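(* Let $\Delta(x)=\sum^*_{n\le x}\Lambda(n)-x$ be the error term in the prime number theorem, let $2s_0=\frac12+i\,14.134\ldots$ be the nontrivial zero of $\zeta(s)$ with least positive imaginary part, and let $\lambda_2=|2s_0|^{-1}$. For a fixed $\epsilon_0$ with $0<\epsilon_0<\lambda_2$ put $$\mathcal A_1=\{x:\Delta(x)>(\lambda_2-\epsilon_0)x^{1/2}\},\qquad\mathcal A_2=\{x:\Delta(x)<(-\lambda_2+\epsilon_0)x^{1/2}\}.$$ Then $$\mu(\mathcal A_j\cap[T,2T])=\Omega\left(T^{1-\epsilon}\right)\qquad\text{for } j=1,2\text{ and for any }\epsilon>0.$$
   Context: $\Lambda$ is the von Mangoldt function. $\sum^*_{n\le x}a_n=\sum_{n\le x}a_n$ if $x\notin\mathbb N$ and $\sum_{n\le x}a_n-\frac12a_x$ if $x\in\mathbb N$. $\mu$ is Lebesgue measure on $\mathbb R$. $f(T)=\Omega(g(T))$ means $\limsup_{T\to\infty}|f(T)|/g(T)>0$. *)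

theory Defs
  imports "HOL-Number_Theory.Prime_Powers" "HOL-Complex_Analysis.Complex_Analysis"
begin

(* The analytic continuation of the Dirichlet series to the punctured plane. It exists and, as the
   punctured plane is connected, is unique there; only the value at the pole 1 is arbitrary. *)
definition zeta :: "complex \<Rightarrow> complex" where
  "zeta = (SOME f. f holomorphic_on (- {1}) \<and>
             (\<forall>s. Re s > 1 \<longrightarrow> (\<lambda>n. of_nat (Suc n) powr (- s)) sums f s))"

(* The point 1 is excluded because the value of zeta there is arbitrary; the trivial zeros are
   -2, -4, -6, ... *)
definition nontrivial_zeta_zero :: "complex \<Rightarrow> bool" where
  "nontrivial_zeta_zero s \<longleftrightarrow>
     s \<noteq> 1 \<and> zeta s = 0 \<and> (\<forall>k::nat. k \<ge> 1 \<longrightarrow> s \<noteq> - of_nat (2 * k))"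

definition sum_star :: "(nat \<Rightarrow> real) \<Rightarrow> real \<Rightarrow> real" where
  "sum_star a x = (\<Sum>n\<in>{1..nat \<lfloor>x\<rfloor>}. a n) -
     (if x \<in> \<nat> - {0} then a (nat \<lfloor>x\<rfloor>) / 2 else 0)"

definition pnt_error :: "real \<Rightarrow> real" where
  "pnt_error x = sum_star mangoldt x - x"

(* The Omega of analytic number theory, i.e. the negation of f = o(g). It is weaker than
   Landau_Symbols.bigomega, which requires a lower bound for all large arguments. *)
definition is_Omega :: "(real \<Rightarrow> real) \<Rightarrow> (real \<Rightarrow> real) \<Rightarrow> bool" where
  "is_Omega f g \<longleftrightarrow> Limsup at_top (\<lambda>T. ereal (\<bar>f T\<bar> / g T)) > 0"

end

theory Submission
  imports Defs "HOL-Probability.Distributions"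
begin

text \<open>
  Write \<open>\<psi>\<close> for the Chebyshev function, put \<open>u = ln x\<close> and \<open>p u = \<psi> (exp u) - exp u\<close> (zero for negative
  \<open>u\<close>), and let \<open>g s = (s - 1) \<zeta>(s)\<close>, an entire function. For \<open>Re s > 1\<close> the Laplace transform of \<open>p\<close>
  is \<open>G s = - (1 + g' s / g s) / s\<close>, so its singularities in the right half plane are the zeros
  of \<open>\<zeta>\<close>. Let \<open>\<theta>\<close> be the supremum of the real parts of the zeros; the zero \<open>\<rho> = 2 s0\<close> gives
  \<open>\<theta> \<ge> 1/2\<close>.

  Suppose one of the two sets has measure at most \<open>T powr (1 - \<epsilon>)\<close> in \<open>[T, 2 T]\<close> for all large \<open>T\<close>,
  and let \<open>B\<close> be its image under \<open>ln\<close>. Let \<open>sg = 1\<close> or \<open>-1\<close> according to the set, and let \<open>c\<close> be the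
  given constant, which is positive and smaller than \<open>1 / |\<rho>|\<close>. Outside \<open>B\<close> the function \<open>c exp (u / 2) - sg p u\<close> is
  nonnegative. On \<open>B\<close> it is not, but its contribution is small: \<open>p u\<close> is \<open>O (exp (a u))\<close> for
  every \<open>a > \<theta>\<close> (lemma \<open>log_pnt_error_bound\<close>), and \<open>exp (\<eta> u)\<close> is integrable over \<open>B\<close> for some
  \<open>\<eta> > 0\<close> (lemma \<open>sparse_dyadic_integrable\<close>), so the Laplace transform of the part over \<open>B\<close> is
  holomorphic in a half plane that contains the line \<open>Re s = \<theta>\<close>. Hence, up to such a harmless
  function, \<open>c / (s - 1/2) - sg G s\<close> is the Laplace transform of a nonnegative function \<open>f\<close>.

  If \<open>\<theta> > 1/2\<close>, this transform is holomorphic at the real point \<open>\<theta>\<close>, since \<open>\<zeta>\<close> has no zeros in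
  \<open>(0, 1)\<close> and the pole at 1 has been removed. By Landau's theorem (lemma
  \<open>landau_oscillation\<close>) the integral then converges to the left of \<open>\<theta>\<close>, so \<open>G\<close> continues there and
  \<open>g\<close>, a solution of \<open>g' = - g (1 + s G)\<close>, has no zeros there, against the choice of \<open>\<theta>\<close>. If
  \<open>\<theta> = 1/2\<close>, nonnegativity of \<open>f\<close> gives
  \<open>|F (\<rho> + \<delta>)| \<le> F (1/2 + \<delta>)\<close> for its transform \<open>F\<close>; multiplied by \<open>\<delta>\<close> and for \<open>\<delta> \<rightarrow> 0\<close> this reads
  \<open>m / |\<rho>| \<le> c\<close>, where \<open>m \<ge> 1\<close> is the multiplicity of \<open>\<rho>\<close>, which contradicts \<open>c < 1 / |\<rho>|\<close>. Lemma
  \<open>pnt_error_not_sparse\<close> carries out both cases.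

  For the bound of \<open>p\<close>, the Borel-Caratheodory argument applied to \<open>g\<close> shows that \<open>g' / g\<close> grows
  more slowly than any power of the imaginary part in \<open>Re s \<ge> a > \<theta>\<close>. The convolution of \<open>p\<close>
  with a Gaussian of tiny width is an absolutely convergent integral of \<open>G\<close> along a vertical line,
  which can be moved from \<open>Re s = 2\<close> to \<open>Re s = a\<close>. Monotonicity of \<open>\<psi>\<close> then turns the bound
  of the convolution into a pointwise one.
\<close>

section \<open>Binomial remainders\<close>

text \<open>The Weierstrass test in a form that asks for the majorants only eventually and near each point.\<close>

lemma holomorphic_series:
  fixes f :: "nat \<Rightarrow> complex \<Rightarrow> complex"
  assumes S: "open S" and f: "\<And>n. f n holomorphic_on S"
    and bd: "\<And>x. x \<in> S \<Longrightarrow> \<exists>d h. 0 < d \<and> summable h \<and> (\<forall>\<^sub>F n in sequentially. \<forall>y\<in>ball x d \<inter> S. norm (f n y) \<le> h n)"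
  shows "(\<lambda>s. \<Sum>n. f n s) holomorphic_on S"
    and "\<And>s. s \<in> S \<Longrightarrow> summable (\<lambda>n. f n s)"
    and "\<And>s. s \<in> S \<Longrightarrow> (\<lambda>n. deriv (f n) s) sums deriv (\<lambda>s. \<Sum>n. f n s) s"
proof -
  have der: "(f n has_field_derivative deriv (f n) x) (at x)" if "x \<in> S" for n x
    by (rule holomorphic_derivI[OF f S that])
  obtain g g' where gg: "\<And>x. x \<in> S \<Longrightarrow> (\<lambda>n. f n x) sums g x \<and> (\<lambda>n. deriv (f n) x) sums g' x \<and> (g has_field_derivative g' x) (at x)"
    using series_and_derivative_comparison_local[OF S der bd] by metis
  have eq: "(\<Sum>n. f n x) = g x" if "x \<in> S" for x using gg[OF that] sums_unique by metis
  have d: "((\<lambda>s. \<Sum>n. f n s) has_field_derivative g' x) (at x)" if x: "x \<in> S" for x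
    using gg[OF x] has_field_derivative_transform_within_open[of g "g' x" x S "\<lambda>s. \<Sum>n. f n s"] S x eq by metis
  show "(\<lambda>s. \<Sum>n. f n s) holomorphic_on S" using d S holomorphic_on_open by blast
  show "summable (\<lambda>n. f n s)" if "s \<in> S" for s using gg[OF that] sums_iff by blast
  show "(\<lambda>n. deriv (f n) s) sums deriv (\<lambda>s. \<Sum>n. f n s) s" if "s \<in> S" for s
    using gg[OF that] d[OF that] by (simp add: DERIV_imp_deriv)
qed

lemma norm_nat_powr: "n > 0 \<Longrightarrow> norm (of_nat n powr (s::complex)) = real n powr Re s"
  using norm_powr_real_powr[of "of_nat n" s] by simp

lemma norm_gbinomial_le:
  assumes "norm (a::complex) \<le> A"
  shows "norm (a gchoose k) \<le> pochhammer A k / fact k"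
proof -
  have "norm (\<Prod>i = 0..<k. a - of_nat i) \<le> (\<Prod>i = 0..<k. A + real i)"
    unfolding prod_norm[symmetric]
  proof (rule prod_mono, safe)
    fix i
    show "norm (a - of_nat i) \<le> A + real i"
      using norm_triangle_ineq4[of a "of_nat i"] assms by simp
  qed simp
  then show ?thesis
    unfolding gbinomial_prod_rev norm_divide pochhammer_prod norm_fact by (simp add: divide_right_mono)
qed

lemma summable_pochhammer_half:
  "summable (\<lambda>k. pochhammer (A::real) k / fact k * (1/2) ^ k)"
proof -
  have "(\<lambda>n. (-A gchoose n) * (-1/2::real) ^ n) sums (1 + -1/2) powr (-A)"
    by (rule gen_binomial_real) auto
  moreover have "(-A gchoose n) * (-1/2::real) ^ n = pochhammer A n / fact n * (1/2) ^ n" for n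
  proof -
    have "(-1/2::real) ^ n = (-1) ^ n * (1/2) ^ n" by (subst power_mult_distrib[symmetric]) simp
    moreover have "(-1::real) ^ n * (-1) ^ n = 1" by (subst power_mult_distrib[symmetric]) simp
    ultimately show ?thesis unfolding gbinomial_pochhammer by (simp add: field_simps)
  qed
  ultimately show ?thesis by (simp add: sums_iff)
qed

lemma pochhammer_nonneg': "0 \<le> (a::real) \<Longrightarrow> 0 \<le> pochhammer a k"
  by (auto simp: pochhammer_prod intro!: prod_nonneg)

text \<open>The remainder of the binomial expansion of \<open>(n + 1) powr (1 - s)\<close> in descending powers of \<open>n\<close>.
Summed over \<open>n\<close>, the terms that are subtracted become multiples of \<open>\<zeta>(s), \<zeta>(s + 1), \<dots>\<close>, and the leading
difference telescopes; this yields a recursion for \<open>\<zeta>\<close>.\<close>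

definition binom_rem :: "nat \<Rightarrow> nat \<Rightarrow> complex \<Rightarrow> complex" where
  "binom_rem M n s = of_nat (Suc n) powr (1 - s)
     - (\<Sum>k\<le>M. ((1 - s) gchoose k) * of_nat n powr (1 - s - of_nat k))"

text \<open>For \<open>n \<ge> 2\<close> the binomial series in \<open>1 / n\<close> converges, and its tail is at most
\<open>(2 / n) ^ (M + 1)\<close> times the series of absolute values at \<open>1 / 2\<close>. The constant depends on \<open>s\<close> only
through a bound of its modulus, as locally uniform convergence requires.\<close>

lemma binom_rem_bound:
  assumes "norm (1 - s) \<le> A" "n \<ge> 2"
  shows "norm (binom_rem M n s) \<le>
     (2 ^ Suc M * (\<Sum>k. pochhammer A k / fact k * (1/2) ^ k)) * real n powr (- Re s - real M)"
proof -
  let ?a = "1 - s" and ?K = "\<Sum>k. pochhammer A k / fact k * (1/2) ^ k"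
  have A: "A \<ge> 0" using assms(1) norm_ge_zero order_trans by blast
  have n0: "of_nat n \<noteq> (0::complex)" "n > 0" using assms by auto
  have S: "(\<lambda>k. (?a gchoose k) * (1 / of_nat n) ^ k) sums (1 + 1 / of_nat n) powr ?a"
    by (rule gen_binomial_complex) (use assms in \<open>auto simp: norm_divide\<close>)
  have e1: "of_nat (Suc n) powr ?a = of_nat n powr ?a * (1 + 1 / of_nat n) powr ?a"
  proof -
    have "of_nat (Suc n) = complex_of_real (real n) * complex_of_real (1 + 1 / real n)"
      using n0 by (simp add: field_simps)
    also have "\<dots> powr ?a = complex_of_real (real n) powr ?a * complex_of_real (1 + 1 / real n) powr ?a"
      by (rule powr_times_real) auto
    finally show ?thesis by simp
  qed
  have e2: "of_nat n powr (?a - of_nat k) = of_nat n powr ?a * (1 / of_nat n) ^ k" for k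
    using n0 by (simp add: powr_diff powr_nat power_divide)
  have e3: "binom_rem M n s = of_nat n powr ?a * ((1 + 1 / of_nat n) powr ?a - (\<Sum>k<Suc M. (?a gchoose k) * (1 / of_nat n) ^ k))"
    unfolding binom_rem_def e1 e2 lessThan_Suc_atMost by (simp add: algebra_simps sum_distrib_left)
  have S': "(\<lambda>k. (?a gchoose (k + Suc M)) * (1 / of_nat n) ^ (k + Suc M)) sums
      ((1 + 1 / of_nat n) powr ?a - (\<Sum>k<Suc M. (?a gchoose k) * (1 / of_nat n) ^ k))"
    using S by (subst sums_iff_shift) (simp only: diff_add_cancel)
  have nk: "(1 / real n) ^ (k + Suc M) \<le> 2 ^ Suc M * real n powr (- real (Suc M)) * (1/2) ^ (k + Suc M)" for k
  proof -
    have p: "(1 / real n) ^ Suc M = real n powr (- real (Suc M))"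
      using n0 by (simp add: powr_minus powr_realpow power_divide inverse_eq_divide del: power_Suc of_nat_Suc)
    have "(1 / real n) ^ k \<le> (1/2) ^ k" by (rule power_mono) (use assms in auto)
    then have "(1 / real n) ^ k * (1 / real n) ^ Suc M \<le> (1/2) ^ k * real n powr (- real (Suc M))"
      unfolding p by (intro mult_right_mono) auto
    moreover have "2 ^ Suc M * c * (1/2) ^ (k + Suc M) = (1/2) ^ k * (c::real)" for c
      by (simp add: power_add power_one_over)
    ultimately show ?thesis by (simp only: power_add)
  qed
  have bd: "norm ((?a gchoose (k + Suc M)) * (1 / of_nat n) ^ (k + Suc M)) \<le>
     2 ^ Suc M * real n powr (- real (Suc M)) * (pochhammer A (k + Suc M) / fact (k + Suc M) * (1/2) ^ (k + Suc M))" for k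
  proof -
    have "norm ((?a gchoose (k + Suc M)) * (1 / of_nat n) ^ (k + Suc M))
      \<le> (pochhammer A (k + Suc M) / fact (k + Suc M)) * (2 ^ Suc M * real n powr (- real (Suc M)) * (1/2) ^ (k + Suc M))"
      unfolding norm_mult norm_power norm_divide norm_one norm_of_nat
      by (intro mult_mono norm_gbinomial_le assms nk) (use A in \<open>auto intro!: divide_nonneg_nonneg pochhammer_nonneg'\<close>)
    then show ?thesis by (simp only: mult_ac)
  qed
  have sk: "summable (\<lambda>k. pochhammer A (k + Suc M) / fact (k + Suc M) * (1/2) ^ (k + Suc M))"
    by (subst summable_iff_shift) (rule summable_pochhammer_half)
  have tail: "(\<Sum>k. pochhammer A (k + Suc M) / fact (k + Suc M) * (1/2) ^ (k + Suc M)) \<le> ?K"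
  proof -
    have "?K = (\<Sum>k. pochhammer A (k + Suc M) / fact (k + Suc M) * (1/2) ^ (k + Suc M)) +
       (\<Sum>k<Suc M. pochhammer A k / fact k * (1/2) ^ k)"
      by (rule suminf_split_initial_segment[OF summable_pochhammer_half])
    moreover have "(\<Sum>k<Suc M. pochhammer A k / fact k * (1/2) ^ k) \<ge> 0"
      by (intro sum_nonneg) (use A pochhammer_nonneg'[of A] in \<open>auto simp del: power_divide\<close>)
    ultimately show ?thesis by linarith
  qed
  have sn: "summable (\<lambda>k. 2 ^ Suc M * real n powr (- real (Suc M)) * (pochhammer A (k + Suc M) / fact (k + Suc M) * (1/2) ^ (k + Suc M)))"
    by (intro summable_mult sk)
  have "norm ((1 + 1 / of_nat n) powr ?a - (\<Sum>k<Suc M. (?a gchoose k) * (1 / of_nat n) ^ k))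
     \<le> (\<Sum>k. 2 ^ Suc M * real n powr (- real (Suc M)) * (pochhammer A (k + Suc M) / fact (k + Suc M) * (1/2) ^ (k + Suc M)))"
    using norm_suminf_le[OF bd sn] sums_unique[OF S'] by simp
  also have "\<dots> = 2 ^ Suc M * real n powr (- real (Suc M)) * (\<Sum>k. (pochhammer A (k + Suc M) / fact (k + Suc M) * (1/2) ^ (k + Suc M)))"
    by (rule suminf_mult[OF sk])
  also have "\<dots> \<le> 2 ^ Suc M * real n powr (- real (Suc M)) * ?K"
    by (intro mult_left_mono tail) auto
  finally have "norm (binom_rem M n s) \<le> real n powr (1 - Re s) * (2 ^ Suc M * real n powr (- real (Suc M)) * ?K)"
    unfolding e3 norm_mult norm_nat_powr[OF n0(2)] by (intro mult_mono) auto
  also have "\<dots> = 2 ^ Suc M * ?K * (real n powr (1 - Re s) * real n powr (- real (Suc M)))"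
    by (simp only: mult_ac)
  also have "real n powr (1 - Re s) * real n powr (- real (Suc M)) = real n powr (- Re s - real M)"
    by (simp flip: powr_add)
  finally show ?thesis .
qed

section \<open>Analytic continuation of the zeta function\<close>

definition zeta_series :: "complex \<Rightarrow> complex" where
  "zeta_series s = (\<Sum>n. of_nat (Suc n) powr (- s))"

lemma open_Re_gt: "open {s. Re s > a}" and convex_Re_gt: "convex {s. Re s > a}"
  and connected_Re_gt: "connected {s. Re s > a}"
  using open_halfspace_Re_gt convex_halfspace_Re_gt convex_connected by blast+

lemma summable_Suc_powr: "a < -1 \<Longrightarrow> summable (\<lambda>n. real (Suc n) powr a)"
  using summable_real_powr_iff[of a] by (subst summable_Suc_iff) simp

lemma abs_Re_diff_ball: "y \<in> ball x d \<Longrightarrow> \<bar>Re y - Re x\<bar> < d"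
  using abs_Re_le_cmod[of "y - x"] by (simp add: dist_norm norm_minus_commute)

lemma dirichlet_series:
  fixes a :: "nat \<Rightarrow> real"
  assumes a: "\<And>x. x > 1 \<Longrightarrow> summable (\<lambda>n. a n * real (Suc n) powr (- x))" and a0: "\<And>n. 0 \<le> a n"
  defines "D \<equiv> \<lambda>s. \<Sum>n. of_real (a n) * of_nat (Suc n) powr (- s) :: complex"
  shows "D holomorphic_on {s. Re s > 1}"
    and "Re s > 1 \<Longrightarrow> (\<lambda>n. of_real (a n) * of_nat (Suc n) powr (- s)) sums D s"
    and "Re s > 1 \<Longrightarrow> (\<lambda>n. - of_real (ln (Suc n)) * (of_real (a n) * of_nat (Suc n) powr (- s))) sums deriv D s"
proof -
  have bd: "\<exists>d h. 0 < d \<and> summable h \<and> (\<forall>\<^sub>F n in sequentially. \<forall>y\<in>ball x d \<inter> {s. Re s > 1}. norm (of_real (a n) * of_nat (Suc n) powr (- y)) \<le> h n)"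
    if "x \<in> {s. Re s > 1}" for x :: complex
  proof (intro exI conjI always_eventually allI ballI)
    let ?d = "(Re x - 1) / 2" and ?h = "\<lambda>n. a n * real (Suc n) powr - ((Re x + 1) / 2)"
    show "0 < ?d" using that by simp
    show "summable ?h" by (rule a) (use that in auto)
    fix n y assume y: "y \<in> ball x ?d \<inter> {s. Re s > 1}"
    then have "\<bar>Re y - Re x\<bar> < ?d" by (intro abs_Re_diff_ball) auto
    then have "- Re y \<le> - ((Re x + 1) / 2)" using abs_ge_minus_self[of "Re y - Re x"] by (simp add: field_simps)
    then have "real (Suc n) powr (- Re y) \<le> real (Suc n) powr - ((Re x + 1) / 2)"
      by (intro powr_mono) auto
    then show "norm (of_real (a n) * of_nat (Suc n) powr (- y)) \<le> ?h n"
      unfolding norm_mult norm_of_real abs_of_nonneg[OF a0] norm_nat_powr[OF zero_less_Suc] uminus_complex.sel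
      by (intro mult_left_mono a0)
  qed
  have hol: "(\<lambda>s. of_real (a n) * of_nat (Suc n) powr (- s)) holomorphic_on {s. Re s > 1}" for n
    by (intro holomorphic_intros)
  note H = holomorphic_series[OF open_Re_gt hol bd]
  show "D holomorphic_on {s. Re s > 1}" unfolding D_def by (rule H(1))
  show "Re s > 1 \<Longrightarrow> (\<lambda>n. of_real (a n) * of_nat (Suc n) powr (- s)) sums D s"
    unfolding D_def using summable_sums[OF H(2)[of s]] by blast
  have d: "deriv (\<lambda>s. of_real (a n) * of_nat (Suc n) powr (- s)) s = - of_real (ln (Suc n)) * (of_real (a n) * of_nat (Suc n) powr (- s))" for n and s :: complex
  proof (rule DERIV_imp_deriv)
    have "((\<lambda>s. of_real (a n) * exp (- s * of_real (ln (Suc n)))) has_field_derivative - of_real (ln (Suc n)) * (of_real (a n) * exp (- s * of_real (ln (Suc n))))) (at s)"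
      by (auto intro!: derivative_eq_intros)
    moreover have "of_nat (Suc n) powr (- s) = exp (- s * of_real (ln (Suc n)))" for s :: complex
      using Ln_of_real[of "real (Suc n)"] by (simp add: powr_def del: of_nat_Suc)
    ultimately show "((\<lambda>s. of_real (a n) * of_nat (Suc n) powr (- s)) has_field_derivative - of_real (ln (Suc n)) * (of_real (a n) * of_nat (Suc n) powr (- s))) (at s)"
      by simp
  qed
  show "Re s > 1 \<Longrightarrow> (\<lambda>n. - of_real (ln (Suc n)) * (of_real (a n) * of_nat (Suc n) powr (- s))) sums deriv D s"
    using H(3)[of s] unfolding d D_def by simp
qed

lemma zeta_series_props:
  shows "zeta_series holomorphic_on {s. Re s > 1}"
    and "Re s > 1 \<Longrightarrow> (\<lambda>n. of_nat (Suc n) powr (- s)) sums zeta_series s"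
    and "Re s > 1 \<Longrightarrow> (\<lambda>n. - of_real (ln (Suc n)) * of_nat (Suc n) powr (- s)) sums deriv zeta_series s"
proof -
  have "summable (\<lambda>n. (1::real) * real (Suc n) powr (- x))" if "x > 1" for x
    unfolding mult_1 by (rule summable_Suc_powr) (use that in simp)
  note D = dirichlet_series[of "\<lambda>_. 1", OF this zero_le_one, unfolded of_real_1 mult_1]
  show "zeta_series holomorphic_on {s. Re s > 1}"
    unfolding zeta_series_def[abs_def] by (rule D(1))
  show "Re s > 1 \<Longrightarrow> (\<lambda>n. of_nat (Suc n) powr (- s)) sums zeta_series s"
    unfolding zeta_series_def by (rule D(2))
  show "Re s > 1 \<Longrightarrow> (\<lambda>n. - of_real (ln (Suc n)) * of_nat (Suc n) powr (- s)) sums deriv zeta_series s"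
    unfolding zeta_series_def[abs_def] by (rule D(3))
qed

lemma holomorphic_gchoose [holomorphic_intros]:
  "f holomorphic_on S \<Longrightarrow> (\<lambda>s. f s gchoose k) holomorphic_on S"
  unfolding gbinomial_prod_rev by (intro holomorphic_intros) auto

text \<open>Each further term of the expansion moves the abscissa of convergence one unit to the left.\<close>

lemma binom_rem_series:
  defines "S \<equiv> \<lambda>M. {s. Re s > 1 - real M}"
  shows "(\<lambda>s. \<Sum>n. binom_rem M (Suc n) s) holomorphic_on S M"
    and "s \<in> S M \<Longrightarrow> summable (\<lambda>n. binom_rem M (Suc n) s)"
proof -
  have bd: "\<exists>d h. 0 < d \<and> summable h \<and> (\<forall>\<^sub>F n in sequentially. \<forall>y\<in>ball x d \<inter> S M. norm (binom_rem M (Suc n) y) \<le> h n)"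
    if "x \<in> S M" for x :: complex
  proof -
    define d where "d = (Re x + M - 1) / 2"
    define C where "C = 2 ^ Suc M * (\<Sum>k. pochhammer (norm (1 - x) + d) k / fact k * (1/2) ^ k)"
    have d: "d > 0" "- (Re x - d) - M < -1" using that by (auto simp: d_def S_def field_simps)
    have C: "C \<ge> 0" unfolding C_def using d
      by (intro mult_nonneg_nonneg suminf_nonneg summable_pochhammer_half) 
         (auto intro!: mult_nonneg_nonneg divide_nonneg_nonneg pochhammer_nonneg' add_nonneg_nonneg simp del: power_divide)
    have "norm (binom_rem M (Suc n) y) \<le> C * real (Suc n) powr (- (Re x - d) - M)"
      if n: "n \<ge> 1" and y: "y \<in> ball x d \<inter> S M" for n y
    proof -
      have "norm (1 - y) \<le> norm (1 - x) + norm (x - y)"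
        using norm_triangle_ineq[of "1 - x" "x - y"] by simp
      also have "\<dots> \<le> norm (1 - x) + d" using y by (auto simp: dist_norm)
      finally have "norm (binom_rem M (Suc n) y) \<le> C * real (Suc n) powr (- Re y - M)"
        unfolding C_def by (intro binom_rem_bound) (use n in auto)
      also have "\<dots> \<le> C * real (Suc n) powr (- (Re x - d) - M)"
        using abs_Re_diff_ball[of y x d] y by (intro mult_left_mono powr_mono C) auto
      finally show ?thesis .
    qed
    then have "\<forall>\<^sub>F n in sequentially. \<forall>y\<in>ball x d \<inter> S M. norm (binom_rem M (Suc n) y) \<le> C * real (Suc n) powr (- (Re x - d) - M)"
      by (intro eventually_sequentiallyI[of 1]) auto
    moreover have "summable (\<lambda>n. C * real (Suc n) powr (- (Re x - d) - M))"
      by (intro summable_mult summable_Suc_powr d)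
    ultimately show ?thesis using d(1) by blast
  qed
  have hol: "binom_rem M (Suc n) holomorphic_on S M" for n
    unfolding binom_rem_def[abs_def] by (intro holomorphic_intros)
  have op: "open (S M)" unfolding S_def by (rule open_Re_gt)
  show "(\<lambda>s. \<Sum>n. binom_rem M (Suc n) s) holomorphic_on S M"
    by (rule holomorphic_series(1)[OF op hol bd])
  show "s \<in> S M \<Longrightarrow> summable (\<lambda>n. binom_rem M (Suc n) s)"
    by (rule holomorphic_series(2)[OF op hol bd])
qed

text \<open>Multiplying by \<open>s + j\<close> in the sum cancels the pole of \<open>\<zeta>(s + j + 1)\<close>: the factor comes from
\<open>(1 - s gchoose (j + 2)) = - (1 - s gchoose (j + 1)) (s + j) / (j + 2)\<close>. The recursion is
therefore one for the pole-free function \<open>(s - 1) \<zeta>(s)\<close>.\<close>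

lemma zeta_series_recursion:
  assumes s: "Re s > 1"
  shows "(\<Sum>n. binom_rem (Suc M) (Suc n) s) =
     -1 + (s - 1) * zeta_series s + (\<Sum>j<M. ((1 - s) gchoose (Suc j)) / (of_nat j + 2) * ((s + of_nat (Suc j) - 1) * zeta_series (s + of_nat (Suc j))))"
proof -
  define h where "h n = of_nat (Suc n) powr (1 - s)" for n
  have "h \<longlonglongrightarrow> 0"
  proof (rule tendsto_norm_zero_cancel)
    have "(\<lambda>n. real (Suc n) powr (1 - Re s)) \<longlonglongrightarrow> 0"
      by (rule LIMSEQ_Suc[where f = "\<lambda>n. real n powr (1 - Re s)"])
         (use s in \<open>auto intro!: tendsto_neg_powr filterlim_real_sequentially\<close>)
    then show "(\<lambda>n. norm (h n)) \<longlonglongrightarrow> 0"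
      unfolding h_def norm_nat_powr[OF zero_less_Suc] by simp
  qed
  then have tel: "(\<lambda>n. h (Suc n) - h n) sums (0 - h 0)"
    by (rule telescope_sums)
  have z: "(\<lambda>n. ((1 - s) gchoose Suc k) * of_nat (Suc n) powr (- (s + of_nat k))) sums
      (((1 - s) gchoose Suc k) * zeta_series (s + of_nat k))" for k
    by (intro sums_mult zeta_series_props) (use s in auto)
  have zs: "(\<lambda>n. \<Sum>k<Suc M. ((1 - s) gchoose Suc k) * of_nat (Suc n) powr (- (s + of_nat k))) sums
      (\<Sum>k<Suc M. ((1 - s) gchoose Suc k) * zeta_series (s + of_nat k))"
    by (intro sums_sum z)
  have rem: "binom_rem (Suc M) (Suc n) s = (h (Suc n) - h n) - (\<Sum>k<Suc M. ((1 - s) gchoose Suc k) * of_nat (Suc n) powr (- (s + of_nat k)))" for n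
  proof -
    have "1 - s - of_nat (Suc k) = - (s + of_nat k)" for k by simp
    then show ?thesis
      unfolding binom_rem_def h_def sum.atMost_shift by (simp only: gbinomial_0 of_nat_0 diff_zero mult_1) simp
  qed
  have "(\<lambda>n. binom_rem (Suc M) (Suc n) s) sums (0 - h 0 - (\<Sum>k<Suc M. ((1 - s) gchoose Suc k) * zeta_series (s + of_nat k)))"
    unfolding rem by (intro sums_diff tel zs)
  then have "(\<Sum>n. binom_rem (Suc M) (Suc n) s) = -1 - (\<Sum>k<Suc M. ((1 - s) gchoose Suc k) * zeta_series (s + of_nat k))"
    by (simp add: sums_iff h_def)
  also have "(\<Sum>k<Suc M. ((1 - s) gchoose Suc k) * zeta_series (s + of_nat k)) =
     (1 - s) * zeta_series s + (\<Sum>j<M. ((1 - s) gchoose Suc (Suc j)) * zeta_series (s + of_nat (Suc j)))"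
    by (subst sum.lessThan_Suc_shift) simp
  also have "(\<Sum>j<M. ((1 - s) gchoose Suc (Suc j)) * zeta_series (s + of_nat (Suc j))) =
    - (\<Sum>j<M. ((1 - s) gchoose (Suc j)) / (of_nat j + 2) * ((s + of_nat (Suc j) - 1) * zeta_series (s + of_nat (Suc j))))"
    unfolding sum_negf[symmetric]
  proof (rule sum.cong[OF refl])
    fix j
    have nz: "of_nat j + 2 \<noteq> (0::complex)"
      by (metis of_nat_Suc of_nat_eq_0_iff add_2_eq_Suc' nat.distinct(1) of_nat_add of_nat_numeral)
    have "of_nat (Suc (Suc j)) * ((1 - s) gchoose Suc (Suc j)) = ((1 - s) - of_nat (Suc j)) * ((1 - s) gchoose Suc j)"
      using gbinomial_mult_1[of "1 - s" "Suc j"] by (simp only: left_diff_distrib mult.commute) algebra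
    then have "((1 - s) gchoose Suc (Suc j)) * (of_nat j + 2) = - ((1 - s) gchoose (Suc j)) * (s + of_nat (Suc j) - 1)"
      unfolding of_nat_Suc by algebra
    then have "((1 - s) gchoose Suc (Suc j)) = (- ((1 - s) gchoose (Suc j)) * (s + of_nat (Suc j) - 1)) / (of_nat j + 2)"
      by (rule eq_divide_imp[OF nz])
    then show "((1 - s) gchoose Suc (Suc j)) * zeta_series (s + of_nat (Suc j)) =
      - (((1 - s) gchoose (Suc j)) / (of_nat j + 2) * ((s + of_nat (Suc j) - 1) * zeta_series (s + of_nat (Suc j))))"
      by simp
  qed
  finally show ?thesis by (simp add: algebra_simps)
qed

text \<open>The recursion expresses the function at \<open>s\<close> by its values at \<open>s + 1, s + 2, \<dots>\<close>, where it is known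
by induction.\<close>

lemma continuation_half_plane:
  "\<exists>g. g holomorphic_on {s. Re s > 1 - real m} \<and> (\<forall>s. Re s > 1 \<longrightarrow> g s = (s - 1) * zeta_series s)"
proof (induction m)
  case 0
  show ?case by (rule exI[of _ "\<lambda>s. (s - 1) * zeta_series s"]) (auto intro!: holomorphic_intros zeta_series_props)
next
  case (Suc m)
  then obtain g where g: "g holomorphic_on {s. Re s > 1 - real m}" "\<And>s. Re s > 1 \<Longrightarrow> g s = (s - 1) * zeta_series s"
    by blast
  define g' where "g' s = 1 + (\<Sum>n. binom_rem (Suc m) (Suc n) s) -
      (\<Sum>j<m. ((1 - s) gchoose (Suc j)) / (of_nat j + 2) * g (s + of_nat (Suc j)))" for s
  have gs: "(\<lambda>s. g (s + of_nat (Suc j))) holomorphic_on {s. Re s > 1 - real (Suc m)}" for j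
    by (rule holomorphic_on_compose_gen[OF _ g(1), unfolded o_def]) (auto intro!: holomorphic_intros)
  have nz: "of_nat j + 2 \<noteq> (0::complex)" for j
      by (metis of_nat_Suc of_nat_eq_0_iff add_2_eq_Suc' nat.distinct(1) of_nat_add of_nat_numeral)
  have "g' holomorphic_on {s. Re s > 1 - real (Suc m)}"
    unfolding g'_def[abs_def] by (intro holomorphic_intros binom_rem_series gs nz)
  moreover have "g' s = (s - 1) * zeta_series s" if "Re s > 1" for s
    unfolding g'_def zeta_series_recursion[OF that] using that by (simp add: g(2))
  ultimately show ?case by blast
qed

lemma entire_continuation:
  "\<exists>g. g holomorphic_on UNIV \<and> (\<forall>s. Re s > 1 \<longrightarrow> g s = (s - 1) * zeta_series s)"
proof -
  obtain g where g: "\<And>m. g m holomorphic_on {s. Re s > 1 - real m}"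
     "\<And>m s. Re s > 1 \<Longrightarrow> g m s = (s - 1) * zeta_series s"
    using continuation_half_plane by metis
  have agree: "g m s = g n s" if "m \<le> n" "Re s > 1 - real m" for m n s
  proof (rule analytic_continuation_open[of "{s. Re s > 1}" "{s. Re s > 1 - real m}" "g m" "g n"])
    show "g n holomorphic_on {s. Re s > 1 - real m}"
      by (rule holomorphic_on_subset[OF g(1)]) (use that in auto)
    show "{s. 1 < Re s} \<noteq> {}" by (auto intro: exI[of _ 2])
  qed (use that g in \<open>auto intro: open_Re_gt connected_Re_gt\<close>)
  define G where "G s = g (nat \<lceil>2 - Re s\<rceil>) s" for s
  have G: "G s = g n s" if "Re s > 1 - real n" for n s
    unfolding G_def using agree[of n "nat \<lceil>2 - Re s\<rceil>" s] agree[of "nat \<lceil>2 - Re s\<rceil>" n s] that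
    by (cases "n \<le> nat \<lceil>2 - Re s\<rceil>") (auto, linarith)
  have "G field_differentiable at z" for z
  proof -
    define n where "n = nat \<lceil>2 - Re z\<rceil>"
    have z: "z \<in> {s. Re s > 1 - real n}" unfolding n_def by simp linarith
    have "G holomorphic_on {s. Re s > 1 - real n}"
      using g(1)[of n] by (rule holomorphic_transform) (simp add: G)
    then show ?thesis using z open_Re_gt holomorphic_on_imp_differentiable_at by blast
  qed
  then have "G holomorphic_on UNIV" by (simp add: holomorphic_on_def)
  moreover have "G s = (s - 1) * zeta_series s" if "Re s > 1" for s
    using G[of 0 s] g(2)[OF that, of 0] that by simp
  ultimately show ?thesis by blast
qed

text \<open>The continuation exists, so the choice operator in the definition of \<open>zeta\<close> picks a function with the
intended properties.\<close>

lemma zeta_spec: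
  shows "zeta holomorphic_on (- {1})"
    and "Re s > 1 \<Longrightarrow> (\<lambda>n. of_nat (Suc n) powr (- s)) sums zeta s"
proof -
  obtain g where g: "g holomorphic_on UNIV" "\<And>s. Re s > 1 \<Longrightarrow> g s = (s - 1) * zeta_series s"
    using entire_continuation by blast
  have "(\<lambda>s. g s / (s - 1)) holomorphic_on (- {1})"
    by (intro holomorphic_intros holomorphic_on_subset[OF g(1)]) auto
  moreover have "\<forall>s. Re s > 1 \<longrightarrow> (\<lambda>n. of_nat (Suc n) powr (- s)) sums (g s / (s - 1))"
  proof safe
    fix s assume s: "Re s > 1"
    then have "g s / (s - 1) = zeta_series s" using g(2)[OF s] by auto
    then show "(\<lambda>n. of_nat (Suc n) powr (- s)) sums (g s / (s - 1))" using zeta_series_props(2)[OF s] by simp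
  qed
  ultimately have "\<exists>f. f holomorphic_on (- {1}) \<and>
             (\<forall>s. Re s > 1 \<longrightarrow> (\<lambda>n. of_nat (Suc n) powr (- s)) sums f s)" by blast
  from someI_ex[OF this] show "zeta holomorphic_on (- {1})"
    and "Re s > 1 \<Longrightarrow> (\<lambda>n. of_nat (Suc n) powr (- s)) sums zeta s"
    unfolding zeta_def by auto
qed

text \<open>At 1 the value 1 is the limit of \<open>(s - 1) \<zeta>(s)\<close>, so that this function is entire.\<close>

definition zeta_reg :: "complex \<Rightarrow> complex" where
  "zeta_reg s = (if s = 1 then 1 else (s - 1) * zeta s)"

lemma zeta_eq_series: "Re s > 1 \<Longrightarrow> zeta s = zeta_series s"
  using zeta_spec(2) zeta_series_props(2) sums_unique2 by blast

lemma zeta_reg_recursion: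
  assumes "Re s > 1" shows "zeta_reg s = 1 + (\<Sum>n. binom_rem 1 (Suc n) s)"
  using zeta_series_recursion[OF assms, of 0] assms by (auto simp: zeta_reg_def zeta_eq_series)

text \<open>The recursion with a single subtracted term, which is valid in the half plane \<open>Re s > 0\<close>.\<close>

lemma zeta_reg_eq:
  assumes "Re s > 0" shows "zeta_reg s = 1 + (\<Sum>n. binom_rem 1 (Suc n) s)"
proof -
  let ?g = "\<lambda>s. 1 + (\<Sum>n. binom_rem 1 (Suc n) s)"
  have hol: "?g holomorphic_on {s. Re s > 0}"
    using binom_rem_series(1)[of 1] by (auto intro!: holomorphic_intros)
  have one: "binom_rem (Suc 0) n 1 = 0" if "n > 0" for n
    using that by (simp add: binom_rem_def del: of_nat_Suc)
  have op: "open ({s. Re s > 0} - {1})" by (intro open_Diff open_Re_gt) auto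
  have con: "connected ({s. Re s > 0} - {1::complex})"
    by (rule connected_open_delete[OF open_Re_gt connected_Re_gt]) simp
  have "(s - 1) * zeta s = ?g s" if "s \<in> {s. Re s > 0} - {1}" for s
  proof (rule analytic_continuation_open[of "{s. Re s > 1}" "{s. Re s > 0} - {1}" "\<lambda>s. (s - 1) * zeta s" ?g])
    show "(\<lambda>s. (s - 1) * zeta s) holomorphic_on {s. Re s > 0} - {1}"
      by (intro holomorphic_intros holomorphic_on_subset[OF zeta_spec(1)]) auto
    show "?g holomorphic_on {s. Re s > 0} - {1}" by (rule holomorphic_on_subset[OF hol]) auto
    show "{s. 1 < Re s} \<noteq> {}" by (auto intro: exI[of _ 2])
    show "open {s. 1 < Re s}" by (rule open_Re_gt)
    show "(z - 1) * zeta z = ?g z" if "z \<in> {s. Re s > 1}" for z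
      using zeta_reg_recursion[of z] that by (auto simp: zeta_reg_def split: if_splits)
  qed (use op con that in auto)
  then show ?thesis using assms by (auto simp: zeta_reg_def one)
qed

lemma zeta_reg_holomorphic: "zeta_reg holomorphic_on UNIV"
proof -
  have "zeta_reg holomorphic_on (- {1})"
    by (rule holomorphic_transform[of "\<lambda>s. (s - 1) * zeta s"])
       (auto intro!: holomorphic_intros zeta_spec simp: zeta_reg_def)
  moreover have "zeta_reg holomorphic_on {s. Re s > 0}"
    using binom_rem_series(1)[of 1]
    by (intro holomorphic_transform[of "\<lambda>s. 1 + (\<Sum>n. binom_rem 1 (Suc n) s)" _ zeta_reg])
       (auto intro!: holomorphic_intros simp: zeta_reg_eq)
  ultimately have "zeta_reg holomorphic_on (- {1} \<union> {s. Re s > 0})"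
    by (subst holomorphic_on_Un) (auto intro: open_Re_gt)
  moreover have "- {1} \<union> {s. Re s > 0} = (UNIV :: complex set)" by auto
  ultimately show ?thesis by simp
qed

text \<open>Each remainder is the integral of \<open>(1 - s) (t powr (-s) - n powr (-s))\<close> over \<open>[n, n + 1]\<close>, and the mean
value inequality bounds it by \<open>|1 - s| |s| n powr (-3/2)\<close>.\<close>

lemma zeta_reg_growth:
  "\<exists>C>0. \<forall>s. Re s \<ge> 1/2 \<longrightarrow> norm (zeta_reg s) \<le> C * (1 + norm s) ^ 2"
proof -
  have rem: "norm (binom_rem 1 (Suc n) s) \<le> norm (1 - s) * norm s * real (Suc n) powr (-3/2)"
    if s: "Re s \<ge> 1/2" for s n
  proof (cases "s = 1")
    case True
    then show ?thesis by (simp add: binom_rem_def del: of_nat_Suc)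
  next
    case False
    let ?f = "\<lambda>t::complex. t powr (1 - s) - (1 - s) * t * of_nat (Suc n) powr (-s)"
    let ?I = "closed_segment (of_nat (Suc n)) (of_nat (Suc (Suc n))) :: complex set"
    define b where "b = norm (1 - s) * (norm s * real (Suc n) powr (-3/2))"
    have I: "?I = of_real ` {real (Suc n)..real (Suc (Suc n))}"
      using closed_segment_of_real[of "real (Suc n)" "real (Suc (Suc n))"]
      by (simp add: closed_segment_eq_real_ivl)
    have J: "t \<notin> \<real>\<^sub>\<le>\<^sub>0" "t \<noteq> 0" "Re t \<ge> real (Suc n)" "Im t = 0" "norm (t - of_nat (Suc n)) \<le> 1" if "t \<in> ?I" for t
    proof -
      from that obtain r where "t = of_real r" "r \<in> {real (Suc n)..real (Suc (Suc n))}" unfolding I by (rule imageE)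
      then have r: "t = of_real r" "real (Suc n) \<le> r" "r \<le> real (Suc n) + 1" by auto
      have "t - of_nat (Suc n) = of_real (r - real (Suc n))" using r by simp
      then have "norm (t - of_nat (Suc n)) = \<bar>r - real (Suc n)\<bar>" by (metis norm_of_real)
      with r show "t \<notin> \<real>\<^sub>\<le>\<^sub>0" "t \<noteq> 0" "Re t \<ge> real (Suc n)" "Im t = 0" "norm (t - of_nat (Suc n)) \<le> 1"
        by (auto simp: complex_nonpos_Reals_iff)
    qed
    have nt: "norm (t powr (-s-1)) \<le> real (Suc n) powr (-3/2)" if "t \<in> ?I" for t
    proof -
      have "norm (t powr (-s-1)) = Re t powr (- Re s - 1)"
        using J[OF that] by (subst norm_powr_real_powr) (auto simp: complex_is_Real_iff)
      also have "\<dots> \<le> Re t powr (-3/2)" by (rule powr_mono) (use s J[OF that] in auto)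
      also have "\<dots> \<le> real (Suc n) powr (-3/2)"
        by (rule powr_mono2') (use J[OF that] in auto)
      finally show ?thesis .
    qed
    have d1: "norm (t powr (-s) - of_nat (Suc n) powr (-s)) \<le> norm s * real (Suc n) powr (-3/2)" if t: "t \<in> ?I" for t
    proof -
      have "norm (t powr (-s) - of_nat (Suc n) powr (-s)) \<le> (norm s * real (Suc n) powr (-3/2)) * norm (t - of_nat (Suc n))"
      proof (rule field_differentiable_bound[where S = ?I and f' = "\<lambda>t. -s * t powr (-s-1)"])
        fix z assume z: "z \<in> ?I"
        show "((\<lambda>t. t powr - s) has_field_derivative - s * z powr (- s - 1)) (at z within ?I)"
          using J[OF z] by (auto intro!: derivative_eq_intros)
        show "norm (- s * z powr (- s - 1)) \<le> norm s * real (Suc n) powr (-3/2)"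
          using nt[OF z] by (simp add: norm_mult mult_left_mono)
      qed (use t in auto)
      also have "\<dots> \<le> (norm s * real (Suc n) powr (-3/2)) * 1"
        by (intro mult_left_mono J[OF t]) auto
      finally show ?thesis by simp
    qed
    have "norm (?f (of_nat (Suc (Suc n))) - ?f (of_nat (Suc n))) \<le> b * norm (of_nat (Suc (Suc n)) - of_nat (Suc n) :: complex)"
    proof (rule field_differentiable_bound[where S = ?I and f' = "\<lambda>t. (1 - s) * (t powr (-s) - of_nat (Suc n) powr (-s))"])
      fix z assume z: "z \<in> ?I"
      show "(?f has_field_derivative (1 - s) * (z powr (-s) - of_nat (Suc n) powr (-s))) (at z within ?I)"
        using J[OF z] by (auto intro!: derivative_eq_intros simp: algebra_simps)
      show "norm ((1 - s) * (z powr (-s) - of_nat (Suc n) powr (-s))) \<le> b"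
        unfolding b_def norm_mult by (intro mult_left_mono d1 z) auto
    qed auto
    moreover have "?f (of_nat (Suc (Suc n))) - ?f (of_nat (Suc n)) = binom_rem 1 (Suc n) s"
      by (simp add: binom_rem_def algebra_simps)
    ultimately show ?thesis by (simp add: b_def mult_ac)
  qed
  define K where "K = (\<Sum>n. real (Suc n) powr (-3/2))"
  have sK: "summable (\<lambda>n. real (Suc n) powr (-3/2))" by (rule summable_Suc_powr) simp
  have K: "K \<ge> 0" unfolding K_def by (rule suminf_nonneg[OF sK]) simp
  have "norm (zeta_reg s) \<le> (1 + K) * (1 + norm s) ^ 2" if s: "Re s \<ge> 1/2" for s
  proof -
    have "norm (\<Sum>n. binom_rem 1 (Suc n) s) \<le> (\<Sum>n. norm (1 - s) * norm s * real (Suc n) powr (-3/2))"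
      by (intro norm_suminf_le rem s summable_mult sK)
    also have "\<dots> = norm (1 - s) * norm s * K" unfolding K_def by (rule suminf_mult[OF sK])
    also have "\<dots> \<le> (1 + norm s) * (1 + norm s) * K"
      using norm_triangle_ineq4[of 1 s] by (intro mult_mono K) auto
    finally have "norm (zeta_reg s) \<le> 1 + (1 + norm s) ^ 2 * K"
      using zeta_reg_eq[of s] s norm_triangle_ineq[of 1 "\<Sum>n. binom_rem 1 (Suc n) s"] by (simp add: power2_eq_square)
    moreover have "1 \<le> (1 + norm s) ^ 2" by simp
    ultimately have "norm (zeta_reg s) \<le> (1 + norm s) ^ 2 + (1 + norm s) ^ 2 * K" by linarith
    then show ?thesis by (simp only: distrib_right mult_1 mult.commute)
  qed
  then show ?thesis using K by (intro exI[of _ "1 + K"]) auto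
qed

text \<open>For real \<open>x\<close> in \<open>(0, 1)\<close> the remainders are bounded below by the terms of a telescoping series with
sum \<open>x - 1\<close>, so \<open>(x - 1) \<zeta>(x) \<ge> x > 0\<close>.\<close>

lemma zeta_reg_real_nonzero:
  assumes "0 < x" "x \<le> (1::real)" shows "zeta_reg (of_real x) \<noteq> 0"
proof (cases "x = 1")
  case True then show ?thesis by (simp add: zeta_reg_def)
next
  case False
  with assms have x: "0 < x" "x < 1" by auto
  define r where "r n = real (Suc (Suc n)) powr (1 - x) - real (Suc n) powr (1 - x) - (1 - x) * real (Suc n) powr (-x)" for n
  have p: "of_nat (Suc n) powr (of_real a :: complex) = of_real (real (Suc n) powr a)" for n a
    using powr_of_real[of "real (Suc n)" a] by simp
  have r: "binom_rem 1 (Suc n) (of_real x) = of_real (r n)" for n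
    unfolding binom_rem_def r_def using p[of n "1-x"] p[of n "-x"] p[of "Suc n" "1-x"] by simp
  have "complex_of_real x \<in> {s. Re s > 1 - real 1}" using x by simp
  then have "summable (\<lambda>n. binom_rem 1 (Suc n) (of_real x))" by (rule binom_rem_series(2))
  then have sr: "summable r" unfolding r summable_complex_of_real .
  have e: "zeta_reg (of_real x) = of_real (1 + suminf r)"
    using zeta_reg_eq[of "of_real x", unfolded r] x by (simp add: suminf_of_real[OF sr])
  let ?q = "\<lambda>n. real (Suc n) powr (-x)"
  have "(\<lambda>n. real n powr (-x)) \<longlonglongrightarrow> 0"
    using x by (intro tendsto_neg_powr filterlim_real_sequentially) auto
  then have "?q \<longlonglongrightarrow> 0" by (rule LIMSEQ_Suc)
  from sums_mult[OF telescope_sums[OF this], of "1 - x"]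
  have q: "(\<lambda>n. (1 - x) * (?q (Suc n) - ?q n)) sums ((1 - x) * (0 - ?q 0))" .
  have "(1 - x) * (?q (Suc n) - ?q n) \<le> r n" for n
  proof -
    have "\<exists>z>real (Suc n). z < real (Suc (Suc n)) \<and>
       real (Suc (Suc n)) powr (1 - x) - real (Suc n) powr (1 - x) = (real (Suc (Suc n)) - real (Suc n)) * ((1 - x) * z powr (-x))"
      by (rule MVT2) (auto intro!: derivative_eq_intros)
    then obtain z where z: "z > real (Suc n)" "z < real (Suc (Suc n))"
       "real (Suc (Suc n)) powr (1 - x) - real (Suc n) powr (1 - x) = (1 - x) * z powr (-x)" by auto
    have "?q (Suc n) \<le> z powr (-x)" by (rule powr_mono2') (use x z in auto)
    then have "(1 - x) * ?q (Suc n) \<le> (1 - x) * z powr (-x)" using x by (intro mult_left_mono) auto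
    then show ?thesis unfolding r_def using z(3) by (simp only: right_diff_distrib) 
  qed
  then have "(1 - x) * (0 - ?q 0) \<le> suminf r"
    using q sr by (intro sums_le[OF _ q summable_sums[OF sr]])
  then have "1 + suminf r > 0" using x by simp
  then show ?thesis unfolding e by (metis of_real_eq_0_iff less_irrefl)
qed

section \<open>The Dirichlet series of the von Mangoldt function\<close>

lemma has_sum_Suc_iff: "((\<lambda>n. f (Suc n)) has_sum S) UNIV \<longleftrightarrow> (f has_sum S) {0<..}"
proof -
  have "bij_betw Suc UNIV {0<..}"
    by (rule bij_betwI[of _ _ _ "\<lambda>n. n - 1"]) auto
  then show ?thesis by (rule has_sum_reindex_bij_betw)
qed

lemma powr_nat_mult: "of_nat (d * m) powr (s::complex) = of_nat d powr s * of_nat m powr s"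
  using powr_times_real[of "of_nat d" "of_nat m" s] by simp

definition mangoldt_series :: "complex \<Rightarrow> complex" where
  "mangoldt_series s = (\<Sum>n. mangoldt (Suc n) * of_nat (Suc n) powr (- s))"

lemma summable_ln_powr: 
  assumes "x > 1" shows "summable (\<lambda>n. ln (Suc n) * real (Suc n) powr (- x))"
proof -
  have "(\<lambda>n. - of_real (ln (Suc n)) * of_nat (Suc n) powr (- of_real x)) sums deriv zeta_series (of_real x)"
    by (rule zeta_series_props) (use assms in simp)
  moreover have "- of_real (ln (Suc n)) * of_nat (Suc n) powr (- of_real x) = complex_of_real (- (ln (Suc n) * real (Suc n) powr (-x)))" for n
    using powr_of_real[of "real (Suc n)" "-x"] by (simp del: of_nat_Suc)
  ultimately have "(\<lambda>n. complex_of_real (- (ln (Suc n) * real (Suc n) powr (-x)))) sums deriv zeta_series (of_real x)"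
    by (simp only:)
  then have "summable (\<lambda>n. complex_of_real (- (ln (Suc n) * real (Suc n) powr (-x))))"
    by (rule sums_summable)
  then show ?thesis unfolding summable_complex_of_real summable_minus_iff .
qed

lemma norm_mangoldt_term:
  "norm (mangoldt (Suc n) * of_nat (Suc n) powr (- s :: complex)) = mangoldt (Suc n) * real (Suc n) powr (- Re s)"
  unfolding norm_mult norm_mangoldt norm_nat_powr[OF zero_less_Suc] by simp

lemma summable_mangoldt_powr:
  assumes "x > 1" shows "summable (\<lambda>n. mangoldt (Suc n) * real (Suc n) powr (- x))"
proof (rule summable_comparison_test'[OF summable_ln_powr[OF assms], of 0])
  fix n
  show "norm (mangoldt (Suc n) * real (Suc n) powr (- x)) \<le> ln (Suc n) * real (Suc n) powr (- x)"
    using mangoldt_le[of "Suc n"] mangoldt_nonneg[of "Suc n"] by (simp add: mult_right_mono)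
qed

lemma mangoldt_series_props:
  shows "mangoldt_series holomorphic_on {s. Re s > 1}"
    and "Re s > 1 \<Longrightarrow> (\<lambda>n. mangoldt (Suc n) * of_nat (Suc n) powr (- s)) sums mangoldt_series s"
proof -
  note D = dirichlet_series[of "\<lambda>n. mangoldt (Suc n)", OF summable_mangoldt_powr mangoldt_nonneg, unfolded of_real_mangoldt]
  show "mangoldt_series holomorphic_on {s. Re s > 1}"
    unfolding mangoldt_series_def[abs_def] by (rule D(1))
  show "Re s > 1 \<Longrightarrow> (\<lambda>n. mangoldt (Suc n) * of_nat (Suc n) powr (- s)) sums mangoldt_series s"
    unfolding mangoldt_series_def by (rule D(2))
qed

lemma summable_on_normI:
  assumes "summable (\<lambda>n. norm (c (Suc n)))"
  shows "(\<lambda>n. norm (c n)) summable_on {0<..}"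
proof -
  have "((\<lambda>n. norm (c (Suc n))) has_sum (\<Sum>n. norm (c (Suc n)))) UNIV"
    by (rule norm_summable_imp_has_sum) (use assms in \<open>simp_all add: summable_sums\<close>)
  then have "((\<lambda>n. norm (c n)) has_sum (\<Sum>n. norm (c (Suc n)))) {0<..}"
    by (rule iffD1[OF has_sum_Suc_iff[of "\<lambda>n. norm (c n)"]])
  then show ?thesis by (rule has_sum_imp_summable)
qed

text \<open>This is the Dirichlet convolution \<open>\<Lambda> * 1 = ln\<close>: the product of the two series is rearranged along the
divisors of \<open>n\<close>.\<close>

lemma deriv_zeta_series:
  assumes s: "Re s > 1"
  shows "deriv zeta_series s = - (zeta_series s * mangoldt_series s)"
proof -
  define a b :: "nat \<Rightarrow> complex" where "a n = mangoldt n * of_nat n powr (- s)" and "b n = of_nat n powr (- s)" for n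
  have sa: "summable (\<lambda>n. norm (a (Suc n)))"
    unfolding a_def norm_mangoldt_term by (rule summable_mangoldt_powr[OF s])
  have sb: "summable (\<lambda>n. norm (b (Suc n)))"
    unfolding b_def norm_nat_powr[OF zero_less_Suc] by (rule summable_Suc_powr) (use s in simp)
  have a: "(a has_sum mangoldt_series s) {0<..}"
    unfolding has_sum_Suc_iff[symmetric] 
    by (rule norm_summable_imp_has_sum[OF sa]) (unfold a_def, rule mangoldt_series_props(2)[OF s])
  have b: "(b has_sum zeta_series s) {0<..}"
    unfolding has_sum_Suc_iff[symmetric] 
    by (rule norm_summable_imp_has_sum[OF sb]) (unfold b_def, rule zeta_series_props(2)[OF s])
  have na: "(\<lambda>n. norm (a n)) summable_on {0<..}" and nb: "(\<lambda>n. norm (b n)) summable_on {0<..}"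
    by (rule summable_on_normI[OF sa], rule summable_on_normI[OF sb])
  define f where "f x = a (fst x) * b (snd x)" for x
  have "(\<lambda>x. norm (f x)) summable_on ({0<..} \<times> {0<..})"
    unfolding Infinite_Sum.abs_summable_on_Sigma_iff
  proof (intro conjI ballI)
    fix d
    show "(\<lambda>m. norm (f (d, m))) summable_on {0<..}"
      using summable_on_cmult_right[OF nb, of "norm (a d)"] by (simp add: f_def norm_mult)
  next
    have "(\<Sum>\<^sub>\<infinity>m\<in>{0<..}. norm (f (d, m))) = norm (a d) * (\<Sum>\<^sub>\<infinity>m\<in>{0<..}. norm (b m))" for d
      by (simp add: f_def norm_mult infsum_cmult_right')
    moreover have "(\<Sum>\<^sub>\<infinity>m\<in>{0<..}. norm (b m)) \<ge> 0" by (rule infsum_nonneg) simp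
    ultimately show "(\<lambda>d. norm (\<Sum>\<^sub>\<infinity>m\<in>{0<..}. norm (f (d, m)))) summable_on {0<..}"
      using summable_on_cmult_left[OF na, of "\<Sum>\<^sub>\<infinity>m\<in>{0<..}. norm (b m)"] by (simp add: abs_mult)
  qed
  then have "f summable_on ({0<..} \<times> {0<..})"
    by (rule Infinite_Sum.abs_summable_summable[of f])
  then obtain T where T: "(f has_sum T) ({0<..} \<times> {0<..})"
    unfolding summable_on_def by blast
  have "((\<lambda>d. a d * zeta_series s) has_sum T) {0<..}"
    by (rule has_sum_SigmaD[OF T]) (unfold f_def fst_conv snd_conv, rule has_sum_cmult_right[OF b])
  moreover have "((\<lambda>d. a d * zeta_series s) has_sum (mangoldt_series s * zeta_series s)) {0<..}"
    by (rule has_sum_cmult_left[OF a])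
  ultimately have T1: "T = mangoldt_series s * zeta_series s" by (rule has_sum_unique)
  have bij: "bij_betw (\<lambda>(n, d). (d, n div d)) (Sigma {0<..} (\<lambda>n. {d. d dvd n})) ({0<..} \<times> {0<..} :: (nat \<times> nat) set)"
    by (rule bij_betwI[of _ _ _ "\<lambda>(d, m). (d * m, d)"]) (auto intro: Nat.gr0I)
  have "((\<lambda>x. f ((\<lambda>(n, d). (d, n div d)) x)) has_sum T) (Sigma {0<..} (\<lambda>n. {d. d dvd n}))"
    unfolding has_sum_reindex_bij_betw[OF bij] by (rule T)
  then have "((\<lambda>n. \<Sum>d | d dvd n. a d * b (n div d)) has_sum T) {0<..}"
  proof (rule has_sum_SigmaD)
    fix n :: nat assume "n \<in> {0<..}"
    then have "finite {d. d dvd n}" by simp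
    then show "((\<lambda>d. f (case (n, d) of (n, d) \<Rightarrow> (d, n div d))) has_sum (\<Sum>d | d dvd n. a d * b (n div d))) {d. d dvd n}"
      unfolding f_def prod.case fst_conv snd_conv by (rule has_sum_finite)
  qed
  also have "(\<Sum>d | d dvd n. a d * b (n div d)) = of_real (ln n) * of_nat n powr (- s)" if "n > 0" for n
  proof -
    have "(\<Sum>d | d dvd n. a d * b (n div d)) = (\<Sum>d | d dvd n. mangoldt d * of_nat n powr (- s))"
    proof (rule sum.cong[OF refl])
      fix d assume "d \<in> {d. d dvd n}"
      then have "of_nat n powr (- s) = of_nat d powr (- s) * of_nat (n div d) powr (- s)"
        by (subst powr_nat_mult[symmetric]) simp
      then show "a d * b (n div d) = mangoldt d * of_nat n powr (- s)" by (simp add: a_def b_def)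
    qed
    also have "\<dots> = of_real (ln n) * of_nat n powr (- s)"
      using mangoldt_sum[of n] that by (simp flip: sum_distrib_right)
    finally show ?thesis .
  qed
  then have "((\<lambda>n. \<Sum>d | d dvd n. a d * b (n div d)) has_sum T) {0<..} \<longleftrightarrow> 
     ((\<lambda>n. of_real (ln n) * of_nat n powr (- s)) has_sum T) {0<..}"
    by (intro has_sum_cong) auto
  finally have "((\<lambda>n. of_real (ln (Suc n)) * of_nat (Suc n) powr (- s)) has_sum T) UNIV"
    using has_sum_Suc_iff[of "\<lambda>n. of_real (ln (real n)) * of_nat n powr (- s)"] by blast
  then have "(\<lambda>n. of_real (ln (Suc n)) * of_nat (Suc n) powr (- s)) sums T"
    by (rule has_sum_imp_sums)
  from sums_minus[OF this] have "(\<lambda>n. - of_real (ln (Suc n)) * of_nat (Suc n) powr (- s)) sums (- T)"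
    by simp
  then have "deriv zeta_series s = - T" using zeta_series_props(3)[OF s] sums_unique2 by blast
  then show ?thesis by (simp add: T1 mult.commute)
qed

text \<open>The function \<open>f exp (- K)\<close> has derivative zero.\<close>

lemma linear_ode_solution:
  assumes S: "open S" "convex S" and f: "f holomorphic_on S"
    and K: "\<And>z. z \<in> S \<Longrightarrow> (K has_field_derivative k z) (at z within S)"
    and ode: "\<And>z. z \<in> S \<Longrightarrow> deriv f z = f z * k z"
    and z: "z0 \<in> S" "z \<in> S"
  shows "f z = f z0 * exp (K z - K z0)"
proof -
  have "((\<lambda>x. f x * exp (- K x)) has_field_derivative 0) (at x within S)" if x: "x \<in> S" for x
  proof -
    have "(f has_field_derivative f x * k x) (at x within S)"
      using holomorphic_derivI[OF f S(1) x] ode[OF x] by (simp add: has_field_derivative_at_within)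
    moreover have "((\<lambda>x. exp (- K x)) has_field_derivative exp (- K x) * (- k x)) (at x within S)"
      using K[OF x] by (auto intro!: derivative_eq_intros)
    ultimately have "((\<lambda>x. f x * exp (- K x)) has_field_derivative f x * k x * exp (- K x) + exp (- K x) * (- k x) * f x) (at x within S)"
      by (rule DERIV_mult)
    moreover have "f x * k x * exp (- K x) + exp (- K x) * (- k x) * f x = 0" by simp
    ultimately show ?thesis by (simp only:)
  qed
  then have "\<exists>c. \<forall>x\<in>S. f x * exp (- K x) = c"
    by (rule has_field_derivative_zero_constant[OF S(2)])
  then obtain c where "\<And>x. x \<in> S \<Longrightarrow> f x * exp (- K x) = c" by blast
  from this[OF z(2)] this[OF z(1)] have "f z * exp (- K z) = f z0 * exp (- K z0)" by simp
  then show ?thesis by (simp add: exp_diff exp_minus field_simps)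
qed

lemma linear_ode_nonzero:
  assumes S: "open S" "convex S" and f: "f holomorphic_on S" and k: "k holomorphic_on S"
    and ode: "\<And>z. z \<in> S \<Longrightarrow> deriv f z = f z * k z"
    and z0: "z0 \<in> S" "f z0 \<noteq> 0" and z: "z \<in> S"
  shows "f z \<noteq> 0"
proof -
  obtain K where "\<And>x. x \<in> S \<Longrightarrow> (K has_field_derivative k x) (at x within S)"
    using holomorphic_convex_primitive'[OF S(2,1) k] by blast
  from linear_ode_solution[OF S f this ode z0(1) z] show ?thesis using z0(2) by simp
qed

lemma zeta_reg_series: "Re s > 1 \<Longrightarrow> zeta_reg s = (s - 1) * zeta_series s"
  by (auto simp: zeta_reg_def zeta_eq_series)

lemma deriv_zeta_reg:
  assumes s: "Re s > 1"
  shows "deriv zeta_reg s = zeta_reg s * (1 / (s - 1) - mangoldt_series s)"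
proof -
  have "s \<noteq> 1" using s by auto
  have "(zeta_series has_field_derivative deriv zeta_series s) (at s)"
    by (rule holomorphic_derivI[OF zeta_series_props(1) open_Re_gt]) (use s in simp)
  then have "((\<lambda>s. (s - 1) * zeta_series s) has_field_derivative (1 * zeta_series s + deriv zeta_series s * (s - 1))) (at s)"
    by (auto intro!: derivative_eq_intros)
  then have "(zeta_reg has_field_derivative (1 * zeta_series s + deriv zeta_series s * (s - 1))) (at s)"
    by (rule has_field_derivative_transform_within_open[OF _ open_Re_gt[of 1]]) (use s in \<open>auto simp: zeta_reg_series\<close>)
  then show ?thesis
    using \<open>s \<noteq> 1\<close> by (simp add: DERIV_imp_deriv deriv_zeta_series[OF s] zeta_reg_series[OF s] field_simps)
qed

text \<open>The terms of the Dirichlet series after the first have total modulus at most \<open>pi\<^sup>2 / 6 - 1 < 1\<close>.\<close>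

lemma zeta_reg_lower_bound:
  "\<exists>c>0. \<forall>t. norm (zeta_reg (Complex 2 t)) \<ge> c"
proof -
  have S: "(\<lambda>n. inverse (real (Suc n) ^ 2)) sums (pi\<^sup>2 / 6)" 
    using inverse_squares_sums by (simp add: inverse_eq_divide)
  have p: "pi\<^sup>2 / 6 < 2"
  proof -
    have "pi < 3.2" using pi_approx by simp
    then have "pi\<^sup>2 < 3.2\<^sup>2" by (intro power_strict_mono) auto
    then show ?thesis by (simp add: power2_eq_square)
  qed
  have "norm (zeta_reg (Complex 2 t)) \<ge> 2 - pi\<^sup>2 / 6" for t
  proof -
    let ?s = "Complex 2 t"
    have Z: "(\<lambda>n. of_nat (Suc n) powr (- ?s)) sums zeta_series ?s" by (rule zeta_series_props) simp
    have n2: "norm (of_nat (Suc n) powr (- ?s)) = inverse (real (Suc n) ^ 2)" for n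
      unfolding norm_nat_powr[OF zero_less_Suc] by (simp add: powr_minus del: of_nat_Suc)
    have T: "(\<lambda>n. of_nat (Suc (Suc n)) powr (- ?s)) sums (zeta_series ?s - 1)"
      using Z sums_Suc_iff[of "\<lambda>n. of_nat (Suc n) powr (- ?s)" "zeta_series ?s - 1"] by simp
    have T': "(\<lambda>n. inverse (real (Suc (Suc n)) ^ 2)) sums (pi\<^sup>2 / 6 - 1)"
      using sums_Suc_iff[of "\<lambda>n. inverse (real (Suc n) ^ 2)" "pi\<^sup>2 / 6 - 1"] S by simp
    have "norm (\<Sum>n. of_nat (Suc (Suc n)) powr (- ?s)) \<le> (\<Sum>n. inverse (real (Suc (Suc n)) ^ 2))"
      by (rule norm_suminf_le) (use n2 T' in \<open>auto simp: sums_iff simp del: of_nat_Suc power_inverse\<close>)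
    then have "norm (zeta_series ?s - 1) \<le> pi\<^sup>2 / 6 - 1" using T T' by (simp add: sums_iff)
    then have z: "norm (zeta_series ?s) \<ge> 2 - pi\<^sup>2 / 6"
      using norm_triangle_ineq2[of 1 "1 - zeta_series ?s"] by (simp add: norm_minus_commute)
    have "1 \<le> norm (?s - 1)" using abs_Re_le_cmod[of "?s - 1"] by simp
    then have "1 * norm (zeta_series ?s) \<le> norm (?s - 1) * norm (zeta_series ?s)" by (intro mult_right_mono) auto
    then show ?thesis using z by (simp add: zeta_reg_series norm_mult)
  qed
  then show ?thesis using p by (intro exI[of _ "2 - pi\<^sup>2 / 6"]) auto
qed

lemma zeta_reg_nonzero_Re_gt_1:
  assumes "Re s > 1" shows "zeta_reg s \<noteq> 0"
proof (rule linear_ode_nonzero[of "{s. Re s > 1}" zeta_reg "\<lambda>s. 1 / (s - 1) - mangoldt_series s" "Complex 2 0"])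
  show "zeta_reg (Complex 2 0) \<noteq> 0" using zeta_reg_lower_bound by (metis norm_zero not_le)
  show "zeta_reg holomorphic_on {s. Re s > 1}" using zeta_reg_holomorphic holomorphic_on_subset by blast
  show "(\<lambda>s. 1 / (s - 1) - mangoldt_series s) holomorphic_on {s. Re s > 1}"
    by (intro holomorphic_intros mangoldt_series_props) auto
  show "deriv zeta_reg z = zeta_reg z * (1 / (z - 1) - mangoldt_series z)" if "z \<in> {s. Re s > 1}" for z
    using that by (intro deriv_zeta_reg) simp
qed (use assms in \<open>simp_all add: open_Re_gt convex_Re_gt\<close>)

section \<open>Laplace transforms and Landau's theorem\<close>

definition laplace :: "(real \<Rightarrow> real) \<Rightarrow> complex \<Rightarrow> complex" where
  "laplace f s = (\<integral>u. of_real (f u) * exp (- s * of_real u) \<partial>lborel)"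

text \<open>Absolute convergence, for functions supported on the nonnegative half line.\<close>

definition laplace_converges :: "(real \<Rightarrow> real) \<Rightarrow> real \<Rightarrow> bool" where
  "laplace_converges f \<sigma> \<longleftrightarrow> f \<in> borel_measurable borel \<and> (\<forall>u<0. f u = 0) \<and> integrable lborel (\<lambda>u. f u * exp (- \<sigma> * u))"

lemma norm_laplace_integrand: "norm (of_real (f u) * exp (- s * of_real u) :: complex) = \<bar>f u\<bar> * exp (- Re s * u)"
  by (simp add: norm_mult norm_exp_eq_Re)

lemma laplace_converges_mono:
  assumes "laplace_converges f \<sigma>" "\<sigma> \<le> \<tau>" shows "laplace_converges f \<tau>"
proof -
  have [measurable]: "f \<in> borel_measurable borel" and f0: "\<And>u. u < 0 \<Longrightarrow> f u = 0"
   and I: "integrable lborel (\<lambda>u. f u * exp (- \<sigma> * u))"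
    using assms(1) unfolding laplace_converges_def by auto
  have "integrable lborel (\<lambda>u. f u * exp (- \<tau> * u))"
  proof (rule Bochner_Integration.integrable_bound[OF I])
    show "AE u in lborel. norm (f u * exp (- \<tau> * u)) \<le> norm (f u * exp (- \<sigma> * u))"
    proof (intro always_eventually allI)
      fix u show "norm (f u * exp (- \<tau> * u)) \<le> norm (f u * exp (- \<sigma> * u))"
      proof (cases "u < 0")
        case False
        then have "\<sigma> * u \<le> \<tau> * u" using assms(2) by (intro mult_right_mono) auto
        then show ?thesis by (simp add: abs_mult mult_left_mono)
      qed (simp add: f0)
    qed
  qed simp
  then show ?thesis using assms(1) unfolding laplace_converges_def by auto
qed

lemma laplace_integrable:
  assumes "laplace_converges f (Re s)"
  shows "integrable lborel (\<lambda>u. of_real (f u) * exp (- s * of_real u) :: complex)"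
proof -
  have [measurable]: "f \<in> borel_measurable borel"
   and I: "integrable lborel (\<lambda>u. f u * exp (- Re s * u))"
    using assms unfolding laplace_converges_def by auto
  show ?thesis
  proof (rule Bochner_Integration.integrable_bound[OF I])
    show "AE u in lborel. norm (of_real (f u) * exp (- s * of_real u) :: complex) \<le> norm (f u * exp (- Re s * u))"
      unfolding norm_laplace_integrand by (simp add: abs_mult)
  qed simp
qed

text \<open>Expanding \<open>exp (- z u)\<close> under the integral; the absolute values sum to \<open>exp (norm z * u)\<close>, which the
hypothesis on \<open>z\<close> allows.\<close>

lemma laplace_power_series:
  assumes conv: "\<And>\<sigma>. \<sigma> > \<theta> \<Longrightarrow> laplace_converges f \<sigma>" and z: "norm z < Re a - \<theta>"
  shows "(\<lambda>k. (-1) ^ k / fact k * laplace (\<lambda>u. f u * u ^ k) a * z ^ k) sums laplace f (a + z)"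
proof -
  have a: "Re a - norm z > \<theta>" using z by simp
  have [measurable]: "f \<in> borel_measurable borel" and f0: "\<And>u. u < 0 \<Longrightarrow> f u = 0"
   and I: "integrable lborel (\<lambda>u. f u * exp (- (Re a - norm z) * u))"
    using conv[OF a] unfolding laplace_converges_def by auto
  define t :: "nat \<Rightarrow> real \<Rightarrow> complex" where
    "t k u = of_real (f u) * exp (- a * of_real u) * ((- z * of_real u) ^ k /\<^sub>R fact k)" for k u
  have nt: "norm (t k u) = \<bar>f u\<bar> * exp (- Re a * u) * ((norm z * u) ^ k /\<^sub>R fact k)" for k u
  proof (cases "u < 0")
    case False
    then show ?thesis unfolding t_def by (simp add: norm_mult norm_power norm_exp_eq_Re power_mult_distrib)
  qed (simp add: f0 t_def)
  have nsums: "(\<lambda>k. norm (t k u)) sums (\<bar>f u\<bar> * exp (- (Re a - norm z) * u))" for u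
  proof -
    have "(\<lambda>k. norm (t k u)) sums (\<bar>f u\<bar> * exp (- Re a * u) * exp (norm z * u))"
      unfolding nt by (intro sums_mult exp_converges)
    moreover have "exp (- Re a * u) * exp (norm z * u) = exp (- (Re a - norm z) * u)"
      unfolding exp_add[symmetric] by (rule arg_cong[of _ _ exp]) (simp add: algebra_simps)
    ultimately show ?thesis by (simp only: mult.assoc)
  qed
  have csums: "(\<lambda>k. t k u) sums (of_real (f u) * exp (- (a + z) * of_real u))" for u
  proof -
    have "(\<lambda>k. t k u) sums (of_real (f u) * exp (- a * of_real u) * exp (- z * of_real u))"
      unfolding t_def by (intro sums_mult exp_converges)
    moreover have "exp (- a * of_real u) * exp (- z * of_real u) = exp (- (a + z) * of_real u)"
      unfolding exp_add[symmetric] by (rule arg_cong[of _ _ exp]) (simp add: algebra_simps)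
    ultimately show ?thesis by (simp only: mult.assoc)
  qed
  have I': "integrable lborel (\<lambda>u. \<bar>f u\<bar> * exp (- (Re a - norm z) * u))"
    using integrable_norm[OF I] by (simp add: abs_mult)
  have int: "integrable lborel (t k)" for k
  proof (rule Bochner_Integration.integrable_bound[OF I'])
    show "t k \<in> borel_measurable lborel" unfolding t_def by measurable
    show "AE u in lborel. norm (t k u) \<le> norm (\<bar>f u\<bar> * exp (- (Re a - norm z) * u))"
    proof (intro always_eventually allI)
      fix u
      have "norm (t k u) \<le> (\<Sum>k. norm (t k u))"
        using sum_le_suminf[OF sums_summable[OF nsums[of u]], of "{k}"] by simp
      then show "norm (t k u) \<le> norm (\<bar>f u\<bar> * exp (- (Re a - norm z) * u))"
        using sums_unique[OF nsums[of u]] by simp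
    qed
  qed
  have "summable (\<lambda>k. \<integral>u. norm (t k u) \<partial>lborel)"
  proof (rule bounded_imp_summable)
    fix n
    have "(\<Sum>k\<le>n. \<integral>u. norm (t k u) \<partial>lborel) = (\<integral>u. (\<Sum>k\<le>n. norm (t k u)) \<partial>lborel)"
      by (rule Bochner_Integration.integral_sum[symmetric]) (intro integrable_norm int)
    also have "\<dots> \<le> (\<integral>u. \<bar>f u\<bar> * exp (- (Re a - norm z) * u) \<partial>lborel)"
    proof (rule integral_mono)
      fix u
      have "(\<Sum>k\<le>n. norm (t k u)) \<le> (\<Sum>k. norm (t k u))"
        using sum_le_suminf[OF sums_summable[OF nsums[of u]], of "{..n}"] by simp
      then show "(\<Sum>k\<le>n. norm (t k u)) \<le> \<bar>f u\<bar> * exp (- (Re a - norm z) * u)"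
        using sums_unique[OF nsums[of u]] by simp
    qed (intro Bochner_Integration.integrable_sum integrable_norm int I')+
    finally show "(\<Sum>k\<le>n. \<integral>u. norm (t k u) \<partial>lborel) \<le> (\<integral>u. \<bar>f u\<bar> * exp (- (Re a - norm z) * u) \<partial>lborel)" .
  qed simp
  then have "(\<lambda>k. integral\<^sup>L lborel (t k)) sums (\<integral>u. (\<Sum>k. t k u) \<partial>lborel)"
    by (intro sums_integral int always_eventually allI sums_summable[OF nsums])
  moreover have "(\<integral>u. (\<Sum>k. t k u) \<partial>lborel) = laplace f (a + z)"
    using csums sums_unique unfolding laplace_def by metis
  moreover have "integral\<^sup>L lborel (t k) = (-1) ^ k / fact k * laplace (\<lambda>u. f u * u ^ k) a * z ^ k" for k
  proof -
    have "t k u = ((-1) ^ k / fact k * z ^ k) * (of_real (f u * u ^ k) * exp (- a * of_real u))" for u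
      unfolding t_def by (simp add: scaleR_conv_of_real divide_inverse power_mult_distrib power_minus' mult_ac)
    then have "t k = (\<lambda>u. ((-1) ^ k / fact k * z ^ k) * (of_real (f u * u ^ k) * exp (- a * of_real u)))" by (rule ext)
    then have "integral\<^sup>L lborel (t k) = ((-1) ^ k / fact k * z ^ k) * laplace (\<lambda>u. f u * u ^ k) a"
      unfolding laplace_def by (simp only: integral_mult_right_zero)
    then show ?thesis by simp
  qed
  ultimately show ?thesis by simp
qed

lemma laplace_holomorphic:
  assumes conv: "\<And>\<sigma>. \<sigma> > \<theta> \<Longrightarrow> laplace_converges f \<sigma>"
  shows "laplace f holomorphic_on {s. Re s > \<theta>}"
proof -
  have "laplace f field_differentiable at a" if a: "Re a > \<theta>" for a
  proof -
    have "laplace f holomorphic_on ball a (Re a - \<theta>)"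
    proof (rule power_series_holomorphic)
      fix w assume "w \<in> ball a (Re a - \<theta>)"
      then have "norm (w - a) < Re a - \<theta>" by (simp add: dist_norm norm_minus_commute)
      from laplace_power_series[OF conv this]
      show "(\<lambda>k. (-1) ^ k / fact k * laplace (\<lambda>u. f u * u ^ k) a * (w - a) ^ k) sums laplace f w" by simp
    qed
    then show ?thesis using a by (auto intro: holomorphic_on_imp_differentiable_at)
  qed
  then show ?thesis by (auto simp: holomorphic_on_def intro: field_differentiable_at_within)
qed

lemma power_series_coeff_unique:
  fixes a b :: "nat \<Rightarrow> complex"
  assumes "r > 0" and a: "\<And>z. norm z < r \<Longrightarrow> (\<lambda>n. a n * z ^ n) sums f z"
    and b: "\<And>z. norm z < r \<Longrightarrow> (\<lambda>n. b n * z ^ n) sums f z"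
  shows "a = b"
proof (rule ccontr)
  assume "a \<noteq> b"
  then have ex: "\<exists>n. a n - b n \<noteq> 0" by auto
  define m where "m = (LEAST n. a n - b n \<noteq> 0)"
  have m: "a m - b m \<noteq> 0" "\<And>n. n < m \<Longrightarrow> a n - b n = 0"
    unfolding m_def using LeastI_ex[OF ex] not_less_Least by blast+
  have s: "(\<lambda>n. (a n - b n) * z ^ n) sums 0" if "norm z < r" for z
    using sums_diff[OF a[OF that] b[OF that]] by (simp add: algebra_simps)
  have s2: "(\<lambda>n. (a (n + m) - b (n + m)) * z ^ n) sums (if z = 0 then a m - b m else 0)" if z: "norm z < r" for z
  proof (cases "z = 0")
    case True
    then show ?thesis using powser_sums_zero[of "\<lambda>n. a (n + m) - b (n + m)"] by simp
  next
    case False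
    have "(\<lambda>n. (a (n + m) - b (n + m)) * z ^ (n + m)) sums (0 - (\<Sum>n<m. (a n - b n) * z ^ n))"
      using s[OF z] by (subst sums_iff_shift) (simp only: diff_add_cancel)
    then have "(\<lambda>n. (a (n + m) - b (n + m)) * z ^ n * z ^ m) sums 0"
      using m(2) by (simp add: power_add mult.assoc)
    then have "(\<lambda>n. (a (n + m) - b (n + m)) * z ^ n * z ^ m / z ^ m) sums (0 / z ^ m)"
      by (rule sums_divide)
    then show ?thesis using False by simp
  qed
  have "((\<lambda>z::complex. if z = 0 then a m - b m else 0) \<longlongrightarrow> (\<lambda>n. a (n + m) - b (n + m)) 0) (at 0)"
    by (rule powser_limit_0[of r "\<lambda>n. a (n + m) - b (n + m)"]) (use \<open>r > 0\<close> s2 in auto)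
  moreover have "((\<lambda>z::complex. if z = 0 then a m - b m else 0) \<longlongrightarrow> 0) (at 0)"
    by (rule tendsto_eventually) (auto simp: eventually_at_filter)
  ultimately have "a m - b m = 0" using tendsto_unique[of "at (0::complex)"] by fastforce
  with m(1) show False by simp
qed

text \<open>Expand \<open>\<Phi>\<close> around a point to the right of \<open>\<theta>\<close> whose disc of holomorphy reaches beyond \<open>\<theta>\<close>. The
coefficients are \<open>(-1) ^ k / k!\<close> times the moments of \<open>f\<close>, so at points to the left of the centre all terms are
nonnegative, and monotone convergence turns the convergence of the power series into that of the integral.\<close>

lemma landau_oscillation:
  assumes conv: "\<And>\<sigma>. \<sigma> > \<theta> \<Longrightarrow> laplace_converges f \<sigma>" and nonneg: "\<And>u. f u \<ge> 0"
    and R: "R > 0" and hol: "\<Phi> holomorphic_on ball (of_real \<theta>) R"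
    and eq: "\<And>s. s \<in> ball (of_real \<theta>) R \<Longrightarrow> Re s > \<theta> \<Longrightarrow> \<Phi> s = laplace f s"
  shows "laplace_converges f (\<theta> - R / 4)"
proof -
  define a where "a = \<theta> + R / 4"
  let ?m = "\<lambda>k u. f u * u ^ k * exp (- a * u)" and ?r = "\<lambda>k. (R / 2) ^ k / fact k"
  have [measurable]: "f \<in> borel_measurable borel" and f0: "\<And>u. u < 0 \<Longrightarrow> f u = 0"
    using conv[of "\<theta> + 1"] unfolding laplace_converges_def by auto
  define c where "c k = (-1) ^ k / fact k * laplace (\<lambda>u. f u * u ^ k) (of_real a)" for k
  have sub: "ball (of_real a) (3 / 4 * R) \<subseteq> ball (complex_of_real \<theta>) R"
    using R by (simp add: ball_subset_ball_iff a_def dist_norm flip: of_real_diff)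
  have hol': "\<Phi> holomorphic_on ball (of_real a) (3 / 4 * R)"
    by (rule holomorphic_on_subset[OF hol sub])
  have taylor: "(\<lambda>k. (deriv ^^ k) \<Phi> (of_real a) / fact k * z ^ k) sums \<Phi> (of_real a + z)" if "norm z < 3 / 4 * R" for z
    using holomorphic_power_series[OF hol', of "of_real a + z"] that by (simp add: dist_norm)
  have "(\<lambda>k. (deriv ^^ k) \<Phi> (of_real a) / fact k) = c"
  proof (rule power_series_coeff_unique[of "R / 4" _ "\<lambda>z. \<Phi> (of_real a + z)"])
    fix z :: complex assume z: "norm z < R / 4"
    show "(\<lambda>k. (deriv ^^ k) \<Phi> (of_real a) / fact k * z ^ k) sums \<Phi> (of_real a + z)"
      by (rule taylor) (use z R in simp)
    have "- Re z \<le> norm z" using abs_Re_le_cmod[of z] by linarith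
    then have "Re (of_real a + z) > \<theta>" using z by (simp add: a_def)
    moreover have "of_real a + z \<in> ball (of_real a) (3 / 4 * R)" using z R by (simp add: dist_norm)
    ultimately have e: "\<Phi> (of_real a + z) = laplace f (of_real a + z)" using eq sub by blast
    show "(\<lambda>k. c k * z ^ k) sums \<Phi> (of_real a + z)"
      unfolding e c_def by (rule laplace_power_series[OF conv]) (use z in \<open>auto simp: a_def\<close>)
  qed (use R in simp)
  then have "(\<lambda>k. c k * z ^ k) sums \<Phi> (of_real a + z)" if "norm z < 3 / 4 * R" for z
    using taylor[OF that] by (simp add: fun_eq_iff)
  from this[of "- of_real (R / 2)"] R have sc: "summable (\<lambda>k. c k * (- of_real (R / 2)) ^ k)"
    by (auto simp: sums_iff)
  have intk: "integrable lborel (\<lambda>u. ?m k u)" for k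
  proof -
    have I: "integrable lborel (\<lambda>u. f u * exp (- (\<theta> + R / 8) * u))"
      using conv[of "\<theta> + R / 8"] R unfolding laplace_converges_def by auto
    have "integrable lborel (\<lambda>u. (fact k / (R / 8) ^ k) * (f u * exp (- (\<theta> + R / 8) * u)))"
      by (intro integrable_mult_right I)
    then show ?thesis
    proof (rule Bochner_Integration.integrable_bound)
      show "AE u in lborel. norm (?m k u) \<le> norm ((fact k / (R / 8) ^ k) * (f u * exp (- (\<theta> + R / 8) * u)))"
      proof (intro always_eventually allI)
        fix u
        show "norm (?m k u) \<le> norm ((fact k / (R / 8) ^ k) * (f u * exp (- (\<theta> + R / 8) * u)))"
        proof (cases "u < 0")
          case False
          have "(R / 8 * u) ^ k /\<^sub>R fact k \<le> exp (R / 8 * u)"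
            using sum_le_suminf[OF sums_summable[OF exp_converges[of "R / 8 * u"]], of "{k}"] False R
               sums_unique[OF exp_converges[of "R / 8 * u"]] by simp
          then have "u ^ k \<le> fact k / (R / 8) ^ k * exp (R / 8 * u)"
            using R by (simp add: field_simps power_mult_distrib power_divide)
          then have "f u * exp (- a * u) * u ^ k \<le> f u * exp (- a * u) * (fact k / (R / 8) ^ k * exp (R / 8 * u))"
            by (intro mult_left_mono) (use nonneg in auto)
          also have "\<dots> = (fact k / (R / 8) ^ k) * (f u * (exp (- a * u) * exp (R / 8 * u)))" by simp
          also have "exp (- a * u) * exp (R / 8 * u) = exp (- (\<theta> + R / 8) * u)"
            unfolding exp_add[symmetric] by (rule arg_cong[of _ _ exp]) (simp add: a_def field_simps)
          finally have "?m k u \<le> (fact k / (R / 8) ^ k) * (f u * exp (- (\<theta> + R / 8) * u))"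
            by (simp add: mult_ac)
          moreover have p: "?m k u \<ge> 0" using nonneg[of u] False by simp
          ultimately show ?thesis unfolding real_norm_def abs_of_nonneg[OF p] by (meson abs_ge_self order_trans)
        qed (simp add: f0)
      qed
    qed simp
  qed
  define M where "M k = (\<integral>u. ?m k u \<partial>lborel)" for k
  have ck: "c k * (- of_real (R / 2)) ^ k = of_real (M k * (R / 2) ^ k / fact k)" for k
  proof -
    have "laplace (\<lambda>u. f u * u ^ k) (of_real a) = (\<integral>u. of_real (?m k u) \<partial>lborel)"
      unfolding laplace_def by (intro Bochner_Integration.integral_cong refl) (simp flip: exp_of_real)
    also have "\<dots> = of_real (M k)" unfolding M_def by (rule integral_of_real[OF intk])
    finally have l: "laplace (\<lambda>u. f u * u ^ k) (of_real a) = of_real (M k)" .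
    have "(- complex_of_real (R / 2)) ^ k = (-1) ^ k * of_real (R / 2) ^ k"
      by (subst power_mult_distrib[symmetric]) simp
    moreover have "(-1::complex) ^ k * (-1) ^ k = 1" by (subst power_mult_distrib[symmetric]) simp
    ultimately show ?thesis unfolding c_def l by (simp add: field_simps)
  qed
  then have sM: "summable (\<lambda>k. M k * (R / 2) ^ k / fact k)"
    using sc unfolding ck summable_complex_of_real by simp
  have M0: "M k \<ge> 0" for k
    unfolding M_def
  proof (rule Bochner_Integration.integral_nonneg)
    fix u show "0 \<le> ?m k u" using nonneg[of u] f0[of u] by (cases "u < 0") auto
  qed
  have "(\<integral>\<^sup>+u. ennreal (f u * exp (- (\<theta> - R / 4) * u)) \<partial>lborel) = (\<integral>\<^sup>+u. (\<Sum>k. ennreal (?m k u * ?r k)) \<partial>lborel)"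
  proof (rule nn_integral_cong)
    fix u
    show "ennreal (f u * exp (- (\<theta> - R / 4) * u)) = (\<Sum>k. ennreal (?m k u * ?r k))"
    proof (cases "u < 0")
      case False
      have "(\<lambda>k. f u * exp (- a * u) * ((R / 2 * u) ^ k /\<^sub>R fact k)) sums (f u * exp (- a * u) * exp (R / 2 * u))"
        by (intro sums_mult exp_converges)
      moreover have "exp (- a * u) * exp (R / 2 * u) = exp (- (\<theta> - R / 4) * u)"
        unfolding exp_add[symmetric] by (rule arg_cong[of _ _ exp]) (simp add: a_def field_simps)
      moreover have "f u * exp (- a * u) * ((R / 2 * u) ^ k /\<^sub>R fact k) = ?m k u * ?r k" for k
        unfolding power_mult_distrib[of "R / 2" u] real_scaleR_def divide_inverse[of _ "fact k"] by (simp only: ac_simps)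
      ultimately have S: "(\<lambda>k. ?m k u * ?r k) sums (f u * exp (- (\<theta> - R / 4) * u))"
        by (simp only: mult.assoc)
      have "0 \<le> ?m k u * ?r k" for k
        using False R nonneg[of u] by (intro mult_nonneg_nonneg divide_nonneg_nonneg zero_le_power) auto
      then show ?thesis by (rule suminf_ennreal_eq[OF _ S, symmetric])
    qed (simp add: f0)
  qed
  also have "\<dots> = (\<Sum>k. \<integral>\<^sup>+u. ennreal (?m k u * ?r k) \<partial>lborel)"
    by (rule nn_integral_suminf) simp
  also have "\<dots> = (\<Sum>k. ennreal (M k * (R / 2) ^ k / fact k))"
  proof (rule suminf_cong)
    fix k
    have "(\<integral>\<^sup>+u. ennreal (?m k u * ?r k) \<partial>lborel) =
       ennreal (\<integral>u. ?m k u * ?r k \<partial>lborel)"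
    proof (rule nn_integral_eq_integral)
      show "AE u in lborel. 0 \<le> ?m k u * ?r k"
      proof (intro always_eventually allI)
        fix u show "0 \<le> ?m k u * ?r k"
          using nonneg[of u] f0[of u] R by (cases "u < 0") (auto intro!: mult_nonneg_nonneg divide_nonneg_nonneg)
      qed
    qed (intro integrable_mult_left intk)
    then show "(\<integral>\<^sup>+u. ennreal (?m k u * ?r k) \<partial>lborel) = ennreal (M k * (R / 2) ^ k / fact k)"
      unfolding M_def integral_mult_left_zero by (simp only: times_divide_eq_right)
  qed
  also have "\<dots> < \<infinity>"
  proof -
    have "0 \<le> M k * (R / 2) ^ k / fact k" for k using M0 R by simp
    then have "(\<Sum>k. ennreal (M k * (R / 2) ^ k / fact k)) = ennreal (\<Sum>k. M k * (R / 2) ^ k / fact k)"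
      by (rule suminf_ennreal_eq[OF _ summable_sums[OF sM]])
    then show ?thesis by (simp only: ennreal_less_top infinity_ennreal_def)
  qed
  finally have fin: "(\<integral>\<^sup>+u. ennreal (f u * exp (- (\<theta> - R / 4) * u)) \<partial>lborel) < \<infinity>" .
  have "integrable lborel (\<lambda>u. f u * exp (- (\<theta> - R / 4) * u))"
    by (rule integrableI_nonneg) (use fin nonneg in \<open>simp_all only: mult_nonneg_nonneg exp_ge_zero\<close>, measurable)
  then show ?thesis using f0 unfolding laplace_converges_def by simp
qed

section \<open>The Laplace transform of the error term\<close>

definition chebyshev_psi :: "real \<Rightarrow> real" where
  "chebyshev_psi x = (\<Sum>n\<in>{1..nat \<lfloor>x\<rfloor>}. mangoldt n)"

text \<open>The error term as a function of \<open>u = ln x\<close>. The main term is cut off at \<open>x = 1\<close> so that the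
function vanishes for negative \<open>u\<close>.\<close>

definition log_pnt_error :: "real \<Rightarrow> real" where
  "log_pnt_error u = chebyshev_psi (exp u) - indicator {0..} u * exp u"

lemma chebyshev_psi_mono: "x \<le> y \<Longrightarrow> chebyshev_psi x \<le> chebyshev_psi y"
  unfolding chebyshev_psi_def
  by (intro sum_mono2) (auto simp: mangoldt_nonneg nat_mono floor_mono intro: order_trans)

lemma chebyshev_psi_nonneg: "chebyshev_psi x \<ge> 0"
  unfolding chebyshev_psi_def by (intro sum_nonneg mangoldt_nonneg)

lemma chebyshev_psi_eq_0: "x < 1 \<Longrightarrow> chebyshev_psi x = 0"
  unfolding chebyshev_psi_def by (subst sum.neutral) (auto)

lemma chebyshev_psi_exp_le: "chebyshev_psi (exp u) \<le> exp (2 * u)"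
proof (cases "exp u < 1")
  case True then show ?thesis by (simp add: chebyshev_psi_eq_0)
next
  case False
  define N where "N = nat \<lfloor>exp u\<rfloor>"
  have N: "real N \<le> exp u" unfolding N_def by (simp add: of_nat_floor)
  have "chebyshev_psi (exp u) \<le> (\<Sum>n\<in>{1..N}. exp u)"
    unfolding chebyshev_psi_def N_def[symmetric]
  proof (rule sum_mono)
    fix n assume n: "n \<in> {1..N}"
    have "mangoldt n \<le> ln (real n)" using n by (intro mangoldt_le) auto
    also have "\<dots> \<le> real n" using n ln_le_minus_one[of "real n"] by simp
    also have "\<dots> \<le> exp u" using n N by simp
    finally show "mangoldt n \<le> exp u" .
  qed
  also have "\<dots> = real N * exp u" by simp
  also have "\<dots> \<le> exp u * exp u" using N by (intro mult_right_mono) auto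
  finally show ?thesis by (simp flip: exp_add)
qed

lemma chebyshev_psi_measurable [measurable]: "chebyshev_psi \<in> borel_measurable borel"
  by (rule borel_measurable_mono) (auto simp: mono_def chebyshev_psi_mono)

lemma log_pnt_error_measurable [measurable]: "log_pnt_error \<in> borel_measurable borel"
  unfolding log_pnt_error_def[abs_def] by measurable

lemma exp_tail_integral:
  assumes s: "Re s > 0"
  shows "has_bochner_integral lborel (\<lambda>u. indicator {a..} u *\<^sub>R exp (- s * of_real u)) (exp (- s * of_real a) / s)"
    and "(\<integral>u. norm (indicator {a..} u *\<^sub>R exp (- s * of_real u) :: complex) \<partial>lborel) = exp (- Re s * a) / Re s"
proof -
  have s0: "s \<noteq> 0" using s by auto
  have lim: "((\<lambda>u. exp (- Re s * u)) \<longlongrightarrow> 0) at_top"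
  proof -
    have "filterlim (\<lambda>u. - Re s * u) at_bot at_top"
      by (rule filterlim_tendsto_neg_mult_at_bot[OF tendsto_const]) (use s in \<open>auto simp: filterlim_ident\<close>)
    then show ?thesis by (rule filterlim_compose[OF exp_at_bot])
  qed
  have nn: "(\<integral>\<^sup>+u. ennreal (exp (- Re s * u)) * indicator {a..} u \<partial>lborel) = ennreal (0 - (- exp (- Re s * a) / Re s))"
  proof (rule nn_integral_FTC_atLeast)
    show "((\<lambda>u. - exp (- Re s * u) / Re s) \<longlongrightarrow> 0) at_top"
      using tendsto_divide[OF tendsto_minus[OF lim] tendsto_const, of "Re s"] s by simp
    show "DERIV (\<lambda>u. - exp (- Re s * u) / Re s) x :> exp (- Re s * x)" for x
      using s by (auto intro!: derivative_eq_intros)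
  qed auto
  have ne: "norm (indicator {a..} u *\<^sub>R exp (- s * of_real u) :: complex) = exp (- Re s * u) * indicator {a..} u" for u
    by (simp add: norm_exp_eq_Re)
  have "(\<integral>\<^sup>+u. ennreal (exp (- Re s * u) * indicator {a..} u) \<partial>lborel) = ennreal (exp (- Re s * a) / Re s)"
    using nn by (simp add: ennreal_mult' ennreal_indicator)
  then have hb: "integrable lborel (\<lambda>u. exp (- Re s * u) * indicator {a..} u) \<and>
     (\<integral>u. exp (- Re s * u) * indicator {a..} u \<partial>lborel) = exp (- Re s * a) / Re s"
    using s by (subst (asm) nn_integral_eq_integrable) auto
  then show "(\<integral>u. norm (indicator {a..} u *\<^sub>R exp (- s * of_real u) :: complex) \<partial>lborel) = exp (- Re s * a) / Re s"
    unfolding ne by simp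
  have int: "integrable lborel (\<lambda>u. indicator {a..} u *\<^sub>R exp (- s * of_real u) :: complex)"
  proof (rule Bochner_Integration.integrable_bound)
    show "integrable lborel (\<lambda>u. exp (- Re s * u) * indicator {a..} u)" using hb by simp
    show "AE u in lborel. norm (indicator {a..} u *\<^sub>R exp (- s * of_real u) :: complex) \<le> norm (exp (- Re s * u) * indicator {a..} u)"
      unfolding ne by simp
  qed measurable
  have ae: "AE u in lborel. indicator {a<..} u *\<^sub>R exp (- s * of_real u) = (indicator {a..} u *\<^sub>R exp (- s * of_real u) :: complex)"
    using AE_lborel_singleton[of a] by eventually_elim (auto simp: indicator_def)
  have int': "integrable lborel (\<lambda>u. indicator {a<..} u *\<^sub>R exp (- s * of_real u) :: complex)"
    by (rule integrable_cong_AE_imp[OF int]) (use ae in \<open>auto elim: eventually_mono\<close>)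
  have "(LBINT u=ereal a..\<infinity>. exp (- s * of_real u)) = 0 - (- exp (- s * of_real a) / s)"
  proof (rule interval_integral_FTC_integrable[where F = "\<lambda>u. - exp (- s * of_real u) / s"])
    show "((\<lambda>u. - exp (- s * of_real u) / s) has_vector_derivative exp (- s * of_real x)) (at x)" for x
    proof -
      have "((\<lambda>u. - exp (- s * u) / s) has_field_derivative exp (- s * of_real x)) (at (of_real x))"
        using s0 by (auto intro!: derivative_eq_intros)
      from has_vector_derivative_real_field[OF this] show ?thesis by simp
    qed
    show "set_integrable lborel (einterval (ereal a) \<infinity>) (\<lambda>u. exp (- s * of_real u))"
      using int' unfolding set_integrable_def einterval_def by (simp add: greaterThan_def)
    have c: "isCont (\<lambda>u. - exp (- s * complex_of_real u) / s) a" using s0 by (intro continuous_intros) auto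
    show "(((\<lambda>u. - exp (- s * of_real u) / s) \<circ> real_of_ereal) \<longlongrightarrow> - exp (- s * of_real a) / s) (at_right (ereal a))"
      unfolding comp_def
      by (rule ereal_tendsto_simps1(2)[THEN iffD2, unfolded comp_def])
         (use c[unfolded isCont_def] in \<open>rule filterlim_at_split[THEN iffD1, THEN conjunct2]\<close>)
    have "((\<lambda>u. norm (- exp (- s * of_real u) / s)) \<longlongrightarrow> 0) at_top"
      using tendsto_divide[OF lim tendsto_const, of "norm s"] s0 by (simp add: norm_divide norm_exp_eq_Re)
    then have "((\<lambda>u. - exp (- s * of_real u) / s) \<longlongrightarrow> 0) at_top" by (rule tendsto_norm_zero_cancel)
    then show "(((\<lambda>u. - exp (- s * of_real u) / s) \<circ> real_of_ereal) \<longlongrightarrow> 0) (at_left \<infinity>)"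
      by (simp add: ereal_tendsto_simps1)
  qed (auto intro!: continuous_intros)
  then have "(\<integral>u. indicator {a<..} u *\<^sub>R exp (- s * of_real u) \<partial>lborel) = exp (- s * of_real a) / s"
    unfolding interval_integral_to_infinity_eq set_lebesgue_integral_def by simp
  moreover have "(\<integral>u. indicator {a<..} u *\<^sub>R exp (- s * of_real u) \<partial>lborel) = (\<integral>u. indicator {a..} u *\<^sub>R exp (- s * of_real u) \<partial>lborel)"
    by (rule integral_cong_AE) (use ae in auto)
  ultimately show "has_bochner_integral lborel (\<lambda>u. indicator {a..} u *\<^sub>R exp (- s * of_real u)) (exp (- s * of_real a) / s)"
    using int by (simp add: has_bochner_integral_iff)
qed

lemma laplace_psi:
  assumes s: "Re s > 1"
  shows "has_bochner_integral lborel (\<lambda>u. of_real (chebyshev_psi (exp u)) * exp (- s * of_real u)) (mangoldt_series s / s)"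
proof -
  have s0: "Re s > 0" "s \<noteq> 0" using s by auto
  define f where "f n u = mangoldt (Suc n) * (indicator {ln (Suc n)..} u *\<^sub>R exp (- s * of_real u))" for n u
  have e: "exp (- x * of_real (ln (Suc n))) = of_nat (Suc n) powr (- x :: complex)" for n x
    using Ln_of_real[of "real (Suc n)"] by (simp add: powr_def del: of_nat_Suc)
  have e': "exp (- x * ln (Suc n)) = real (Suc n) powr (- x)" for n x
    by (simp add: powr_def del: of_nat_Suc)
  have hb: "has_bochner_integral lborel (f n) (mangoldt (Suc n) * of_nat (Suc n) powr (- s) / s)" for n
    unfolding f_def using has_bochner_integral_mult_right[OF exp_tail_integral(1)[OF s0(1), of "ln (Suc n)"], of "mangoldt (Suc n)"]
    unfolding e by simp
  have nrm: "(\<integral>u. norm (f n u) \<partial>lborel) = mangoldt (Suc n) * real (Suc n) powr (- Re s) / Re s" for n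
  proof -
    have "(\<integral>u. norm (f n u) \<partial>lborel) = (\<integral>u. mangoldt (Suc n) * norm (indicator {ln (Suc n)..} u *\<^sub>R exp (- s * of_real u) :: complex) \<partial>lborel)"
      unfolding f_def norm_mult norm_mangoldt ..
    also have "\<dots> = mangoldt (Suc n) * (exp (- Re s * ln (Suc n)) / Re s)"
      unfolding integral_mult_right_zero exp_tail_integral(2)[OF s0(1)] ..
    finally show ?thesis unfolding e' by simp
  qed
  have fsum: "(\<lambda>n. f n u) sums (of_real (chebyshev_psi (exp u)) * exp (- s * of_real u))"
    and nsum: "summable (\<lambda>n. norm (f n u))" for u
  proof -
    define N where "N = nat \<lfloor>exp u\<rfloor>"
    have iff: "ln (Suc n) \<le> u \<longleftrightarrow> n < N" for n
    proof -
      have "ln (Suc n) \<le> u \<longleftrightarrow> real (Suc n) \<le> exp u"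
        using ln_le_cancel_iff[of "real (Suc n)" "exp u"] by simp
      also have "\<dots> \<longleftrightarrow> Suc n \<le> N" unfolding N_def using le_nat_floor[of "Suc n" "exp u"] of_nat_floor[of "exp u"]
        by (metis exp_ge_zero of_nat_le_iff order_trans)
      finally show ?thesis by auto
    qed
    have z: "f n u = 0" if "n \<notin> {..<N}" for n using that iff[of n] by (auto simp: f_def indicator_def)
    have "(\<lambda>n. f n u) sums (\<Sum>n<N. f n u)" by (rule sums_finite) (use z in auto)
    also have "(\<Sum>n<N. f n u) = (\<Sum>n<N. mangoldt (Suc n) * exp (- s * of_real u))"
      by (rule sum.cong) (use iff in \<open>auto simp: f_def indicator_def\<close>)
    also have "\<dots> = of_real (\<Sum>n<N. mangoldt (Suc n)) * exp (- s * of_real u)"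
      by (simp add: sum_distrib_right)
    also have "(\<Sum>n<N. mangoldt (Suc n)) = chebyshev_psi (exp u)"
      unfolding chebyshev_psi_def N_def[symmetric] by (rule sum.reindex_bij_witness[of _ "\<lambda>n. n - 1" Suc]) auto
    finally show "(\<lambda>n. f n u) sums (of_real (chebyshev_psi (exp u)) * exp (- s * of_real u))" .
    show "summable (\<lambda>n. norm (f n u))" by (rule summable_finite[of "{..<N}"]) (use z in auto)
  qed
  have sn: "summable (\<lambda>n. \<integral>u. norm (f n u) \<partial>lborel)"
    unfolding nrm by (intro summable_divide summable_mangoldt_powr s)
  have int: "integrable lborel (f n)" for n using hb by (simp add: has_bochner_integral_iff)
  have eq: "(\<Sum>n. f n u) = of_real (chebyshev_psi (exp u)) * exp (- s * of_real u)" for u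
    using fsum sums_unique by metis
  have "integrable lborel (\<lambda>u. \<Sum>n. f n u)" 
    by (rule integrable_suminf[OF int always_eventually[OF allI[OF nsum]] sn])
  moreover have "(\<lambda>n. integral\<^sup>L lborel (f n)) sums (\<integral>u. (\<Sum>n. f n u) \<partial>lborel)"
    by (rule sums_integral[OF int always_eventually[OF allI[OF nsum]] sn])
  moreover have "(\<lambda>n. integral\<^sup>L lborel (f n)) sums (mangoldt_series s / s)"
    unfolding has_bochner_integral_integral_eq[OF hb] by (intro sums_divide mangoldt_series_props s)
  ultimately show ?thesis unfolding eq has_bochner_integral_iff using sums_unique2 by blast
qed

text \<open>In terms of \<open>\<zeta>\<close> this is \<open>- \<zeta>' s / (s \<zeta> s) - 1 / (s - 1)\<close>; in the form used here the pole at 1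
is gone.\<close>

definition pnt_error_transform :: "complex \<Rightarrow> complex" where
  "pnt_error_transform s = - (1 + deriv zeta_reg s / zeta_reg s) / s"

lemma laplace_log_pnt_error:
  assumes s: "Re s > 1"
  shows "laplace_converges log_pnt_error (Re s)" and "laplace log_pnt_error s = pnt_error_transform s"
proof -
  have s1: "Re (s - 1) > 0" "s \<noteq> 1" "s \<noteq> 0" using s by auto
  have r: "of_real (log_pnt_error u) * exp (- s * of_real u) = of_real (chebyshev_psi (exp u)) * exp (- s * of_real u) - 
     (indicator {0..} u *\<^sub>R exp (- (s - 1) * of_real u))" for u
    unfolding log_pnt_error_def by (auto simp: indicator_def algebra_simps exp_add exp_diff exp_minus exp_of_real divide_inverse)
  have hb: "has_bochner_integral lborel (\<lambda>u. of_real (log_pnt_error u) * exp (- s * of_real u)) (mangoldt_series s / s - 1 / (s - 1))"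
    unfolding r using has_bochner_integral_diff[OF laplace_psi[OF s] exp_tail_integral(1)[OF s1(1), of 0]] by simp
  have "deriv zeta_reg s / zeta_reg s = 1 / (s - 1) - mangoldt_series s"
    using deriv_zeta_reg[OF s] zeta_reg_nonzero_Re_gt_1[OF s] by simp
  then have "pnt_error_transform s = mangoldt_series s / s - 1 / (s - 1)"
    unfolding pnt_error_transform_def using s1 by (simp only:) (simp add: field_simps)
  then show "laplace log_pnt_error s = pnt_error_transform s"
    using hb by (simp add: laplace_def has_bochner_integral_iff)
  have "integrable lborel (\<lambda>u. norm (of_real (log_pnt_error u) * exp (- s * of_real u) :: complex))"
    using hb by (intro integrable_norm) (simp add: has_bochner_integral_iff)
  then have "integrable lborel (\<lambda>u. \<bar>log_pnt_error u\<bar> * exp (- Re s * u))"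
    unfolding norm_laplace_integrand .
  then have "integrable lborel (\<lambda>u. log_pnt_error u * exp (- Re s * u))"
    by (rule Bochner_Integration.integrable_bound) (auto simp: abs_mult)
  then show "laplace_converges log_pnt_error (Re s)"
    unfolding laplace_converges_def by (auto simp: log_pnt_error_def chebyshev_psi_eq_0)
qed

section \<open>Growth of the logarithmic derivative of zeta\<close>

text \<open>The Borel-Caratheodory argument. A logarithm \<open>K\<close> of \<open>f / f z0\<close> has real part below \<open>A = ln M\<close>, hence
\<open>K / (2 A - K)\<close> maps the ball into the unit disc. Schwarz's lemma bounds \<open>K\<close>, and Cauchy's inequality its
derivative \<open>f' / f\<close>.\<close>

lemma log_deriv_bound:
  fixes f :: "complex \<Rightarrow> complex"
  assumes hol: "f holomorphic_on ball z0 R" and nz: "\<And>z. z \<in> ball z0 R \<Longrightarrow> f z \<noteq> 0"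
    and bd: "\<And>z. z \<in> ball z0 R \<Longrightarrow> norm (f z) < M * norm (f z0)"
    and r: "0 \<le> r" "r < R" and z: "norm (z - z0) \<le> r"
  shows "norm (deriv f z / f z) \<le> 8 * R / (R - r)\<^sup>2 * ln M"
proof -
  have R: "R > 0" using r by simp
  define A where "A = ln M"
  have f0: "f z0 \<noteq> 0" using nz R by simp
  have M1: "M > 1" using bd[of z0] R f0 by simp
  then have A: "A > 0" by (simp add: A_def)
  have "(\<lambda>z. deriv f z / f z) holomorphic_on ball z0 R"
    by (intro holomorphic_intros hol nz) auto
  then obtain K0 where K0: "\<And>x. x \<in> ball z0 R \<Longrightarrow> (K0 has_field_derivative (deriv f x / f x)) (at x within ball z0 R)"
    using holomorphic_convex_primitive'[OF convex_ball open_ball] by blast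
  define K where "K x = K0 x - K0 z0" for x
  have K: "(K has_field_derivative (deriv f x / f x)) (at x)" if "x \<in> ball z0 R" for x
  proof -
    have "(K0 has_field_derivative (deriv f x / f x)) (at x)"
      using K0[OF that] by (simp only: at_within_open[OF that open_ball])
    from DERIV_diff[OF this DERIV_const[of "K0 z0"]] show ?thesis unfolding K_def by simp
  qed
  have Kz0: "K z0 = 0" by (simp add: K_def)
  have Khol: "K holomorphic_on ball z0 R" using K unfolding holomorphic_on_open[OF open_ball] by blast
  have fK: "f x = f z0 * exp (K x)" if x: "x \<in> ball z0 R" for x
    unfolding K_def using linear_ode_solution[OF open_ball convex_ball hol K0 _ _ x, of z0] nz R by simp
  have ReK: "Re (K x) < A" if x: "x \<in> ball z0 R" for x
  proof -
    have "norm (f z0) * exp (Re (K x)) < M * norm (f z0)"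
      using bd[OF x] unfolding fK[OF x] by (simp add: norm_mult norm_exp_eq_Re)
    then have "exp (Re (K x)) < M" using f0 by simp
    then show ?thesis unfolding A_def using M1 by (metis exp_less_cancel_iff exp_ln less_trans zero_less_one)
  qed
  define w where "w y = K (z0 + of_real R * y) / (2 * of_real A - K (z0 + of_real R * y))" for y
  have inb: "z0 + of_real R * y \<in> ball z0 R" if "norm y < 1" for y
    using that R by (simp add: dist_norm norm_mult)
  have ne: "2 * of_real A - K x \<noteq> 0" if "x \<in> ball z0 R" for x
  proof
    assume "2 * of_real A - K x = 0"
    then have "Re (2 * of_real A - K x) = 0" by simp
    then show False using ReK[OF that] A by simp
  qed
  have whol: "w holomorphic_on ball 0 1"
    unfolding w_def
    by (intro holomorphic_intros holomorphic_on_compose_gen[OF _ Khol, unfolded o_def] ne inb) (use inb in auto)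
  have w1: "norm (w y) < 1" if y: "norm y < 1" for y
  proof -
    let ?k = "K (z0 + of_real R * y)"
    have "(Re ?k)\<^sup>2 < (2 * A - Re ?k)\<^sup>2"
      using ReK[OF inb[OF y]] A by (simp add: power2_eq_square algebra_simps)
    then have "(norm ?k)\<^sup>2 < (norm (2 * of_real A - ?k))\<^sup>2"
      by (simp add: cmod_power2)
    then have "norm ?k < norm (2 * of_real A - ?k)" by (rule power_less_imp_less_base) simp
    then show ?thesis unfolding w_def norm_divide using ne[OF inb[OF y]] by (simp add: divide_less_eq)
  qed
  have wle: "norm (w y) \<le> norm y" if "norm y < 1" for y
    by (rule Schwarz_Lemma(1)[OF whol _ w1 that]) (simp_all add: w_def Kz0)
  \<comment> \<open>Half of the gap between \<open>r\<close> and \<open>R\<close> is spent on Schwarz's lemma, the other half on Cauchy's inequality.\<close>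
  define q where "q = (R - r) / 2"
  have q: "q > 0" "r + q = (R + r) / 2" "R - (r + q) = q" using r by (simp_all add: q_def field_simps)
  define B where "B = 2 * A * R / q"
  have KB: "norm (K x) \<le> B" if x: "norm (x - z0) \<le> r + q" for x
  proof -
    define y where "y = (x - z0) / of_real R"
    have xy: "x = z0 + of_real R * y" using R by (simp add: y_def)
    have ny: "norm y \<le> (r + q) / R" using x R by (simp add: y_def norm_divide divide_right_mono)
    also have "\<dots> < 1" using q R by (simp add: field_simps)
    finally have y1: "norm y < 1" .
    have xb: "x \<in> ball z0 R" using inb[OF y1] xy by simp
    have "K x = w y * (2 * of_real A - K x)" unfolding w_def xy[symmetric] using ne[OF xb] by simp
    then have "norm (K x) = norm (w y) * norm (2 * of_real A - K x)" by (metis norm_mult)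
    also have "\<dots> \<le> ((r + q) / R) * (2 * A + norm (K x))"
    proof (rule mult_mono)
      show "norm (w y) \<le> (r + q) / R" using wle[OF y1] ny by linarith
      have "norm (2 * of_real A - K x) \<le> norm (2 * of_real A :: complex) + norm (K x)" by (rule norm_triangle_ineq4)
      then show "norm (2 * of_real A - K x) \<le> 2 * A + norm (K x)" using A by (simp add: norm_mult)
    qed (use r q R in auto)
    finally have "R * norm (K x) \<le> (r + q) * (2 * A + norm (K x))" using R by (simp add: field_simps)
    then have "(R - (r + q)) * norm (K x) \<le> (r + q) * (2 * A)" by (simp add: algebra_simps)
    also have "\<dots> \<le> R * (2 * A)" using A q by (intro mult_right_mono) auto
    finally have "q * norm (K x) \<le> 2 * A * R" unfolding q(3) by (simp add: mult_ac)
    then show ?thesis unfolding B_def using q by (simp add: field_simps)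
  qed
  have sub: "cball z q \<subseteq> ball z0 R"
  proof
    fix x assume "x \<in> cball z q"
    then have "norm (x - z0) \<le> r + q" using z norm_triangle_ineq[of "x - z" "z - z0"] by (simp add: dist_norm norm_minus_commute)
    then show "x \<in> ball z0 R" using q by (simp add: dist_norm norm_minus_commute)
  qed
  have "norm ((deriv ^^ 1) K z) \<le> fact 1 * B / q ^ 1"
  proof (rule Cauchy_inequality)
    show "K holomorphic_on ball z q" using Khol sub ball_subset_cball holomorphic_on_subset by blast
    show "continuous_on (cball z q) K" using Khol sub holomorphic_on_imp_continuous_on continuous_on_subset by blast
    show "norm (K x) \<le> B" if "norm (z - x) = q" for x
      using KB[of x] z norm_triangle_ineq[of "x - z" "z - z0"] that by (simp add: norm_minus_commute)
  qed (rule q)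
  moreover have "z \<in> ball z0 R" using z r by (simp add: dist_norm norm_minus_commute)
  then have "deriv K z = deriv f z / f z" using K DERIV_imp_deriv by blast
  ultimately have "norm (deriv f z / f z) \<le> B / q" by simp
  also have "B / q = 8 * R / (R - r)\<^sup>2 * ln M"
    unfolding B_def q_def A_def by (simp add: power2_eq_square)
  finally show ?thesis .
qed

text \<open>The ball around \<open>2 + i t\<close> that touches the line \<open>Re s = \<theta>\<close> contains no zeros, and the modulus on it is at
most a constant times \<open>(1 + |t|)\<^sup>2\<close> times the modulus at the centre. The bound by the logarithm of this
ratio is then weakened to a power of \<open>1 + |t|\<close>.\<close>

lemma zeta_reg_log_deriv_growth:
  assumes nz: "\<And>s. Re s > \<theta> \<Longrightarrow> zeta_reg s \<noteq> 0" and \<theta>: "1/2 \<le> \<theta>" "\<theta> < a" "a \<le> 2" and \<kappa>: "\<kappa> > 0"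
  shows "\<exists>C>0. \<forall>s. a \<le> Re s \<and> Re s \<le> 2 \<longrightarrow> norm (deriv zeta_reg s / zeta_reg s) \<le> C * (1 + \<bar>Im s\<bar>) powr \<kappa>"
proof -
  obtain C0 where C0: "C0 > 0" "\<And>s. Re s \<ge> 1/2 \<Longrightarrow> norm (zeta_reg s) \<le> C0 * (1 + norm s) ^ 2"
    using zeta_reg_growth by blast
  obtain c where c: "c > 0" "\<And>t. norm (zeta_reg (Complex 2 t)) \<ge> c" using zeta_reg_lower_bound by blast
  define R r where "R = 2 - \<theta>" and "r = 2 - a"
  have R: "0 \<le> r" "r < R" "R \<le> 3/2" using \<theta> by (auto simp: R_def r_def)
  define D where "D = 25 * C0 / c + 2"
  have D: "D \<ge> 1" unfolding D_def using C0 c by (simp add: field_simps)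
  define E where "E = 8 * R / (R - r)\<^sup>2"
  have E: "E > 0" unfolding E_def using R by simp
  have main: "norm (deriv zeta_reg s / zeta_reg s) \<le> E * D powr (\<kappa> / 2) / (\<kappa> / 2) * (1 + \<bar>Im s\<bar>) powr \<kappa>"
    if s: "a \<le> Re s" "Re s \<le> 2" for s
  proof -
    define t where "t = Im s"
    define z0 where "z0 = Complex 2 t"
    define M where "M = D * (1 + \<bar>t\<bar>) ^ 2"
    have M: "M \<ge> 1" unfolding M_def using D mult_mono[of 1 D 1 "(1 + \<bar>t\<bar>) ^ 2"] by simp
    have reb: "Re z > \<theta>" if "z \<in> ball z0 R" for z
      using abs_Re_diff_ball[OF that] by (auto simp: z0_def R_def)
    have "norm (deriv zeta_reg s / zeta_reg s) \<le> 8 * R / (R - r)\<^sup>2 * ln M"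
    proof (rule log_deriv_bound[where ?z0.0 = z0])
      show "zeta_reg holomorphic_on ball z0 R" using zeta_reg_holomorphic holomorphic_on_subset by blast
      show "zeta_reg z \<noteq> 0" if "z \<in> ball z0 R" for z using nz reb[OF that] by blast
      show "norm (zeta_reg z) < M * norm (zeta_reg z0)" if z: "z \<in> ball z0 R" for z
      proof -
        have "norm z0 \<le> 2 + \<bar>t\<bar>" using cmod_le[of z0] by (simp add: z0_def)
        moreover have "norm z \<le> norm z0 + norm (z - z0)" using norm_triangle_ineq[of z0 "z - z0"] by simp
        moreover have "norm (z - z0) < 2" using z R by (simp add: dist_norm norm_minus_commute)
        ultimately have "1 + norm z \<le> 5 * (1 + \<bar>t\<bar>)" by simp
        then have "(1 + norm z) ^ 2 \<le> (5 * (1 + \<bar>t\<bar>)) ^ 2" by (intro power_mono) auto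
        then have "C0 * (1 + norm z) ^ 2 \<le> C0 * (5 * (1 + \<bar>t\<bar>)) ^ 2"
          using C0(1) by (intro mult_left_mono) auto
        moreover have "norm (zeta_reg z) \<le> C0 * (1 + norm z) ^ 2"
          using reb[OF z] \<theta> by (intro C0(2)) auto
        ultimately have "norm (zeta_reg z) \<le> C0 * (5 * (1 + \<bar>t\<bar>)) ^ 2" by linarith
        also have "\<dots> = (25 * C0 / c) * (1 + \<bar>t\<bar>) ^ 2 * c"
        proof -
          have "(5 * (1 + \<bar>t\<bar>)) ^ 2 = 25 * (1 + \<bar>t\<bar>) ^ 2" unfolding power_mult_distrib by simp
          then show ?thesis using c by simp
        qed
        also have "\<dots> < D * (1 + \<bar>t\<bar>) ^ 2 * c"
          using c by (intro mult_strict_right_mono) (auto simp: D_def)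
        also have "\<dots> \<le> M * norm (zeta_reg z0)" unfolding M_def[symmetric] z0_def by (intro mult_left_mono c) (use M in auto)
        finally show ?thesis .
      qed
      show "norm (s - z0) \<le> r"
      proof -
        have "s - z0 = of_real (Re s - 2)" by (simp add: complex_eq_iff z0_def t_def)
        then show ?thesis using s by (simp only: norm_of_real) (simp add: r_def)
      qed
    qed (use R in auto)
    also have "\<dots> \<le> E * (M powr (\<kappa> / 2) / (\<kappa> / 2))"
      unfolding E_def[symmetric] using E M \<kappa> by (intro mult_left_mono ln_powr_bound) auto
    also have "M powr (\<kappa> / 2) = D powr (\<kappa> / 2) * (1 + \<bar>t\<bar>) powr \<kappa>"
    proof -
      have "((1 + \<bar>t\<bar>) ^ 2) powr (\<kappa> / 2) = ((1 + \<bar>t\<bar>) powr 2) powr (\<kappa> / 2)" by (simp add: powr_numeral)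
      also have "\<dots> = (1 + \<bar>t\<bar>) powr \<kappa>" unfolding powr_powr by simp
      finally show ?thesis unfolding M_def using D by (simp add: powr_mult)
    qed
    finally show ?thesis by (simp add: t_def mult_ac)
  qed
  have "E * D powr (\<kappa> / 2) / (\<kappa> / 2) > 0" using E D \<kappa> by simp
  with main show ?thesis by blast
qed

section \<open>Gaussian integrals along vertical lines\<close>

abbreviation vline :: "real \<Rightarrow> real \<Rightarrow> complex" where
  "vline a t \<equiv> of_real a + \<i> * of_real t"

lemma exp_neg_square_eq_normal: "c > 0 \<Longrightarrow> exp (- c * t\<^sup>2) = sqrt (pi / c) * normal_density 0 (1 / sqrt (2 * c)) t"
proof -
  assume c: "c > 0"
  have s: "(1 / sqrt (2 * c))\<^sup>2 = 1 / (2 * c)" using c by (simp add: power_divide)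
  have e1: "2 * pi * (1 / (2 * c)) = pi / c" using c by simp
  have e2: "- (t - 0)\<^sup>2 / (2 * (1 / (2 * c))) = - c * t\<^sup>2" using c by simp
  have "pi / c > 0" using c by simp
  then have "sqrt (pi / c) \<noteq> 0" by (simp only: real_sqrt_eq_zero_cancel_iff less_imp_neq[THEN not_sym] not_False_eq_True)
  moreover have "x = w * (1 / w * x)" if "w \<noteq> 0" for x w :: real using that by simp
  ultimately show ?thesis unfolding normal_density_def s e1 e2 by blast
qed

lemma integrable_exp_neg_square:
  assumes "(c::real) > 0" shows "integrable lborel (\<lambda>t. exp (- c * t\<^sup>2))"
proof -
  have "integrable lborel (\<lambda>t. sqrt (pi / c) * normal_density 0 (1 / sqrt (2 * c)) t)"
    using assms by (intro integrable_mult_right integrable_normal_density) auto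
  then show ?thesis by (simp only: exp_neg_square_eq_normal[OF assms])
qed

lemma integral_exp_neg_square: "c > 0 \<Longrightarrow> (\<integral>t. exp (- c * t\<^sup>2) \<partial>lborel) = sqrt (pi / c)"
  by (simp only: exp_neg_square_eq_normal integral_mult_right_zero) simp

text \<open>A primitive \<open>Q\<close> replaces contour integration: the difference of the two integrals over \<open>[-n, n]\<close> is made up of
increments of \<open>Q\<close> along horizontal segments at height \<open>n\<close> and \<open>- n\<close>, where \<open>f\<close> is small.\<close>

lemma line_shift:
  assumes hol: "f holomorphic_on {s. Re s > \<theta>}" and ab: "\<theta> < a" "a \<le> b" and c: "c > 0"
    and bd: "\<And>\<sigma> t. a \<le> \<sigma> \<Longrightarrow> \<sigma> \<le> b \<Longrightarrow> norm (f (vline \<sigma> t)) \<le> C * exp (- c * t\<^sup>2)"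
  shows "(\<integral>t. f (vline a t) \<partial>lborel) = (\<integral>t. f (vline b t) \<partial>lborel)"
proof -
  obtain Q where Q: "\<And>x. x \<in> {s. Re s > \<theta>} \<Longrightarrow> (Q has_field_derivative f x) (at x within {s. Re s > \<theta>})"
    using holomorphic_convex_primitive'[OF convex_Re_gt open_Re_gt hol] by blast
  then have Q': "(Q has_field_derivative f x) (at x)" if "Re x > \<theta>" for x
    using that by (metis (mono_tags, lifting) at_within_open mem_Collect_eq open_Re_gt)
  have contf: "continuous_on UNIV (\<lambda>t. f (vline \<sigma> t))" if "a \<le> \<sigma>" "\<sigma> \<le> b" for \<sigma>
    by (rule continuous_on_compose2[OF holomorphic_on_imp_continuous_on[OF hol]])
       (use that ab in \<open>auto intro!: continuous_intros\<close>)
  have meas [measurable]: "(\<lambda>t. f (vline \<sigma> t)) \<in> borel_measurable borel" if "a \<le> \<sigma>" "\<sigma> \<le> b" for \<sigma>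
    using contf[OF that] by (rule borel_measurable_continuous_onI)
  have I: "integrable lborel (\<lambda>t. C * exp (- c * t\<^sup>2))" by (intro integrable_mult_right integrable_exp_neg_square c)
  have int: "integrable lborel (\<lambda>t. f (vline \<sigma> t))" if "a \<le> \<sigma>" "\<sigma> \<le> b" for \<sigma>
    by (rule Bochner_Integration.integrable_bound[OF I])
       (use meas[OF that] bd[OF that] in \<open>auto intro: order_trans[OF _ abs_ge_self]\<close>)
  define I where "I \<sigma> n = (\<integral>t. indicator {- real n..real n} t *\<^sub>R f (vline \<sigma> t) \<partial>lborel)" for \<sigma> n
  have lim: "I \<sigma> \<longlonglongrightarrow> (\<integral>t. f (vline \<sigma> t) \<partial>lborel)" if s: "a \<le> \<sigma>" "\<sigma> \<le> b" for \<sigma>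
    unfolding I_def
  proof (rule integral_dominated_convergence[where w = "\<lambda>t. norm (f (vline \<sigma> t))"])
    show "integrable lborel (\<lambda>t. norm (f (vline \<sigma> t)))" by (intro integrable_norm int s)
    show "AE t in lborel. (\<lambda>n. indicator {- real n..real n} t *\<^sub>R f (vline \<sigma> t)) \<longlonglongrightarrow> f (vline \<sigma> t)"
    proof (rule AE_I2, rule tendsto_eventually)
      fix t :: real
      have "\<forall>\<^sub>F n in sequentially. real n \<ge> \<bar>t\<bar>"
        by (rule eventually_sequentiallyI[of "nat \<lceil>\<bar>t\<bar>\<rceil>"]) linarith
      then show "\<forall>\<^sub>F n in sequentially. indicator {- real n..real n} t *\<^sub>R f (vline \<sigma> t) = f (vline \<sigma> t)"
        by eventually_elim (auto simp: indicator_def)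
    qed
  qed (use meas[OF s] in \<open>auto simp: indicator_def\<close>)
  have FTC: "\<i> * I \<sigma> n = Q (vline \<sigma> n) - Q (vline \<sigma> (- real n))" if s: "a \<le> \<sigma>" "\<sigma> \<le> b" for \<sigma> n
  proof -
    have "(\<integral>t. indicator {- real n..real n} t *\<^sub>R (\<i> * f (vline \<sigma> t)) \<partial>lborel) = Q (vline \<sigma> (real n)) - Q (vline \<sigma> (- real n))"
    proof (rule integral_FTC_Icc)
      fix t :: real
      have "(Q has_field_derivative f (vline \<sigma> t)) (at (vline \<sigma> t))" by (rule Q') (use s ab in simp)
      moreover have "((\<lambda>z. of_real \<sigma> + \<i> * z) has_field_derivative \<i>) (at (of_real t))"
        by (auto intro!: derivative_eq_intros)
      ultimately have "((\<lambda>z. Q (of_real \<sigma> + \<i> * z)) has_field_derivative f (vline \<sigma> t) * \<i>) (at (of_real t))"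
        by (rule DERIV_chain2)
      from has_vector_derivative_real_field[OF this, of UNIV]
      show "((\<lambda>t. Q (vline \<sigma> t)) has_vector_derivative \<i> * f (vline \<sigma> t)) (at t within {- real n..real n})"
        by (simp add: mult.commute has_vector_derivative_at_within)
    next
      show "continuous_on {- real n..real n} (\<lambda>t. \<i> * f (vline \<sigma> t))"
        by (rule continuous_on_mult_left[OF continuous_on_subset[OF contf[OF s] subset_UNIV]])
    qed simp
    moreover have "\<i> * I \<sigma> n = (\<integral>t. indicator {- real n..real n} t *\<^sub>R (\<i> * f (vline \<sigma> t)) \<partial>lborel)"
      unfolding I_def by (subst integral_mult_right_zero[symmetric]) (simp only: mult_scaleR_right)
    ultimately show ?thesis by (simp only:)
  qed
  have hbd: "norm (Q (vline b t) - Q (vline a t)) \<le> \<bar>C\<bar> * exp (- c * t\<^sup>2) * (b - a)" for t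
  proof -
    have seg: "\<exists>\<sigma>. a \<le> \<sigma> \<and> \<sigma> \<le> b \<and> z = vline \<sigma> t" if z: "z \<in> closed_segment (vline a t) (vline b t)" for z
    proof -
      obtain u where u: "0 \<le> u" "u \<le> 1" "z = (1 - u) *\<^sub>R vline a t + u *\<^sub>R vline b t"
        using z unfolding closed_segment_def by blast
      have "z = vline ((1 - u) * a + u * b) t" unfolding u(3) by (simp add: scaleR_conv_of_real algebra_simps)
      moreover have "a \<le> (1 - u) * a + u * b"
        using mult_left_mono[OF ab(2) u(1)] by (simp add: algebra_simps)
      moreover have "(1 - u) * a + u * b \<le> b"
        using mult_left_mono[OF ab(2), of "1 - u"] u(2) by (simp add: algebra_simps)
      ultimately show ?thesis by blast
    qed
    have "norm (Q (vline b t) - Q (vline a t)) \<le> \<bar>C\<bar> * exp (- c * t\<^sup>2) * norm (vline b t - vline a t)"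
    proof (rule field_differentiable_bound[where S = "closed_segment (vline a t) (vline b t)" and f' = f])
      fix z assume "z \<in> closed_segment (vline a t) (vline b t)"
      then obtain \<sigma> where s: "a \<le> \<sigma>" "\<sigma> \<le> b" "z = vline \<sigma> t" using seg by blast
      show "(Q has_field_derivative f z) (at z within closed_segment (vline a t) (vline b t))"
        by (rule has_field_derivative_at_within[OF Q']) (use s ab in simp)
      have "C * exp (- c * t\<^sup>2) \<le> \<bar>C\<bar> * exp (- c * t\<^sup>2)" by (intro mult_right_mono) auto
      then show "norm (f z) \<le> \<bar>C\<bar> * exp (- c * t\<^sup>2)" unfolding s(3) by (rule order_trans[OF bd[OF s(1,2)]])
    qed auto
    also have "norm (vline b t - vline a t) = b - a"
    proof -
      have "vline b t - vline a t = of_real (b - a)" by simp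
      then show ?thesis using ab by (simp only: norm_of_real)
    qed
    finally show ?thesis .
  qed
  have "(\<lambda>n. I b n - I a n) \<longlonglongrightarrow> 0"
  proof (rule Lim_null_comparison)
    have "norm (I b n - I a n) \<le> 2 * (\<bar>C\<bar> * (b - a)) * exp (- c * (real n)\<^sup>2)" for n
    proof -
      have "\<i> * (I b n - I a n) = (Q (vline b n) - Q (vline a n)) - (Q (vline b (- real n)) - Q (vline a (- real n)))"
        using FTC[of b n] FTC[of a n] ab by (simp add: right_diff_distrib)
      then have "norm (I b n - I a n) = norm ((Q (vline b n) - Q (vline a n)) - (Q (vline b (- real n)) - Q (vline a (- real n))))"
        by (metis mult_1 norm_ii norm_mult)
      also have "\<dots> \<le> norm (Q (vline b n) - Q (vline a n)) + norm (Q (vline b (- real n)) - Q (vline a (- real n)))"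
        by (rule norm_triangle_ineq4)
      finally show ?thesis using hbd[of n] hbd[of "- real n"] by (simp add: algebra_simps)
    qed
    then show "\<forall>\<^sub>F n in sequentially. norm (I b n - I a n) \<le> 2 * (\<bar>C\<bar> * (b - a)) * exp (- c * (real n)\<^sup>2)"
      by (intro always_eventually allI)
    have "filterlim (\<lambda>n. - c * (real n)\<^sup>2) at_bot sequentially"
      by (rule filterlim_tendsto_neg_mult_at_bot[OF tendsto_const])
         (use c in \<open>auto intro!: filterlim_pow_at_top filterlim_real_sequentially\<close>)
    then have "(\<lambda>n. exp (- c * (real n)\<^sup>2)) \<longlonglongrightarrow> 0" by (rule filterlim_compose[OF exp_at_bot])
    from tendsto_mult_right_zero[OF this] show "(\<lambda>n. 2 * (\<bar>C\<bar> * (b - a)) * exp (- c * (real n)\<^sup>2)) \<longlonglongrightarrow> 0" .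
  qed
  moreover have "(\<lambda>n. I b n - I a n) \<longlonglongrightarrow> (\<integral>t. f (vline b t) \<partial>lborel) - (\<integral>t. f (vline a t) \<partial>lborel)"
    by (intro tendsto_diff lim) (use ab in auto)
  ultimately show "(\<integral>t. f (vline a t) \<partial>lborel) = (\<integral>t. f (vline b t) \<partial>lborel)"
    using LIMSEQ_unique by force
qed

lemma Re_quadratic_vline: "Re (vline \<sigma> t * of_real y + of_real (h\<^sup>2 / 2) * (vline \<sigma> t)\<^sup>2) = \<sigma> * y + h\<^sup>2 / 2 * (\<sigma>\<^sup>2 - t\<^sup>2)"
  by (simp add: power2_eq_square)

lemma quadratic_le:
  fixes \<sigma> m y h t :: real
  assumes "\<bar>\<sigma>\<bar> \<le> m"
  shows "\<sigma> * y + h\<^sup>2 / 2 * (\<sigma>\<^sup>2 - t\<^sup>2) \<le> (m * \<bar>y\<bar> + h\<^sup>2 / 2 * m\<^sup>2) + - (h\<^sup>2 / 2) * t\<^sup>2"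
proof -
  have "\<sigma> * y \<le> \<bar>\<sigma>\<bar> * \<bar>y\<bar>" using abs_ge_self[of "\<sigma> * y"] unfolding abs_mult .
  also have "\<dots> \<le> m * \<bar>y\<bar>" using assms by (intro mult_right_mono) auto
  finally have 1: "\<sigma> * y \<le> m * \<bar>y\<bar>" .
  have "\<sigma>\<^sup>2 \<le> m\<^sup>2" using power_mono[OF assms, of 2] by simp
  then have "h\<^sup>2 / 2 * \<sigma>\<^sup>2 \<le> h\<^sup>2 / 2 * m\<^sup>2" by (intro mult_left_mono) auto
  with 1 show ?thesis by (simp add: algebra_simps)
qed

text \<open>On the line through the saddle point \<open>- y / h\<^sup>2\<close> the exponent is real, and the integral is that of a real
Gaussian.\<close>

lemma gaussian_line_integral:
  assumes h: "h > 0"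
  shows "(\<integral>t. exp (vline \<sigma> t * of_real y + of_real (h\<^sup>2 / 2) * (vline \<sigma> t)\<^sup>2) \<partial>lborel) = of_real (2 * pi * normal_density 0 h y)"
proof -
  define f where "f s = exp (s * complex_of_real y + of_real (h\<^sup>2 / 2) * s\<^sup>2)" for s
  have shift: "(\<integral>t. f (vline a t) \<partial>lborel) = (\<integral>t. f (vline b t) \<partial>lborel)" if ab: "a \<le> b" for a b
  proof (rule line_shift[where \<theta> = "a - 1" and c = "h\<^sup>2 / 2" and C = "exp (max \<bar>a\<bar> \<bar>b\<bar> * \<bar>y\<bar> + h\<^sup>2 / 2 * (max \<bar>a\<bar> \<bar>b\<bar>)\<^sup>2)"])
    show "f holomorphic_on {s. a - 1 < Re s}" unfolding f_def by (intro holomorphic_intros)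
    fix \<sigma> t assume "a \<le> \<sigma>" "\<sigma> \<le> b"
    then have "\<bar>\<sigma>\<bar> \<le> max \<bar>a\<bar> \<bar>b\<bar>" by (auto simp: abs_if)
    from quadratic_le[OF this, of y h t]
    show "norm (f (vline \<sigma> t)) \<le> exp (max \<bar>a\<bar> \<bar>b\<bar> * \<bar>y\<bar> + h\<^sup>2 / 2 * (max \<bar>a\<bar> \<bar>b\<bar>)\<^sup>2) * exp (- (h\<^sup>2 / 2) * t\<^sup>2)"
      unfolding f_def norm_exp_eq_Re Re_quadratic_vline exp_add[symmetric] exp_le_cancel_iff .
  qed (use h ab in auto)
  define \<sigma>0 where "\<sigma>0 = - y / h\<^sup>2"
  have e: "f (vline \<sigma>0 t) = of_real (exp (- y\<^sup>2 / (2 * h\<^sup>2)) * exp (- (h\<^sup>2 / 2) * t\<^sup>2))" for t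
  proof -
    have hy: "complex_of_real h ^ 2 * of_real \<sigma>0 = - of_real y" using h by (simp add: \<sigma>0_def flip: of_real_power)
    have hy2: "complex_of_real (h\<^sup>2 / 2 * \<sigma>0 + y) * \<sigma>0 = of_real (- y\<^sup>2 / (2 * h\<^sup>2))"
      unfolding of_real_eq_iff of_real_mult[symmetric] using h by (simp add: \<sigma>0_def field_simps power2_eq_square)
    have "vline \<sigma>0 t * of_real y + of_real (h\<^sup>2 / 2) * (vline \<sigma>0 t)\<^sup>2 =
       complex_of_real (h\<^sup>2 / 2 * \<sigma>0 + y) * \<sigma>0 + of_real (- (h\<^sup>2 / 2) * t\<^sup>2) + \<i> * of_real t * (of_real y + complex_of_real h ^ 2 * of_real \<sigma>0)"
      by (simp add: power2_eq_square algebra_simps)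
    also have "\<dots> = of_real (- y\<^sup>2 / (2 * h\<^sup>2) + - (h\<^sup>2 / 2) * t\<^sup>2)" unfolding hy hy2 by simp
    finally show ?thesis unfolding f_def exp_add[symmetric] by (simp only: exp_of_real)
  qed
  have "(\<integral>t. f (vline \<sigma> t) \<partial>lborel) = (\<integral>t. f (vline \<sigma>0 t) \<partial>lborel)"
  proof (cases "\<sigma> \<le> \<sigma>0")
    case True
    then show ?thesis by (rule shift)
  next
    case False
    then have "\<sigma>0 \<le> \<sigma>" by simp
    then show ?thesis by (rule shift[symmetric])
  qed
  also have "\<dots> = of_real (exp (- y\<^sup>2 / (2 * h\<^sup>2)) * sqrt (pi / (h\<^sup>2 / 2)))"
  proof -
    have "(\<integral>t. exp (- (h\<^sup>2 / 2) * t\<^sup>2) \<partial>lborel) = sqrt (pi / (h\<^sup>2 / 2))"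
      by (rule integral_exp_neg_square) (use h in simp)
    then show ?thesis unfolding e integral_complex_of_real integral_mult_right_zero by (simp only:)
  qed
  also have "exp (- y\<^sup>2 / (2 * h\<^sup>2)) * sqrt (pi / (h\<^sup>2 / 2)) = 2 * pi * normal_density 0 h y"
  proof -
    have "sqrt (2 * pi * h\<^sup>2) * sqrt (pi / (h\<^sup>2 / 2)) = sqrt ((2 * pi) * (2 * pi))"
      unfolding real_sqrt_mult[symmetric] using h by (simp add: field_simps)
    also have "\<dots> = 2 * pi" unfolding real_sqrt_abs2 by simp
    finally have "sqrt (pi / (h\<^sup>2 / 2)) = 2 * pi * (1 / sqrt (2 * pi * h\<^sup>2))" using h by (simp add: field_simps)
    then show ?thesis unfolding normal_density_def by simp
  qed
  finally show ?thesis unfolding f_def .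
qed

section \<open>Gaussian smoothing of the error term\<close>

lemma pnt_error_transform_holomorphic:
  assumes "\<theta> \<ge> 0" and nz: "\<And>s. Re s > \<theta> \<Longrightarrow> zeta_reg s \<noteq> 0"
  shows "pnt_error_transform holomorphic_on {s. Re s > \<theta>}"
  unfolding pnt_error_transform_def[abs_def]
  by (intro holomorphic_intros holomorphic_on_subset[OF zeta_reg_holomorphic] holomorphic_deriv open_Re_gt)
     (use assms in auto)

lemma pnt_error_transform_growth:
  assumes nz: "\<And>s. Re s > \<theta> \<Longrightarrow> zeta_reg s \<noteq> 0" and \<theta>: "1/2 \<le> \<theta>" "\<theta> < a" "a \<le> 2" and \<kappa>: "\<kappa> > 0"
  shows "\<exists>C>0. \<forall>\<sigma> t. a \<le> \<sigma> \<and> \<sigma> \<le> 2 \<longrightarrow> norm (pnt_error_transform (vline \<sigma> t)) \<le> C * (1 + \<bar>t\<bar>) powr (\<kappa> - 1)"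
proof -
  obtain C where C: "C > 0" "\<And>s. a \<le> Re s \<Longrightarrow> Re s \<le> 2 \<Longrightarrow> norm (deriv zeta_reg s / zeta_reg s) \<le> C * (1 + \<bar>Im s\<bar>) powr \<kappa>"
    using zeta_reg_log_deriv_growth[OF nz \<theta> \<kappa>] by blast
  have "norm (pnt_error_transform (vline \<sigma> t)) \<le> 3 * (1 + C) * (1 + \<bar>t\<bar>) powr (\<kappa> - 1)" if s: "a \<le> \<sigma>" "\<sigma> \<le> 2" for \<sigma> t
  proof -
    let ?s = "vline \<sigma> t" and ?x = "1 + \<bar>t\<bar>"
    have x1: "?x powr \<kappa> \<ge> 1" using \<kappa> by (intro ge_one_powr_ge_zero) auto
    have "norm (1 + deriv zeta_reg ?s / zeta_reg ?s) \<le> 1 + C * ?x powr \<kappa>"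
      using norm_triangle_ineq[of 1 "deriv zeta_reg ?s / zeta_reg ?s"] C(2)[of ?s] s by simp
    also have "\<dots> \<le> (1 + C) * ?x powr \<kappa>" using x1 by (simp add: distrib_right)
    finally have num: "norm (1 + deriv zeta_reg ?s / zeta_reg ?s) \<le> (1 + C) * ?x powr \<kappa>" .
    have den: "?x \<le> 3 * norm ?s"
      using abs_Re_le_cmod[of ?s] abs_Im_le_cmod[of ?s] s \<theta> by simp
    have "norm (pnt_error_transform ?s) = norm (1 + deriv zeta_reg ?s / zeta_reg ?s) / norm ?s"
      unfolding pnt_error_transform_def norm_divide norm_minus_cancel ..
    also have "\<dots> \<le> ((1 + C) * ?x powr \<kappa>) / (?x / 3)"
      by (rule frac_le) (use num den C(1) in auto)
    also have "\<dots> = 3 * (1 + C) * ?x powr (\<kappa> - 1)" by (simp add: powr_diff)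
    finally show ?thesis .
  qed
  then show ?thesis using C(1) by (intro exI[of _ "3 * (1 + C)"]) auto
qed

lemma integrable_one_plus_abs_powr:
  assumes "\<kappa> > (0::real)" shows "integrable lborel (\<lambda>t. (1 + \<bar>t\<bar>) powr (- 1 - \<kappa>))"
proof -
  define g :: "real \<Rightarrow> real" where "g t = (1 + \<bar>t\<bar>) powr (- 1 - \<kappa>) * indicator {0..} t" for t
  have [measurable]: "g \<in> borel_measurable borel" unfolding g_def[abs_def] by measurable
  have "(\<integral>\<^sup>+t. ennreal ((1 + \<bar>t\<bar>) powr (- 1 - \<kappa>)) * indicator {0..} t \<partial>lborel) = ennreal (0 - (- ((1 + 0) powr (- \<kappa>)) / \<kappa>))"
  proof (rule nn_integral_FTC_atLeast)
    fix x :: real assume x: "0 \<le> x"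
    have "((\<lambda>t. - ((1 + t) powr (- \<kappa>)) / \<kappa>) has_real_derivative (1 + x) powr (- \<kappa> - 1)) (at x)"
      using x assms by (auto intro!: derivative_eq_intros)
    moreover have "- \<kappa> - 1 = - 1 - \<kappa>" by simp
    ultimately show "((\<lambda>t. - ((1 + t) powr (- \<kappa>)) / \<kappa>) has_real_derivative (1 + \<bar>x\<bar>) powr (- 1 - \<kappa>)) (at x)"
      using x by simp
  next
    have "((\<lambda>t. (1 + t) powr (- \<kappa>)) \<longlongrightarrow> 0) at_top"
      by (rule tendsto_neg_powr) (use assms in \<open>auto intro!: filterlim_tendsto_add_at_top filterlim_ident\<close>)
    from tendsto_divide[OF tendsto_minus[OF this] tendsto_const, of \<kappa>]
    show "((\<lambda>t. - ((1 + t) powr (- \<kappa>)) / \<kappa>) \<longlongrightarrow> 0) at_top" using assms by simp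
  qed auto
  moreover have "ennreal (g t) = ennreal ((1 + \<bar>t\<bar>) powr (- 1 - \<kappa>)) * indicator {0..} t" for t
    unfolding g_def by (simp add: ennreal_mult' ennreal_indicator)
  ultimately have "(\<integral>\<^sup>+t. ennreal (g t) \<partial>lborel) < \<infinity>" by simp
  then have g: "integrable lborel g"
    by (intro integrableI_nonneg) (auto simp: g_def)
  have g': "integrable lborel (\<lambda>t. g (0 + (-1) * t))" by (rule lborel_integrable_real_affine[OF g]) simp
  show ?thesis
  proof (rule Bochner_Integration.integrable_bound[OF Bochner_Integration.integrable_add[OF g g']])
    show "AE t in lborel. norm ((1 + \<bar>t\<bar>) powr (- 1 - \<kappa>)) \<le> norm (g t + g (0 + (-1) * t))"
      by (rule AE_I2) (auto simp: g_def indicator_def)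
  qed measurable
qed

text \<open>On the line \<open>Re s = 2\<close> the transform is an absolutely convergent integral over \<open>v\<close>; exchanging the
integrals leaves the Fourier transform of a Gaussian inside. Then the line is moved to \<open>Re s = a\<close>.\<close>

lemma smoothed_pnt_error_eq:
  assumes nz: "\<And>s. Re s > \<theta> \<Longrightarrow> zeta_reg s \<noteq> 0" and \<theta>: "1/2 \<le> \<theta>" "\<theta> < a" "a \<le> 2" and h: "h > 0"
  shows "of_real (2 * pi * (\<integral>v. log_pnt_error v * normal_density x h v \<partial>lborel)) =
    (\<integral>t. pnt_error_transform (vline a t) * exp (vline a t * of_real x + of_real (h\<^sup>2 / 2) * (vline a t)\<^sup>2) \<partial>lborel)"
proof -
  define e where "e s = exp (s * complex_of_real x + of_real (h\<^sup>2 / 2) * s\<^sup>2)" for s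
  define f where "f t v = of_real (log_pnt_error v) * exp (- vline 2 t * of_real v) * e (vline 2 t)" for t v
  have conv: "laplace_converges log_pnt_error 2" using laplace_log_pnt_error(1)[of 2] by simp
  have [measurable]: "case_prod f \<in> borel_measurable (lborel \<Otimes>\<^sub>M lborel)"
    unfolding f_def e_def case_prod_beta by measurable
  have ne: "norm (e (vline \<sigma> t)) \<le> exp (2 * \<bar>x\<bar> + h\<^sup>2 / 2 * 2\<^sup>2) * exp (- (h\<^sup>2 / 2) * t\<^sup>2)" if "\<bar>\<sigma>\<bar> \<le> 2" for \<sigma> t
    using quadratic_le[OF that, of x h t]
    unfolding e_def norm_exp_eq_Re Re_quadratic_vline exp_add[symmetric] exp_le_cancel_iff .
  define K where "K = (\<integral>v. norm (of_real (log_pnt_error v) * exp (- (2::complex) * of_real v)) \<partial>lborel)"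
  have nf: "norm (f t v) = norm (of_real (log_pnt_error v) * exp (- (2::complex) * of_real v)) * norm (e (vline 2 t))" for t v
    unfolding f_def norm_mult by (simp add: norm_exp_eq_Re)
  have Ie: "integrable lborel (\<lambda>t. norm (e (vline 2 t)))"
  proof (rule Bochner_Integration.integrable_bound)
    show "integrable lborel (\<lambda>t. exp (2 * \<bar>x\<bar> + h\<^sup>2 / 2 * 2\<^sup>2) * exp (- (h\<^sup>2 / 2) * t\<^sup>2))"
      by (intro integrable_mult_right integrable_exp_neg_square) (use h in simp)
    show "AE t in lborel. norm (norm (e (vline 2 t))) \<le> norm (exp (2 * \<bar>x\<bar> + h\<^sup>2 / 2 * 2\<^sup>2) * exp (- (h\<^sup>2 / 2) * t\<^sup>2))"
      by (rule AE_I2) (use ne[of 2] in simp)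
  qed (unfold e_def, measurable)
  have "integrable (lborel \<Otimes>\<^sub>M lborel) (case_prod f)"
  proof (rule lborel_pair.Fubini_integrable)
    show "integrable lborel (\<lambda>t. \<integral>v. norm (case (t, v) of (t, v) \<Rightarrow> f t v) \<partial>lborel)"
      unfolding prod.case nf integral_mult_left_zero by (intro integrable_mult_right Ie)
    show "AE t in lborel. integrable lborel (\<lambda>v. case (t, v) of (t, v) \<Rightarrow> f t v)"
      unfolding prod.case f_def by (intro AE_I2 integrable_mult_left laplace_integrable) (use conv in simp)
  qed simp
  then have "(\<integral>v. (\<integral>t. f t v \<partial>lborel) \<partial>lborel) = (\<integral>t. (\<integral>v. f t v \<partial>lborel) \<partial>lborel)"
    by (rule lborel_pair.Fubini_integral)
  moreover have "(\<integral>v. f t v \<partial>lborel) = pnt_error_transform (vline 2 t) * e (vline 2 t)" for t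
  proof -
    have "(\<integral>v. f t v \<partial>lborel) = laplace log_pnt_error (vline 2 t) * e (vline 2 t)"
      unfolding f_def laplace_def by simp
    then show ?thesis using laplace_log_pnt_error(2)[of "vline 2 t"] by simp
  qed
  moreover have "(\<integral>t. f t v \<partial>lborel) = of_real (2 * pi * (log_pnt_error v * normal_density x h v))" for v
  proof -
    have "f t v = of_real (log_pnt_error v) * exp (vline 2 t * of_real (x - v) + of_real (h\<^sup>2 / 2) * (vline 2 t)\<^sup>2)" for t
    proof -
      have "exp (- vline 2 t * of_real v) * e (vline 2 t) = exp (vline 2 t * of_real (x - v) + of_real (h\<^sup>2 / 2) * (vline 2 t)\<^sup>2)"
        unfolding e_def exp_add[symmetric] by (rule arg_cong[of _ _ exp]) (simp add: algebra_simps)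
      then show ?thesis unfolding f_def mult.assoc by (simp only:)
    qed
    then have "(\<integral>t. f t v \<partial>lborel) = of_real (log_pnt_error v) * of_real (2 * pi * normal_density 0 h (x - v))"
      using gaussian_line_integral[OF h, of 2 "x - v"] by (simp only: integral_mult_right_zero)
    moreover have "normal_density 0 h (x - v) = normal_density x h v"
      unfolding normal_density_def by (simp add: power2_commute)
    ultimately show ?thesis by simp
  qed
  ultimately have "(\<integral>v. of_real (2 * pi * (log_pnt_error v * normal_density x h v)) \<partial>lborel) = (\<integral>t. pnt_error_transform (vline 2 t) * e (vline 2 t) \<partial>lborel)"
    by (simp only:)
  then have A: "of_real (2 * pi * (\<integral>v. log_pnt_error v * normal_density x h v \<partial>lborel)) = (\<integral>t. pnt_error_transform (vline 2 t) * e (vline 2 t) \<partial>lborel)"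
    unfolding integral_complex_of_real integral_mult_right_zero .
  obtain C where C: "C > 0" "\<And>\<sigma> t. a \<le> \<sigma> \<Longrightarrow> \<sigma> \<le> 2 \<Longrightarrow> norm (pnt_error_transform (vline \<sigma> t)) \<le> C * (1 + \<bar>t\<bar>) powr (1 - 1)"
    using pnt_error_transform_growth[OF nz \<theta>, of 1] by auto
  have C2: "norm (pnt_error_transform (vline \<sigma> t)) \<le> C" if "a \<le> \<sigma>" "\<sigma> \<le> 2" for \<sigma> t
  proof -
    have "1 + \<bar>t\<bar> \<noteq> 0" by linarith
    then show ?thesis using C(2)[OF that, of t] by simp
  qed
  have "(\<integral>t. pnt_error_transform (vline a t) * e (vline a t) \<partial>lborel) = (\<integral>t. pnt_error_transform (vline 2 t) * e (vline 2 t) \<partial>lborel)"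
  proof (rule line_shift[where \<theta> = \<theta> and c = "h\<^sup>2 / 2" and C = "C * exp (2 * \<bar>x\<bar> + h\<^sup>2 / 2 * 2\<^sup>2)" and f = "\<lambda>s. pnt_error_transform s * e s"])
    show "(\<lambda>s. pnt_error_transform s * e s) holomorphic_on {s. \<theta> < Re s}"
      unfolding e_def by (intro holomorphic_intros pnt_error_transform_holomorphic nz) (use \<theta> in auto)
    fix \<sigma> t :: real assume s: "a \<le> \<sigma>" "\<sigma> \<le> 2"
    have "norm (pnt_error_transform (vline \<sigma> t) * e (vline \<sigma> t)) \<le> C * (exp (2 * \<bar>x\<bar> + h\<^sup>2 / 2 * 2\<^sup>2) * exp (- (h\<^sup>2 / 2) * t\<^sup>2))"
      unfolding norm_mult by (intro mult_mono ne) (use C2[OF s, of t] C(1) s \<theta> in auto)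
    then show "norm (pnt_error_transform (vline \<sigma> t) * e (vline \<sigma> t)) \<le> C * exp (2 * \<bar>x\<bar> + h\<^sup>2 / 2 * 2\<^sup>2) * exp (- (h\<^sup>2 / 2) * t\<^sup>2)"
      by (simp only: mult.assoc)
  qed (use \<theta> h in auto)
  then show ?thesis using A unfolding e_def by simp
qed

text \<open>The weight \<open>exp (- h\<^sup>2 t\<^sup>2 / 2)\<close> cuts the integral off at \<open>|t|\<close> of order \<open>1 / h\<close>. Since the transform is nearly
of size \<open>1 / |t|\<close>, this costs only an arbitrarily small power of \<open>1 / h\<close>.\<close>

lemma smoothed_pnt_error_bound:
  assumes nz: "\<And>s. Re s > \<theta> \<Longrightarrow> zeta_reg s \<noteq> 0" and \<theta>: "1/2 \<le> \<theta>" "\<theta> < a" "a \<le> 2" and \<kappa>: "\<kappa> > 0" "\<kappa> \<le> 1/2"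
  shows "\<exists>C>0. \<forall>x h. 0 < h \<and> h \<le> 1 \<longrightarrow> \<bar>\<integral>v. log_pnt_error v * normal_density x h v \<partial>lborel\<bar> \<le> C * exp (a * x) * h powr (- 2 * \<kappa>)"
proof -
  obtain C where C: "C > 0" "\<And>\<sigma> t. a \<le> \<sigma> \<Longrightarrow> \<sigma> \<le> 2 \<Longrightarrow> norm (pnt_error_transform (vline \<sigma> t)) \<le> C * (1 + \<bar>t\<bar>) powr (\<kappa> - 1)"
    using pnt_error_transform_growth[OF nz \<theta> \<kappa>(1)] by auto
  define W where "W = (\<integral>t. (1 + \<bar>t\<bar>) powr (- 1 - \<kappa>) \<partial>lborel)"
  have W: "W \<ge> 0" unfolding W_def by (rule Bochner_Integration.integral_nonneg) simp
  have "\<bar>\<integral>v. log_pnt_error v * normal_density x h v \<partial>lborel\<bar> \<le> (C * exp 2 * 2 * W + 1) * exp (a * x) * h powr (- 2 * \<kappa>)"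
    if h: "0 < h" "h \<le> 1" for x h
  proof -
    let ?S = "\<integral>v. log_pnt_error v * normal_density x h v \<partial>lborel"
    let ?B = "C * exp 2 * exp (a * x) * (2 * h powr (- 2 * \<kappa>))"
    define F where "F t = pnt_error_transform (vline a t) * exp (vline a t * of_real x + of_real (h\<^sup>2 / 2) * (vline a t)\<^sup>2)" for t
    have pw: "norm (F t) \<le> ?B * (1 + \<bar>t\<bar>) powr (- 1 - \<kappa>)" for t
    proof -
      define y where "y = h * \<bar>t\<bar>"
      have y: "y \<ge> 0" using h by (simp add: y_def)
      have "1 + \<bar>t\<bar> \<le> (1 + y) / h" using h by (simp add: y_def field_simps)
      then have "(1 + \<bar>t\<bar>) powr (2 * \<kappa>) \<le> ((1 + y) / h) powr (2 * \<kappa>)" using \<kappa> by (intro powr_mono2) auto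
      also have "\<dots> = (1 + y) powr (2 * \<kappa>) / h powr (2 * \<kappa>)" by (rule powr_divide)
      also have "\<dots> = (1 + y) powr (2 * \<kappa>) * h powr (- 2 * \<kappa>)" using powr_minus_divide[of h "2 * \<kappa>"] by simp
      also have "\<dots> \<le> (2 * exp (y\<^sup>2 / 2)) * h powr (- 2 * \<kappa>)"
      proof (rule mult_right_mono)
        have "(1 + y) powr (2 * \<kappa>) \<le> (1 + y) powr 1" by (rule powr_mono) (use \<kappa> y in auto)
        also have "\<dots> = 1 + y" using y by simp
        also have "\<dots> \<le> 2 * (1 + y\<^sup>2 / 2)" 
        proof -
          have "2 * y \<le> y\<^sup>2 + 1" using zero_le_power2[of "y - 1"] by (simp add: power2_diff)
          then have "1 + y \<le> 2 + y\<^sup>2" using zero_le_power2[of y] by linarith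
          then show ?thesis by (simp add: distrib_left)
        qed
        also have "\<dots> \<le> 2 * exp (y\<^sup>2 / 2)" by (intro mult_left_mono exp_ge_add_one_self) simp
        finally show "(1 + y) powr (2 * \<kappa>) \<le> 2 * exp (y\<^sup>2 / 2)" .
      qed simp
      finally have p1: "(1 + \<bar>t\<bar>) powr (2 * \<kappa>) \<le> exp (h\<^sup>2 / 2 * t\<^sup>2) * (2 * h powr (- 2 * \<kappa>))"
        by (simp add: y_def power_mult_distrib mult_ac)
      have "(1 + \<bar>t\<bar>) powr (\<kappa> - 1) = (1 + \<bar>t\<bar>) powr (2 * \<kappa>) * (1 + \<bar>t\<bar>) powr (- 1 - \<kappa>)"
        by (simp flip: powr_add)
      also have "\<dots> \<le> exp (h\<^sup>2 / 2 * t\<^sup>2) * (2 * h powr (- 2 * \<kappa>)) * (1 + \<bar>t\<bar>) powr (- 1 - \<kappa>)"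
        by (intro mult_right_mono p1) simp
      finally have p2: "(1 + \<bar>t\<bar>) powr (\<kappa> - 1) \<le> exp (h\<^sup>2 / 2 * t\<^sup>2) * (2 * h powr (- 2 * \<kappa>)) * (1 + \<bar>t\<bar>) powr (- 1 - \<kappa>)" .
      have a2: "h\<^sup>2 / 2 * a\<^sup>2 \<le> 2"
      proof -
        have "h\<^sup>2 \<le> 1" using h by (simp add: power_le_one)
        moreover have "a\<^sup>2 \<le> 2\<^sup>2" using \<theta> by (intro power_mono) auto
        ultimately have "h\<^sup>2 * a\<^sup>2 \<le> 1 * 2\<^sup>2" by (intro mult_mono) auto
        then show ?thesis by simp
      qed
      have "norm (F t) \<le> C * (1 + \<bar>t\<bar>) powr (\<kappa> - 1) * exp (a * x + h\<^sup>2 / 2 * (a\<^sup>2 - t\<^sup>2))"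
        unfolding F_def norm_mult norm_exp_eq_Re Re_quadratic_vline
        by (intro mult_right_mono C) (use \<theta> in auto)
      also have "\<dots> \<le> C * (exp (h\<^sup>2 / 2 * t\<^sup>2) * (2 * h powr (- 2 * \<kappa>)) * (1 + \<bar>t\<bar>) powr (- 1 - \<kappa>)) * (exp 2 * exp (a * x) * exp (- (h\<^sup>2 / 2 * t\<^sup>2)))"
      proof (intro mult_mono mult_left_mono p2)
        show "exp (a * x + h\<^sup>2 / 2 * (a\<^sup>2 - t\<^sup>2)) \<le> exp 2 * exp (a * x) * exp (- (h\<^sup>2 / 2 * t\<^sup>2))"
          unfolding exp_add[symmetric] exp_le_cancel_iff using a2 by (simp add: right_diff_distrib)
      qed (use C(1) in auto)
      also have "\<dots> = ?B * (1 + \<bar>t\<bar>) powr (- 1 - \<kappa>) * (exp (h\<^sup>2 / 2 * t\<^sup>2) * exp (- (h\<^sup>2 / 2 * t\<^sup>2)))"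
        by (simp only: ac_simps)
      also have "exp (h\<^sup>2 / 2 * t\<^sup>2) * exp (- (h\<^sup>2 / 2 * t\<^sup>2)) = 1" by (simp flip: exp_add)
      finally show ?thesis by simp
    qed
    have "2 * pi * \<bar>?S\<bar> = norm (complex_of_real (2 * pi * ?S))" unfolding norm_of_real by (simp add: abs_mult)
    also have "\<dots> = norm (\<integral>t. F t \<partial>lborel)"
      using smoothed_pnt_error_eq[OF nz \<theta> h(1), of x] unfolding F_def by (simp only:)
    also have "\<dots> \<le> (\<integral>t. norm (F t) \<partial>lborel)" by (rule integral_norm_bound)
    also have "\<dots> \<le> (\<integral>t. ?B * (1 + \<bar>t\<bar>) powr (- 1 - \<kappa>) \<partial>lborel)"
      by (rule integral_mono'[OF integrable_mult_right[OF integrable_one_plus_abs_powr[OF \<kappa>(1)]] pw]) (use C(1) in auto)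
    also have "\<dots> = ?B * W" unfolding W_def by (rule integral_mult_right_zero)
    finally have "2 * pi * \<bar>?S\<bar> \<le> ?B * W" .
    moreover have "1 * \<bar>?S\<bar> \<le> 2 * pi * \<bar>?S\<bar>" using pi_gt3 by (intro mult_right_mono) auto
    ultimately have "\<bar>?S\<bar> \<le> ?B * W" by linarith
    also have "\<dots> \<le> (C * exp 2 * 2 * W + 1) * exp (a * x) * h powr (- 2 * \<kappa>)"
      by (simp add: algebra_simps)
    finally show ?thesis .
  qed
  moreover have "C * exp 2 * 2 * W + 1 > 0" using C W by (intro add_nonneg_pos) auto
  ultimately show ?thesis by blast
qed

section \<open>Pointwise bound of the error term\<close>

lemma exp_normal_moment:
  assumes "h > 0"
  shows "has_bochner_integral lborel (\<lambda>v. exp (l * v) * normal_density x h v) (exp (l * x + l\<^sup>2 * h\<^sup>2 / 2))"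
proof -
  have "exp (l * v) * normal_density x h v = exp (l * x + l\<^sup>2 * h\<^sup>2 / 2) * normal_density (x + l * h\<^sup>2) h v" for v
  proof -
    have "l * v + - (v - x)\<^sup>2 / (2 * h\<^sup>2) = (l * x + l\<^sup>2 * h\<^sup>2 / 2) + - (v - (x + l * h\<^sup>2))\<^sup>2 / (2 * h\<^sup>2)"
      using assms by (simp add: field_simps power2_eq_square)
    then have "exp (l * v) * exp (- (v - x)\<^sup>2 / (2 * h\<^sup>2)) = exp (l * x + l\<^sup>2 * h\<^sup>2 / 2) * exp (- (v - (x + l * h\<^sup>2))\<^sup>2 / (2 * h\<^sup>2))"
      unfolding exp_add[symmetric] by (simp only:)
    then show ?thesis unfolding normal_density_def
      by (simp only: mult.left_commute[of "exp (l * v)"] mult.left_commute[of "exp (l * x + l\<^sup>2 * h\<^sup>2 / 2)"])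
  qed
  moreover have "has_bochner_integral lborel (normal_density (x + l * h\<^sup>2) h) 1"
    using assms by (simp add: has_bochner_integral_iff)
  from has_bochner_integral_mult_right[OF this, of "exp (l * x + l\<^sup>2 * h\<^sup>2 / 2)"]
  have "has_bochner_integral lborel (\<lambda>v. exp (l * x + l\<^sup>2 * h\<^sup>2 / 2) * normal_density (x + l * h\<^sup>2) h v) (exp (l * x + l\<^sup>2 * h\<^sup>2 / 2))"
    by simp
  ultimately show ?thesis by (simp only:)
qed

lemma exp_ge_twice: "2 * w \<le> exp (w::real)" if "w \<ge> 0"
proof -
  have "2 * w \<le> 1 + w + w\<^sup>2 / 2" using zero_le_power2[of "w - 1"] by (simp add: power2_diff)
  also have "\<dots> \<le> exp w" using exp_lower_Taylor_quadratic[OF that] by simp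
  finally show ?thesis .
qed

lemma psi_normal_integrable:
  assumes "h > 0"
  shows "integrable lborel (\<lambda>v. chebyshev_psi (exp v) * normal_density x h v)"
    and "integrable lborel (\<lambda>v. indicator {0..} v * exp v * normal_density x h v)"
proof -
  have I2: "integrable lborel (\<lambda>v. exp (2 * v) * normal_density x h v)" and I1: "integrable lborel (\<lambda>v. exp (1 * v) * normal_density x h v)"
    using exp_normal_moment[OF assms, of 2 x] exp_normal_moment[OF assms, of 1 x] unfolding has_bochner_integral_iff by blast+
  show "integrable lborel (\<lambda>v. chebyshev_psi (exp v) * normal_density x h v)"
  proof (rule Bochner_Integration.integrable_bound[OF I2])
    show "AE v in lborel. norm (chebyshev_psi (exp v) * normal_density x h v) \<le> norm (exp (2 * v) * normal_density x h v)"
      by (rule AE_I2) (auto simp: abs_mult chebyshev_psi_nonneg chebyshev_psi_exp_le intro!: mult_right_mono)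
  qed measurable
  show "integrable lborel (\<lambda>v. indicator {0..} v * exp v * normal_density x h v)"
    by (rule Bochner_Integration.integrable_bound[OF I1]) (auto simp: indicator_def)
qed

text \<open>Smoothing with width \<open>h = exp (- 2 w)\<close> around points at distance \<open>d = exp (- w)\<close> on either side of \<open>w\<close>: up to
negligible Gaussian tails, the mean of the nondecreasing function \<open>v \<mapsto> \<psi> (exp v)\<close> around \<open>w + d\<close>
is at least its value at \<open>w\<close>, and the mean around \<open>w - d\<close> is at most that value, while \<open>exp (w + d)\<close>
and \<open>exp (w - d)\<close> differ from \<open>exp w\<close> by a bounded amount.\<close>

lemma log_pnt_error_bound:
  assumes nz: "\<And>s. Re s > \<theta> \<Longrightarrow> zeta_reg s \<noteq> 0" and \<theta>: "1/2 \<le> \<theta>" "\<theta> < a" "a \<le> 2"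
  shows "\<exists>C>0. \<forall>u\<ge>0. \<bar>log_pnt_error u\<bar> \<le> C * exp (a * u)"
proof -
  \<comment> \<open>The exponents are chosen so that \<open>exp (b w) * h powr (- 2 \<kappa>) = exp (a w)\<close> for \<open>h = exp (- 2 w)\<close>.\<close>
  define b where "b = (\<theta> + a) / 2"
  define \<kappa> where "\<kappa> = (a - \<theta>) / 8"
  have b: "\<theta> < b" "b \<le> 2" and \<kappa>: "\<kappa> > 0" "\<kappa> \<le> 1/2" and b\<kappa>: "b + 4 * \<kappa> = a"
    using \<theta> by (auto simp: b_def \<kappa>_def field_simps)
  obtain C where C: "C > 0" "\<And>x h. 0 < h \<Longrightarrow> h \<le> 1 \<Longrightarrow> \<bar>\<integral>v. log_pnt_error v * normal_density x h v \<partial>lborel\<bar> \<le> C * exp (b * x) * h powr (- 2 * \<kappa>)"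
    using smoothed_pnt_error_bound[OF nz \<theta>(1) b \<kappa>] by blast
  define K :: real where "K = exp (1/2) + 2 * exp 2 + exp (9/2) + 2"
  have K: "K > 0" unfolding K_def by (intro add_pos_pos) auto
  have "\<bar>log_pnt_error w\<bar> \<le> (C * exp 2 + K) * exp (a * w)" if w: "w \<ge> 0" for w
  proof -
    define h d where "h = exp (- 2 * w)" and "d = exp (- w)"
    have h: "0 < h" "h \<le> 1" using w by (auto simp: h_def)
    have d: "0 < d" "d \<le> 1" using w by (auto simp: d_def)
    have hd: "h = d * d" unfolding h_def d_def by (simp flip: exp_add)
    have dh: "d / h = exp w" unfolding h_def d_def by (simp flip: exp_diff)
    have ed: "exp w * d = 1" unfolding d_def by (simp flip: exp_add)
    have e2w: "2 * w \<le> exp w" by (rule exp_ge_twice[OF w])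
    define P where "P v = chebyshev_psi (exp v)" for v
    define N where "N = normal_density"
    define S where "S x = (\<integral>v. log_pnt_error v * N x h v \<partial>lborel)" for x
    define T where "T x = (\<integral>v. indicator {0..} v * exp v * N x h v \<partial>lborel)" for x
    have N0: "N x h v \<ge> 0" for x v by (simp add: N_def)
    have IP: "integrable lborel (\<lambda>v. P v * N x h v)" for x unfolding P_def N_def by (rule psi_normal_integrable(1)[OF h(1)])
    have IT: "integrable lborel (\<lambda>v. indicator {0..} v * exp v * N x h v)" for x unfolding N_def by (rule psi_normal_integrable(2)[OF h(1)])
    have IN: "integrable lborel (\<lambda>v. N x h v)" and IN1: "(\<integral>v. N x h v \<partial>lborel) = 1" for x
      unfolding N_def using h by auto
    have M: "integrable lborel (\<lambda>v. exp (l * v) * N x h v)" "(\<integral>v. exp (l * v) * N x h v \<partial>lborel) = exp (l * x + l\<^sup>2 * h\<^sup>2 / 2)" for l x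
      using exp_normal_moment[OF h(1), of l x] unfolding N_def by (auto simp: has_bochner_integral_iff)
    have PST: "(\<integral>v. P v * N x h v \<partial>lborel) = S x + T x" for x
    proof -
      have "S x = (\<integral>v. P v * N x h v - indicator {0..} v * exp v * N x h v \<partial>lborel)"
        unfolding S_def P_def log_pnt_error_def by (simp add: left_diff_distrib)
      then show ?thesis unfolding T_def using IP IT by simp
    qed
    have Sb: "\<bar>S x\<bar> \<le> C * exp 2 * exp (a * w)" if "x \<le> w + 1" for x
    proof -
      have hk: "h powr (- 2 * \<kappa>) = exp (4 * \<kappa> * w)" unfolding h_def by (simp add: powr_def)
      have "b * x \<le> b * (w + 1)" using that b \<theta> by (intro mult_left_mono) auto
      also have "\<dots> \<le> b * w + 2" using b by (simp add: distrib_left)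
      finally have "b * x + 4 * \<kappa> * w \<le> 2 + a * w" unfolding b\<kappa>[symmetric] by (simp add: distrib_right)
      then have "exp (b * x + 4 * \<kappa> * w) \<le> exp (2 + a * w)" by (simp only: exp_le_cancel_iff)
      then have "C * (exp (b * x) * exp (4 * \<kappa> * w)) \<le> C * (exp 2 * exp (a * w))"
        unfolding exp_add using C(1) by (intro mult_left_mono) auto
      moreover have "\<bar>S x\<bar> \<le> C * exp (b * x) * h powr (- 2 * \<kappa>)" unfolding S_def N_def by (rule C(2)[OF h])
      ultimately show ?thesis unfolding hk by (simp only: mult.assoc)
    qed
    have Pw: "P w \<le> exp (2 * w)" "P w \<ge> 0" unfolding P_def by (rule chebyshev_psi_exp_le, rule chebyshev_psi_nonneg)
    have Pmono: "P v \<le> P v'" if "v \<le> v'" for v v' unfolding P_def by (rule chebyshev_psi_mono) (use that in simp)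
    have ew: "1 \<le> exp (a * w)" using w \<theta> by simp
    have upper: "P w - exp w \<le> \<bar>S (w + d)\<bar> + (exp (1/2) + 2 * exp 2)"
    proof -
      let ?x = "w + d" and ?l = "- 1 / h"
      \<comment> \<open>To the left of \<open>w\<close> the factor \<open>exp ((w - v) / h)\<close> is at least 1, so the last term makes up for the missing monotonicity; its integral is tiny.\<close>
      have "P w * N ?x h v \<le> P v * N ?x h v + P w * exp (w / h) * (exp (?l * v) * N ?x h v)" for v
      proof (cases "w \<le> v")
        case True
        have "P w * N ?x h v \<le> P v * N ?x h v" by (intro mult_right_mono Pmono True N0)
        moreover have "0 \<le> P w * exp (w / h) * (exp (?l * v) * N ?x h v)" using Pw N0 by (intro mult_nonneg_nonneg) auto
        ultimately show ?thesis by linarith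
      next
        case False
        have "exp (w / h) * exp (?l * v) = exp ((w - v) / h)" unfolding exp_add[symmetric] by (simp add: diff_divide_distrib)
        moreover have "1 \<le> exp ((w - v) / h)" using False h by simp
        ultimately have "1 * (P w * N ?x h v) \<le> (exp (w / h) * exp (?l * v)) * (P w * N ?x h v)"
          using Pw N0 by (intro mult_right_mono mult_nonneg_nonneg) auto
        moreover have "0 \<le> P v * N ?x h v" using N0 chebyshev_psi_nonneg by (simp add: P_def)
        ultimately show ?thesis by (simp add: mult_ac)
      qed
      then have "(\<integral>v. P w * N ?x h v \<partial>lborel) \<le> (\<integral>v. P v * N ?x h v + P w * exp (w / h) * (exp (?l * v) * N ?x h v) \<partial>lborel)"
        by (intro integral_mono integrable_mult_right IN Bochner_Integration.integrable_add IP M)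
      also have "\<dots> = (\<integral>v. P v * N ?x h v \<partial>lborel) + P w * exp (w / h) * (\<integral>v. exp (?l * v) * N ?x h v \<partial>lborel)"
        by (subst Bochner_Integration.integral_add[OF IP integrable_mult_right[OF M(1)]]) (simp only: integral_mult_right_zero)
      also have "\<dots> = (S ?x + T ?x) + P w * exp (w / h) * exp (?l * ?x + ?l\<^sup>2 * h\<^sup>2 / 2)"
        unfolding PST M(2) ..
      also have "(\<integral>v. P w * N ?x h v \<partial>lborel) = P w" by (simp add: IN1)
      also have "P w * exp (w / h) * exp (?l * ?x + ?l\<^sup>2 * h\<^sup>2 / 2) = P w * exp (1/2 - exp w)"
      proof -
        have "w / h + (?l * ?x + ?l\<^sup>2 * h\<^sup>2 / 2) = 1/2 - d / h" using h by (simp add: field_simps power2_eq_square)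
        then show ?thesis unfolding mult.assoc exp_add[symmetric] dh by (simp only:)
      qed
      also have "P w * exp (1/2 - exp w) \<le> exp (1/2)"
      proof -
        have "P w * exp (1/2 - exp w) \<le> exp (2 * w) * exp (1/2 - exp w)" using Pw by (intro mult_right_mono) auto
        also have "\<dots> \<le> exp (1/2)" unfolding exp_add[symmetric] exp_le_cancel_iff using e2w by simp
        finally show ?thesis .
      qed
      finally have 1: "P w \<le> S ?x + T ?x + exp (1/2)" by simp
      have "T ?x \<le> (\<integral>v. exp (1 * v) * N ?x h v \<partial>lborel)"
        unfolding T_def by (intro integral_mono IT M mult_right_mono N0) (auto simp: indicator_def)
      also have "\<dots> = exp (?x + h\<^sup>2 / 2)" unfolding M(2) by simp
      also have "\<dots> = exp w * exp (d + h\<^sup>2 / 2)" unfolding exp_add[symmetric] by (simp add: add.assoc)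
      also have "\<dots> \<le> exp w + 2 * exp 2"
      proof -
        define y where "y = d + h\<^sup>2 / 2"
        have "h\<^sup>2 \<le> h" using h by (simp add: power2_eq_square mult_left_le)
        moreover have "h \<le> d" unfolding hd using d by (simp add: mult_left_le)
        ultimately have y: "y \<le> 2 * d" "y \<le> 2" unfolding y_def using h d by auto
        have y0: "0 < y" unfolding y_def using d by (intro add_pos_nonneg) auto
        have "1 - y \<le> exp (- y)" using exp_ge_add_one_self[of "- y"] by simp
        then have "(1 - y) * exp y \<le> exp (- y) * exp y" by (intro mult_right_mono) auto
        then have "exp y \<le> 1 + y * exp y" by (simp add: left_diff_distrib flip: exp_add)
        also have "y * exp y \<le> (2 * d) * exp 2" using y y0 d by (intro mult_mono) auto
        finally have "exp w * exp y \<le> exp w * (1 + (2 * d) * exp 2)" by (intro mult_left_mono) auto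
        also have "\<dots> = exp w + (exp w * d) * (2 * exp 2)" by (simp add: algebra_simps)
        finally show ?thesis unfolding ed y_def by simp
      qed
      finally have "T ?x \<le> exp w + 2 * exp 2" .
      with 1 show ?thesis by linarith
    qed
    have lower: "exp w - P w \<le> \<bar>S (w - d)\<bar> + (exp (9/2) + 2)"
    proof -
      let ?x = "w - d" and ?l = "2 + 1 / h"
      \<comment> \<open>To the right of \<open>w\<close> the trivial bound \<open>P v \<le> exp (2 v)\<close> is used, again with an exponential factor that exceeds 1 there.\<close>
      have "P v * N ?x h v \<le> P w * N ?x h v + exp (- w / h) * (exp (?l * v) * N ?x h v)" for v
      proof (cases "v \<le> w")
        case True
        have "P v * N ?x h v \<le> P w * N ?x h v" by (intro mult_right_mono Pmono True N0)
        moreover have "0 \<le> exp (- w / h) * (exp (?l * v) * N ?x h v)" using N0 by (intro mult_nonneg_nonneg) auto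
        ultimately show ?thesis by linarith
      next
        case False
        have "exp (- w / h) * exp (?l * v) = exp (2 * v + (v - w) / h)"
          unfolding exp_add[symmetric] by (rule arg_cong[of _ _ exp]) (simp add: diff_divide_distrib algebra_simps)
        moreover have "exp (2 * v) \<le> exp (2 * v + (v - w) / h)" using False h by simp
        moreover have "P v \<le> exp (2 * v)" unfolding P_def by (rule chebyshev_psi_exp_le)
        ultimately have "P v \<le> exp (- w / h) * exp (?l * v)" by linarith
        then have "P v * N ?x h v \<le> exp (- w / h) * exp (?l * v) * N ?x h v" by (intro mult_right_mono N0)
        moreover have "0 \<le> P w * N ?x h v" using N0 Pw by simp
        ultimately show ?thesis by (simp only: mult.assoc)
      qed
      then have "(\<integral>v. P v * N ?x h v \<partial>lborel) \<le> (\<integral>v. P w * N ?x h v + exp (- w / h) * (exp (?l * v) * N ?x h v) \<partial>lborel)"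
        by (intro integral_mono integrable_mult_right IN Bochner_Integration.integrable_add IP M)
      also have "\<dots> = P w * (\<integral>v. N ?x h v \<partial>lborel) + exp (- w / h) * (\<integral>v. exp (?l * v) * N ?x h v \<partial>lborel)"
        by (subst Bochner_Integration.integral_add[OF integrable_mult_right[OF IN] integrable_mult_right[OF M(1)]]) (simp only: integral_mult_right_zero)
      also have "\<dots> = P w + exp (- w / h) * exp (?l * ?x + ?l\<^sup>2 * h\<^sup>2 / 2)"
        unfolding IN1 M(2) by simp
      also have "exp (- w / h) * exp (?l * ?x + ?l\<^sup>2 * h\<^sup>2 / 2) \<le> exp (9/2)"
      proof -
        have "- w / h + (?l * ?x + ?l\<^sup>2 * h\<^sup>2 / 2) = 2 * ?x - d / h + (2 * h + 1)\<^sup>2 / 2"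
          using h by (simp add: field_simps power2_eq_square)
        also have "\<dots> \<le> 9 / 2"
        proof -
          have "(2 * h + 1)\<^sup>2 \<le> 3\<^sup>2" using h by (intro power_mono) auto
          then show ?thesis unfolding dh using e2w d by simp
        qed
        finally show ?thesis unfolding exp_add[symmetric] exp_le_cancel_iff .
      qed
      finally have 1: "S ?x + T ?x \<le> P w + exp (9/2)" unfolding PST by simp
      have "exp (1 * v) * N ?x h v \<le> indicator {0..} v * exp v * N ?x h v + N ?x h v" for v
      proof (cases "v \<ge> 0")
        case False
        then have "exp (1 * v) * N ?x h v \<le> 1 * N ?x h v" by (intro mult_right_mono N0) simp
        then show ?thesis using False by simp
      qed (use N0 in simp)
      then have "(\<integral>v. exp (1 * v) * N ?x h v \<partial>lborel) \<le> (\<integral>v. indicator {0..} v * exp v * N ?x h v + N ?x h v \<partial>lborel)"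
        by (intro integral_mono M Bochner_Integration.integrable_add IT IN)
      also have "\<dots> = T ?x + 1" unfolding T_def using IT IN by (simp add: IN1)
      finally have "exp (?x + h\<^sup>2 / 2) \<le> T ?x + 1" unfolding M(2) by simp
      moreover have "exp ?x \<le> exp (?x + h\<^sup>2 / 2)" by simp
      moreover have "exp w - 1 \<le> exp ?x"
      proof -
        have "exp w * (1 - d) \<le> exp w * exp (- d)" using exp_ge_add_one_self[of "- d"] by (intro mult_left_mono) auto
        then show ?thesis using ed by (simp add: right_diff_distrib exp_minus exp_diff divide_inverse)
      qed
      ultimately show ?thesis using 1 by linarith
    qed
    have L: "log_pnt_error w = P w - exp w" unfolding log_pnt_error_def P_def using w by simp
    have S1: "\<bar>S (w + d)\<bar> \<le> C * exp 2 * exp (a * w)" and S2: "\<bar>S (w - d)\<bar> \<le> C * exp 2 * exp (a * w)"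
      by (rule Sb, use d in simp)+
    have K1: "exp (1/2) + 2 * exp 2 \<le> K" and K2: "exp (9/2) + 2 \<le> K" unfolding K_def by simp_all
    have "\<bar>log_pnt_error w\<bar> \<le> C * exp 2 * exp (a * w) + K"
      unfolding L by (rule abs_leI) (use upper lower S1 S2 K1 K2 in linarith)+
    also have "K \<le> K * exp (a * w)" using K ew by simp
    finally show ?thesis by (simp add: distrib_right)
  qed
  moreover have "C * exp 2 + K > 0" using C K by (intro add_pos_pos) auto
  ultimately show ?thesis by blast
qed

section \<open>Contradiction from a sparse exceptional set\<close>

lemma laplace_converges_linear:
  assumes "laplace_converges f \<sigma>" "laplace_converges g \<sigma>"
  shows "laplace_converges (\<lambda>u. a * f u + b * g u) \<sigma>"
    and "Re s = \<sigma> \<Longrightarrow> laplace (\<lambda>u. a * f u + b * g u) s = a * laplace f s + b * laplace g s"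
proof -
  have [measurable]: "f \<in> borel_measurable borel" "g \<in> borel_measurable borel"
    and z: "\<And>u. u < 0 \<Longrightarrow> f u = 0" "\<And>u. u < 0 \<Longrightarrow> g u = 0"
    and I: "integrable lborel (\<lambda>u. f u * exp (- \<sigma> * u))" "integrable lborel (\<lambda>u. g u * exp (- \<sigma> * u))"
    using assms unfolding laplace_converges_def by auto
  have "integrable lborel (\<lambda>u. a * (f u * exp (- \<sigma> * u)) + b * (g u * exp (- \<sigma> * u)))"
    by (intro Bochner_Integration.integrable_add integrable_mult_right I)
  then have "integrable lborel (\<lambda>u. (a * f u + b * g u) * exp (- \<sigma> * u))"
    by (simp only: distrib_right mult.assoc)
  then show "laplace_converges (\<lambda>u. a * f u + b * g u) \<sigma>"
    unfolding laplace_converges_def using z by auto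
  assume s: "Re s = \<sigma>"
  have J: "integrable lborel (\<lambda>u. of_real (f u) * exp (- s * of_real u) :: complex)" "integrable lborel (\<lambda>u. of_real (g u) * exp (- s * of_real u) :: complex)"
    by (rule laplace_integrable, use assms s in simp)+
  have "laplace (\<lambda>u. a * f u + b * g u) s =
     (\<integral>u. of_real a * (of_real (f u) * exp (- s * of_real u)) + of_real b * (of_real (g u) * exp (- s * of_real u)) \<partial>lborel)"
    unfolding laplace_def by (intro Bochner_Integration.integral_cong refl) (simp add: distrib_right mult.assoc)
  also have "\<dots> = a * laplace f s + b * laplace g s"
    unfolding laplace_def
    by (subst Bochner_Integration.integral_add[OF integrable_mult_right[OF J(1)] integrable_mult_right[OF J(2)]])
       (simp only: integral_mult_right_zero)
  finally show "laplace (\<lambda>u. a * f u + b * g u) s = a * laplace f s + b * laplace g s" .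
qed

lemma laplace_converges_bound:
  assumes [measurable]: "f \<in> borel_measurable borel" and z: "\<And>u. u < 0 \<Longrightarrow> f u = 0"
    and g: "integrable lborel (\<lambda>u. g u * exp (- \<sigma> * u))"
    and bd: "\<And>u. u \<ge> 0 \<Longrightarrow> \<bar>f u\<bar> \<le> g u"
  shows "laplace_converges f \<sigma>"
proof -
  have "integrable lborel (\<lambda>u. f u * exp (- \<sigma> * u))"
  proof (rule Bochner_Integration.integrable_bound[OF g])
    show "AE u in lborel. norm (f u * exp (- \<sigma> * u)) \<le> norm (g u * exp (- \<sigma> * u))"
    proof (rule AE_I2)
      fix u :: real
      show "norm (f u * exp (- \<sigma> * u)) \<le> norm (g u * exp (- \<sigma> * u))"
      proof (cases "u < 0")
        case False
        then have "\<bar>f u\<bar> \<le> \<bar>g u\<bar>" using bd[of u] by simp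
        then show ?thesis by (simp add: abs_mult mult_right_mono)
      qed (simp add: z)
    qed
  qed measurable
  then show ?thesis using z unfolding laplace_converges_def by simp
qed

lemma laplace_exp:
  fixes b \<sigma> :: real
  assumes "\<sigma> > b"
  shows "laplace_converges (\<lambda>u. indicator {0..} u * exp (b * u)) \<sigma>"
    and "Re s = \<sigma> \<Longrightarrow> laplace (\<lambda>u. indicator {0..} u * exp (b * u)) s = 1 / (s - of_real b)"
proof -
  have e: "of_real (indicator {0..} u * exp (b * u)) * exp (- s * of_real u) = (indicator {0..} u *\<^sub>R exp (- (s - of_real b) * of_real u) :: complex)" for s u
  proof -
    have "of_real (exp (b * u)) * exp (- s * of_real u) = (exp (- (s - of_real b) * of_real u) :: complex)"
      unfolding exp_of_real[symmetric] exp_add[symmetric] by (rule arg_cong[of _ _ exp]) (simp add: algebra_simps)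
    then show ?thesis by (simp add: indicator_def)
  qed
  have hb: "has_bochner_integral lborel (\<lambda>u. of_real (indicator {0..} u * exp (b * u)) * exp (- s * of_real u)) (1 / (s - of_real b))"
    if "Re s > b" for s
    unfolding e using exp_tail_integral(1)[of "s - of_real b" 0] that by simp
  show "Re s = \<sigma> \<Longrightarrow> laplace (\<lambda>u. indicator {0..} u * exp (b * u)) s = 1 / (s - of_real b)"
    using hb[of s] assms by (auto simp: laplace_def has_bochner_integral_iff)
  have "integrable lborel (\<lambda>u. norm (of_real (indicator {0..} u * exp (b * u)) * exp (- of_real \<sigma> * of_real u) :: complex))"
    by (rule integrable_norm) (use hb[of "of_real \<sigma>"] assms in \<open>auto simp: has_bochner_integral_iff\<close>)
  then have I: "integrable lborel (\<lambda>u. \<bar>indicator {0..} u * exp (b * u)\<bar> * exp (- \<sigma> * u))"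
    by (simp only: norm_laplace_integrand[where f = "\<lambda>u. indicator {0..} u * exp (b * u)" and s = "of_real \<sigma>"] Re_complex_of_real)
  show "laplace_converges (\<lambda>u. indicator {0..} u * exp (b * u)) \<sigma>"
    by (rule laplace_converges_bound[OF _ _ I]) auto
qed

text \<open>The limit \<open>n\<close> is the multiplicity of the zero.\<close>

lemma log_deriv_simple_pole:
  assumes hol: "f holomorphic_on UNIV" and z: "f z = 0" and nc: "f w \<noteq> 0"
  shows "\<exists>n::nat. n > 0 \<and> ((\<lambda>\<delta>. of_real \<delta> * (deriv f (z + of_real \<delta>) / f (z + of_real \<delta>))) \<longlongrightarrow> of_nat n) (at_right (0::real))"
proof -
  have "\<not> f constant_on UNIV" using z nc unfolding constant_on_def by (metis UNIV_I)
  then obtain g r n where g: "0 < n" "0 < r" "g holomorphic_on ball z r"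
      "\<And>w. w \<in> ball z r \<Longrightarrow> f w = (w - z)^n * g w" "\<And>w. w \<in> ball z r \<Longrightarrow> g w \<noteq> 0"
    using holomorphic_factor_zero_nonconstant[OF hol open_UNIV connected_UNIV UNIV_I z] by metis
  define q where "q w = of_nat n + (w - z) * (deriv g w / g w)" for w
  have q: "(w - z) * (deriv f w / f w) = q w" if w: "w \<in> ball z r" "w \<noteq> z" for w
  proof -
    have "(g has_field_derivative deriv g w) (at w)" by (rule holomorphic_derivI[OF g(3) open_ball w(1)])
    then have "((\<lambda>w. (w - z)^n * g w) has_field_derivative (of_nat n * (w - z)^(n - 1) * g w + deriv g w * (w - z)^n)) (at w)"
      by (auto intro!: derivative_eq_intros)
    then have "(f has_field_derivative (of_nat n * (w - z)^(n - 1) * g w + deriv g w * (w - z)^n)) (at w)"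
      by (rule has_field_derivative_transform_within_open[OF _ open_ball w(1)]) (use g(4) in auto)
    then have d: "deriv f w = of_nat n * (w - z)^(n - 1) * g w + deriv g w * (w - z)^n" by (rule DERIV_imp_deriv)
    have p: "(w - z)^n = (w - z) * (w - z)^(n - 1)" using g(1) by (metis power_minus_mult mult.commute)
    have "(w - z)^(n - 1) \<noteq> 0" using w by simp
    then show ?thesis unfolding d g(4)[OF w(1)] q_def p using g(5)[OF w(1)] w(2) by (simp add: field_simps)
  qed
  have "isCont q z"
  proof -
    have "(\<lambda>w. deriv g w / g w) holomorphic_on ball z r"
      by (intro holomorphic_intros holomorphic_deriv g) auto
    then have c: "isCont (\<lambda>w. deriv g w / g w) z"
      using g(2) holomorphic_on_imp_continuous_on continuous_on_interior by (metis centre_in_ball interior_ball)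
    have "isCont (\<lambda>w. w - z) z" by (intro continuous_intros)
    from continuous_add[OF continuous_const[of _ "of_nat n"] continuous_mult[OF this c]]
    show ?thesis unfolding q_def .
  qed
  then have "(q \<longlongrightarrow> of_nat n) (at z)" unfolding isCont_def q_def by simp
  moreover have "filterlim (\<lambda>\<delta>. z + of_real \<delta>) (at z) (at_right (0::real))"
  proof (rule filterlim_atI)
    have "((\<lambda>\<delta>. z + of_real \<delta>) \<longlongrightarrow> z + of_real 0) (at_right (0::real))" by (intro tendsto_intros)
    then show "((\<lambda>\<delta>. z + of_real \<delta>) \<longlongrightarrow> z) (at_right (0::real))" by simp
    show "\<forall>\<^sub>F \<delta> in at_right (0::real). z + of_real \<delta> \<noteq> z"
      by (simp add: eventually_at_filter)
  qed
  ultimately have "((\<lambda>\<delta>. q (z + of_real \<delta>)) \<longlongrightarrow> of_nat n) (at_right (0::real))"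
    by (rule filterlim_compose)
  moreover have "\<forall>\<^sub>F \<delta> in at_right (0::real). q (z + of_real \<delta>) = of_real \<delta> * (deriv f (z + of_real \<delta>) / f (z + of_real \<delta>))"
    unfolding eventually_at_right_field
  proof (intro exI[of _ r] conjI allI impI)
    fix \<delta> :: real assume "0 < \<delta>" "\<delta> < r"
    then show "q (z + of_real \<delta>) = of_real \<delta> * (deriv f (z + of_real \<delta>) / f (z + of_real \<delta>))"
      using q[of "z + of_real \<delta>"] by (simp add: dist_norm)
  qed (rule g(2))
  ultimately have "((\<lambda>\<delta>. of_real \<delta> * (deriv f (z + of_real \<delta>) / f (z + of_real \<delta>))) \<longlongrightarrow> of_nat n) (at_right (0::real))"
    by (rule Lim_transform_eventually)
  then show ?thesis using g(1) by blast
qed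

lemma laplace_log_pnt_error_extended:
  assumes "\<theta> \<ge> 0" and nz: "\<And>s. Re s > \<theta> \<Longrightarrow> zeta_reg s \<noteq> 0"
    and conv: "\<And>\<sigma>. \<sigma> > \<theta> \<Longrightarrow> laplace_converges log_pnt_error \<sigma>" and s: "Re s > \<theta>"
  shows "laplace log_pnt_error s = pnt_error_transform s"
proof (rule analytic_continuation_open[of "{s. Re s > max 1 \<theta>}" "{s. Re s > \<theta>}" "laplace log_pnt_error" pnt_error_transform])
  show "{s. Re s > max 1 \<theta>} \<noteq> {}" by (auto intro!: exI[of _ "of_real (max 1 \<theta> + 1)"])
  show "laplace log_pnt_error holomorphic_on {s. \<theta> < Re s}" by (rule laplace_holomorphic[OF conv])
  show "open {s. Re s > max 1 \<theta>}" by (rule open_Re_gt)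
  show "pnt_error_transform holomorphic_on {s. \<theta> < Re s}" by (rule pnt_error_transform_holomorphic[OF assms(1) nz])
  show "laplace log_pnt_error z = pnt_error_transform z" if "z \<in> {s. Re s > max 1 \<theta>}" for z
    using that by (intro laplace_log_pnt_error) simp
qed (use s in \<open>auto intro: open_Re_gt connected_Re_gt\<close>)

text \<open>A Laplace integral that converges in a larger half plane continues \<open>G\<close> to it, and \<open>g\<close> solves the linear
equation \<open>g' = - g (1 + s G)\<close> there.\<close>

lemma zero_free_from_convergence:
  assumes conv: "\<And>\<sigma>. \<sigma> > \<theta> \<Longrightarrow> laplace_converges log_pnt_error \<sigma>" and s: "Re s > \<theta>"
  shows "zeta_reg s \<noteq> 0"
proof (rule linear_ode_nonzero[where f = zeta_reg and z = s and S = "{s. Re s > \<theta>}" and k = "\<lambda>s. - 1 - s * laplace log_pnt_error s" and ?z0.0 = "of_real (max 1 \<theta> + 1)"])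
  let ?k = "\<lambda>s. - 1 - s * laplace log_pnt_error s"
  show hz: "zeta_reg holomorphic_on {s. \<theta> < Re s}" using zeta_reg_holomorphic holomorphic_on_subset by blast
  show hk: "?k holomorphic_on {s. \<theta> < Re s}" by (intro holomorphic_intros laplace_holomorphic conv)
  show "deriv zeta_reg z = zeta_reg z * ?k z" if "z \<in> {s. \<theta> < Re s}" for z
  proof (rule analytic_continuation_open[of "{s. Re s > max 1 \<theta>}" "{s. Re s > \<theta>}" "deriv zeta_reg" "\<lambda>z. zeta_reg z * ?k z"])
    show "{s. Re s > max 1 \<theta>} \<noteq> {}" by (auto intro!: exI[of _ "of_real (max 1 \<theta> + 1)"])
    show "open {s. Re s > max 1 \<theta>}" by (rule open_Re_gt)
    show "deriv zeta_reg holomorphic_on {s. \<theta> < Re s}" by (rule holomorphic_deriv[OF hz open_Re_gt])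
    show "(\<lambda>z. zeta_reg z * ?k z) holomorphic_on {s. \<theta> < Re s}" by (intro holomorphic_on_mult hz hk)
    show "deriv zeta_reg z = zeta_reg z * ?k z" if "z \<in> {s. Re s > max 1 \<theta>}" for z
    proof -
      have "Re z > 1" "z \<noteq> 0" using that by auto
      then show ?thesis using zeta_reg_nonzero_Re_gt_1[of z] laplace_log_pnt_error(2)[of z]
        by (simp add: pnt_error_transform_def)
    qed
  qed (use that in \<open>auto intro: open_Re_gt connected_Re_gt\<close>)
  show "zeta_reg (of_real (max 1 \<theta> + 1)) \<noteq> 0" by (rule zeta_reg_nonzero_Re_gt_1) auto
qed (use s in \<open>auto intro: open_Re_gt convex_Re_gt\<close>)

text \<open>The analytic core. The integrability hypothesis says that \<open>B\<close> is so thin that it does not influence the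
singularities of the transform on the line \<open>Re s = \<theta>\<close>.\<close>

lemma pnt_error_not_sparse:
  fixes \<rho> :: complex and c \<eta> sg :: real
  assumes \<rho>: "zeta_reg \<rho> = 0" "Re \<rho> = 1/2" and c: "0 < c" "c < inverse (norm \<rho>)" and \<eta>: "\<eta> > 0" and sg: "sg = 1 \<or> sg = -1"
  defines "B \<equiv> {u. u \<ge> 0 \<and> sg * log_pnt_error u > c * exp (1/2 * u)}"
  assumes sparse: "integrable lborel (\<lambda>u. indicator B u * exp (\<eta> * u))"
  shows False
proof -
  define Z where "Z = Re ` {s. zeta_reg s = 0}"
  define \<theta> where "\<theta> = Sup Z"
  have Zb: "x \<le> 1" if "x \<in> Z" for x using that zeta_reg_nonzero_Re_gt_1 unfolding Z_def by force
  have bdd: "bdd_above Z" using Zb by (auto simp: bdd_above_def)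
  have Zh: "1/2 \<in> Z" unfolding Z_def using \<rho> by (auto intro!: image_eqI[of _ _ \<rho>])
  have \<theta>1: "1/2 \<le> \<theta>" unfolding \<theta>_def by (rule cSup_upper[OF Zh bdd])
  have \<theta>2: "\<theta> \<le> 1" unfolding \<theta>_def using Zh Zb by (intro cSup_least) auto
  have nz: "zeta_reg s \<noteq> 0" if "Re s > \<theta>" for s
    using that cSup_upper[OF _ bdd, of "Re s"] unfolding \<theta>_def Z_def by force
  have sg2: "sg * sg = 1" "\<bar>sg\<bar> = 1" using sg by auto
  have [measurable]: "B \<in> sets borel" unfolding B_def by measurable
  have pe0: "log_pnt_error u = 0" if "u < 0" for u using that by (simp add: log_pnt_error_def chebyshev_psi_eq_0)
  define E where "E u = indicator {0..} u * exp (1/2 * u)" for u :: real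
  \<comment> \<open>The function \<open>c exp (u / 2) - sg p u\<close> is split into its part \<open>k\<close> on \<open>B\<close> and its nonnegative part \<open>f\<close> off \<open>B\<close>.\<close>
  define k where "k u = indicator B u * (c * E u + - sg * log_pnt_error u)" for u
  define f where "f u = c * E u + - sg * log_pnt_error u - k u" for u
  have f_alt: "f u = (1::real) * (c * E u + - sg * log_pnt_error u) + (-1) * k u" for u by (simp add: f_def)
  have [measurable]: "E \<in> borel_measurable borel" unfolding E_def[abs_def] by measurable
  have [measurable]: "k \<in> borel_measurable borel" unfolding k_def[abs_def] by measurable
  have [measurable]: "f \<in> borel_measurable borel" unfolding f_def[abs_def] by measurable
  have fn: "f u \<ge> 0" for u
    unfolding f_def k_def B_def E_def by (cases "u \<ge> 0") (auto simp: indicator_def pe0)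
  have cE: "laplace_converges E \<sigma>" "laplace E s = 1 / (s - of_real (1/2))" if "\<sigma> > 1/2" "Re s = \<sigma>" for \<sigma> s
    using laplace_exp(1)[of "1/2" \<sigma>] laplace_exp(2)[of "1/2" \<sigma> s] that unfolding E_def[abs_def] by auto
  have cpe: "laplace_converges log_pnt_error \<sigma>" if s: "\<sigma> > \<theta>" for \<sigma>
  proof -
    define a where "a = min ((\<theta> + \<sigma>) / 2) 2"
    have a: "\<theta> < a" "a \<le> 2" "a < \<sigma>" using s \<theta>2 by (auto simp: a_def min_def)
    obtain C where C: "C > 0" "\<And>u. u \<ge> 0 \<Longrightarrow> \<bar>log_pnt_error u\<bar> \<le> C * exp (a * u)"
      using log_pnt_error_bound[OF nz \<theta>1 a(1,2)] by blast
    have "integrable lborel (\<lambda>u. C * ((indicator {0..} u * exp (a * u)) * exp (- \<sigma> * u)))"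
      using laplace_exp(1)[OF a(3)] unfolding laplace_converges_def by (intro integrable_mult_right) auto
    then have "integrable lborel (\<lambda>u. (C * (indicator {0..} u * exp (a * u))) * exp (- \<sigma> * u))"
      by (simp only: mult.assoc)
    then show ?thesis by (rule laplace_converges_bound[rotated 2]) (use C(2) pe0 in auto)
  qed
  have ck: "laplace_converges k \<sigma>" if s: "\<sigma> > \<theta> - \<eta> / 2" for \<sigma>
  proof -
    define a where "a = min (\<theta> + \<eta> / 2) 2"
    have a: "\<theta> < a" "a \<le> 2" "a - \<sigma> \<le> \<eta>" using s \<theta>2 \<eta> by (auto simp: a_def min_def)
    obtain C where C: "C > 0" "\<And>u. u \<ge> 0 \<Longrightarrow> \<bar>log_pnt_error u\<bar> \<le> C * exp (a * u)"
      using log_pnt_error_bound[OF nz \<theta>1 a(1,2)] by blast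
    have kb: "\<bar>k u\<bar> \<le> C * (indicator B u * exp (a * u))" for u
    proof (cases "u \<in> B")
      case True
      then have u: "u \<ge> 0" "sg * log_pnt_error u > c * exp (1/2 * u)" unfolding B_def by auto
      have "0 < c * exp (1/2 * u)" using c by simp
      then have "\<bar>k u\<bar> \<le> \<bar>sg * log_pnt_error u\<bar>" unfolding k_def E_def using u True by simp
      also have "\<dots> = \<bar>log_pnt_error u\<bar>" by (simp add: abs_mult sg2)
      finally show ?thesis using C(2)[OF u(1)] True by simp
    qed (simp add: k_def)
    have I: "integrable lborel (\<lambda>u. (C * (indicator B u * exp (a * u))) * exp (- \<sigma> * u))"
    proof (rule Bochner_Integration.integrable_bound[OF integrable_mult_right[OF sparse, of C]])
      show "AE u in lborel. norm (C * (indicator B u * exp (a * u)) * exp (- \<sigma> * u)) \<le> norm (C * (indicator B u * exp (\<eta> * u)))"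
      proof (rule AE_I2)
        fix u :: real
        show "norm (C * (indicator B u * exp (a * u)) * exp (- \<sigma> * u)) \<le> norm (C * (indicator B u * exp (\<eta> * u)))"
        proof (cases "u \<in> B")
          case True
          then have "u \<ge> 0" unfolding B_def by auto
          then have "(a - \<sigma>) * u \<le> \<eta> * u" by (intro mult_right_mono a)
          then have "exp (a * u) * exp (- \<sigma> * u) \<le> exp (\<eta> * u)" unfolding exp_add[symmetric] by (simp add: left_diff_distrib)
          then show ?thesis using True C(1) by (simp add: abs_mult mult.assoc)
        qed simp
      qed
    qed measurable
    have "k u = 0" if "u < 0" for u using that by (simp add: k_def B_def)
    then show ?thesis by (intro laplace_converges_bound[OF _ _ I] kb) auto
  qed
  have lin1: "laplace_converges (\<lambda>u. c * E u + - sg * log_pnt_error u) \<sigma>" if "\<sigma> > \<theta>" for \<sigma>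
    by (intro laplace_converges_linear cE(1)[of _ "of_real \<sigma>"] cpe) (use that \<theta>1 in auto)
  have cf: "laplace_converges f \<sigma>" if "\<sigma> > \<theta>" for \<sigma>
    unfolding f_alt[abs_def] by (intro laplace_converges_linear(1) lin1 ck) (use that \<eta> in auto)
  define \<Phi> where "\<Phi> s = of_real c / (s - of_real (1/2)) - of_real sg * pnt_error_transform s - laplace k s" for s
  have Lf: "laplace f s = \<Phi> s" if s: "Re s > \<theta>" for s
  proof -
    have "laplace f s = of_real 1 * laplace (\<lambda>u. c * E u + - sg * log_pnt_error u) s + of_real (-1) * laplace k s"
      unfolding f_alt[abs_def] by (rule laplace_converges_linear(2)[OF lin1[OF s] ck refl]) (use s \<eta> in auto)
    also have "laplace (\<lambda>u. c * E u + - sg * log_pnt_error u) s = of_real c * laplace E s + of_real (- sg) * laplace log_pnt_error s"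
      by (rule laplace_converges_linear(2)[OF cE(1) cpe[OF s] refl, of s]) (use s \<theta>1 in auto)
    also have "laplace log_pnt_error s = pnt_error_transform s"
      by (rule laplace_log_pnt_error_extended[OF _ nz cpe s]) (use \<theta>1 in auto)
    finally show ?thesis using cE(2)[of "Re s" s] s \<theta>1 by (simp add: \<Phi>_def)
  qed
  have kh: "laplace k holomorphic_on {s. Re s > \<theta> - \<eta> / 2}" by (rule laplace_holomorphic[OF ck])
  have gr: "zeta_reg (of_real \<theta>) \<noteq> 0" by (rule zeta_reg_real_nonzero) (use \<theta>1 \<theta>2 in auto)
  have "isCont zeta_reg (of_real \<theta>)"
    using zeta_reg_holomorphic holomorphic_on_imp_continuous_on continuous_on_eq_continuous_at open_UNIV by blast
  then obtain r where r: "r > 0" "\<And>s. dist (of_real \<theta>) s < r \<Longrightarrow> zeta_reg s \<noteq> 0"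
    using continuous_at_avoid[of "of_real \<theta>" zeta_reg 0] gr by (metis isCont_def)
  show False
  proof (cases "\<theta> > 1/2")
    case True
    \<comment> \<open>The radius keeps the disc away from the zeros of \<open>\<zeta>\<close>, inside the half plane where the transform of \<open>k\<close> converges, and away from the pole at 1/2.\<close>
    define R where "R = min r (min (\<eta> / 2) (\<theta> - 1/2))"
    have R: "R > 0" "R \<le> r" "R \<le> \<eta> / 2" "R \<le> \<theta> - 1/2"
    proof -
      show "R > 0" unfolding R_def min_less_iff_conj using r \<eta> True by simp
      show "R \<le> r" unfolding R_def by (rule min.cobounded1)
      show "R \<le> \<eta> / 2" unfolding R_def by (rule min.coboundedI2[OF min.cobounded1])
      show "R \<le> \<theta> - 1/2" unfolding R_def by (rule min.coboundedI2[OF min.cobounded2])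
    qed
    have Reb: "Re s > \<theta> - R" if "s \<in> ball (of_real \<theta>) R" for s
      using abs_Re_diff_ball[OF that] by simp
    have h\<Phi>: "\<Phi> holomorphic_on ball (of_real \<theta>) R"
      unfolding \<Phi>_def[abs_def] pnt_error_transform_def
    proof (intro holomorphic_intros holomorphic_on_subset[OF zeta_reg_holomorphic subset_UNIV] holomorphic_deriv open_ball holomorphic_on_subset[OF kh])
      fix z assume z: "z \<in> ball (complex_of_real \<theta>) R"
      have "Re (z - of_real (1/2)) > 0" using Reb[OF z] R(4) by simp
      then show "z - of_real (1/2) \<noteq> 0" by (metis less_irrefl zero_complex.sel(1))
      show "zeta_reg z \<noteq> 0" using z R by (intro r) auto
      show "z \<noteq> 0" using Reb[OF z] R by auto
    next
      show "ball (complex_of_real \<theta>) R \<subseteq> {s. \<theta> - \<eta> / 2 < Re s}" using Reb R by force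
    qed
    have cf': "laplace_converges f (\<theta> - R / 4)"
      by (rule landau_oscillation[OF cf fn R(1) h\<Phi>]) (use Lf in auto)
    have cpe': "laplace_converges log_pnt_error \<sigma>" if s: "\<sigma> > \<theta> - R / 4" for \<sigma>
    proof -
      have s1: "\<sigma> > 1/2" "\<sigma> > \<theta> - \<eta> / 2" using s R by auto
      have "laplace_converges (\<lambda>u. (sg * c) * E u + (- sg) * (1 * f u + 1 * k u)) \<sigma>"
        by (intro laplace_converges_linear(1) cE(1)[OF s1(1) Re_complex_of_real] laplace_converges_mono[OF cf'] ck s1) (use s in auto)
      moreover have "(sg * c) * E u + (- sg) * (1 * f u + 1 * k u) = log_pnt_error u" for u
        unfolding f_def using sg2(1) by (simp add: algebra_simps)
      ultimately show ?thesis by (simp only:)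
    qed
    have "\<exists>x\<in>Z. x > \<theta> - R / 4"
      using R(1) Zh bdd less_cSup_iff[of Z "\<theta> - R / 4"] unfolding \<theta>_def by auto
    then obtain s where "zeta_reg s = 0" "Re s > \<theta> - R / 4" unfolding Z_def by auto
    then show False using zero_free_from_convergence[OF cpe'] by blast
  next
    case False
    then have th: "\<theta> = 1/2" using \<theta>1 by simp
    \<comment> \<open>Since \<open>f\<close> is nonnegative, its transform is largest on the real axis.\<close>
    have norm_le: "norm (of_real \<delta> * \<Phi> (\<rho> + of_real \<delta>)) \<le> norm (of_real \<delta> * \<Phi> (of_real (1/2) + of_real \<delta>))" if \<delta>: "\<delta> > 0" for \<delta> :: real
    proof -
      have R1: "Re (\<rho> + of_real \<delta>) > \<theta>" "Re (of_real (1/2) + of_real \<delta>) > \<theta>" using \<rho> \<delta> th by auto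
      have "norm (laplace f (\<rho> + of_real \<delta>)) \<le> (\<integral>u. norm (of_real (f u) * exp (- (\<rho> + of_real \<delta>) * of_real u)) \<partial>lborel)"
        unfolding laplace_def by (rule integral_norm_bound)
      also have "\<dots> = (\<integral>u. f u * exp (- (1/2 + \<delta>) * u) \<partial>lborel)"
      proof -
        have "Re (\<rho> + of_real \<delta>) = 1/2 + \<delta>" using \<rho> by simp
        then show ?thesis unfolding norm_laplace_integrand by (simp only: abs_of_nonneg[OF fn])
      qed
      also have "\<dots> \<le> norm (complex_of_real \<dots>)" by simp
      also have "complex_of_real (\<integral>u. f u * exp (- (1/2 + \<delta>) * u) \<partial>lborel) = laplace f (of_real (1/2) + of_real \<delta>)"
        unfolding laplace_def integral_complex_of_real[symmetric]
        by (intro Bochner_Integration.integral_cong refl) (simp add: exp_of_real[symmetric])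
      finally show ?thesis unfolding Lf[OF R1(1)] Lf[OF R1(2)] norm_mult by (intro mult_left_mono) auto
    qed
    have lin: "((\<lambda>\<delta>. z + of_real \<delta>) \<longlongrightarrow> z) (at_right (0::real))" for z :: complex
    proof -
      have "((\<lambda>\<delta>. z + of_real \<delta>) \<longlongrightarrow> z + of_real 0) (at_right (0::real))" by (intro tendsto_intros)
      then show ?thesis by simp
    qed
    have d0: "((\<lambda>\<delta>. complex_of_real \<delta>) \<longlongrightarrow> 0) (at_right (0::real))" using lin[of 0] by simp
    have contk: "isCont (laplace k) z" if "Re z = 1/2" for z
    proof -
      have "z \<in> {s. Re s > \<theta> - \<eta> / 2}" using that th \<eta> by simp
      then show ?thesis using holomorphic_on_imp_continuous_on[OF kh] open_Re_gt continuous_on_eq_continuous_at by blast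
    qed
    have limk: "((\<lambda>\<delta>. of_real \<delta> * laplace k (z + of_real \<delta>)) \<longlongrightarrow> 0) (at_right (0::real))" if "Re z = 1/2" for z
      using tendsto_mult[OF d0 isCont_tendsto_compose[OF contk[OF that] lin]] by simp
    have contT: "isCont pnt_error_transform (of_real (1/2))"
    proof -
      have "pnt_error_transform holomorphic_on ball (of_real (1/2)) (min r (1/2))"
        unfolding pnt_error_transform_def[abs_def]
      proof (intro holomorphic_intros holomorphic_on_subset[OF zeta_reg_holomorphic subset_UNIV] holomorphic_deriv open_ball)
        fix z assume z: "z \<in> ball (complex_of_real (1/2)) (min r (1/2))"
        show "zeta_reg z \<noteq> 0" using z by (intro r) (auto simp: th)
        show "z \<noteq> 0" using abs_Re_diff_ball[OF z] by auto
      qed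
      moreover have "of_real (1/2) \<in> ball (complex_of_real (1/2)) (min r (1/2))" using r by simp
      ultimately show ?thesis using holomorphic_on_imp_continuous_on continuous_on_eq_continuous_at open_ball by blast
    qed
    have lim1: "((\<lambda>\<delta>. of_real \<delta> * \<Phi> (of_real (1/2) + of_real \<delta>)) \<longlongrightarrow> of_real c) (at_right (0::real))"
    proof -
      let ?L = "\<lambda>\<delta>::real. of_real c - of_real sg * (of_real \<delta> * pnt_error_transform (of_real (1/2) + of_real \<delta>)) - of_real \<delta> * laplace k (of_real (1/2) + of_real \<delta>)"
      have "((\<lambda>\<delta>. ?L \<delta>)
         \<longlongrightarrow> of_real c - of_real sg * (0 * pnt_error_transform (of_real (1/2))) - 0) (at_right (0::real))"
        by (intro tendsto_intros d0 limk isCont_tendsto_compose[OF contT lin]) simp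
      moreover have "\<forall>\<^sub>F \<delta> in at_right (0::real). ?L \<delta>
         = of_real \<delta> * \<Phi> (of_real (1/2) + of_real \<delta>)"
        using eventually_at_right_less[of "0::real"]
        by eventually_elim (simp add: \<Phi>_def right_diff_distrib)
      ultimately show ?thesis using Lim_transform_eventually by fastforce
    qed
    have \<rho>0: "\<rho> \<noteq> 0" using \<rho> by auto
    obtain n :: nat where n: "n > 0" "((\<lambda>\<delta>. of_real \<delta> * (deriv zeta_reg (\<rho> + of_real \<delta>) / zeta_reg (\<rho> + of_real \<delta>))) \<longlongrightarrow> of_nat n) (at_right (0::real))"
      using log_deriv_simple_pole[OF zeta_reg_holomorphic \<rho>(1) gr] by blast
    define D where "D \<delta> = deriv zeta_reg (\<rho> + of_real \<delta>) / zeta_reg (\<rho> + of_real \<delta>)" for \<delta> :: real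
    have lim2: "((\<lambda>\<delta>. of_real \<delta> * \<Phi> (\<rho> + of_real \<delta>)) \<longlongrightarrow> of_real sg * (of_nat n / \<rho>)) (at_right (0::real))"
    proof (cases "\<rho> = of_real (1/2)")
      case True
      then show ?thesis using gr \<rho>(1) unfolding th by blast
    next
      case False
      then have ne: "\<rho> - of_real (1/2) \<noteq> 0" by simp
      let ?L = "\<lambda>\<delta>::real. of_real \<delta> * (of_real c / (\<rho> + of_real \<delta> - of_real (1/2))) + of_real sg * ((of_real \<delta> + of_real \<delta> * D \<delta>) / (\<rho> + of_real \<delta>)) - of_real \<delta> * laplace k (\<rho> + of_real \<delta>)"
      have "((\<lambda>\<delta>. ?L \<delta>)
         \<longlongrightarrow> 0 * (of_real c / (\<rho> - of_real (1/2))) + of_real sg * ((0 + of_nat n) / \<rho>) - 0) (at_right (0::real))"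
        by (intro tendsto_intros d0 limk lin n(2)[folded D_def] ne \<rho>0 \<rho>(2))
      moreover have "?L \<delta>
         = of_real \<delta> * \<Phi> (\<rho> + of_real \<delta>)" for \<delta>
      proof -
        have "of_real \<delta> * pnt_error_transform (\<rho> + of_real \<delta>) = - ((of_real \<delta> + of_real \<delta> * D \<delta>) / (\<rho> + of_real \<delta>))"
        proof -
          have "d * (- (1 + w) / z) = - ((d + d * w) / z)" for d w z :: complex
            by (cases "z = 0") (simp_all add: field_simps)
          then show ?thesis unfolding pnt_error_transform_def D_def .
        qed
        moreover have "of_real \<delta> * \<Phi> (\<rho> + of_real \<delta>) = of_real \<delta> * (of_real c / (\<rho> + of_real \<delta> - of_real (1/2))) -
           of_real sg * (of_real \<delta> * pnt_error_transform (\<rho> + of_real \<delta>)) - of_real \<delta> * laplace k (\<rho> + of_real \<delta>)"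
          unfolding \<Phi>_def right_diff_distrib by (simp only: mult.left_commute)
        ultimately show ?thesis by (simp only: mult_minus_right diff_minus_eq_add)
      qed
      ultimately show ?thesis by simp
    qed
    have "norm (of_real sg * (of_nat n / \<rho>)) \<le> norm (complex_of_real c)"
    proof (rule tendsto_le[OF _ tendsto_norm[OF lim1] tendsto_norm[OF lim2]])
      show "\<forall>\<^sub>F \<delta> in at_right 0. norm (of_real \<delta> * \<Phi> (\<rho> + of_real \<delta>)) \<le> norm (of_real \<delta> * \<Phi> (of_real (1/2) + of_real \<delta>))"
        using eventually_at_right_less[of "0::real"] by eventually_elim (rule norm_le)
    qed simp
    then have "real n / norm \<rho> \<le> c" using sg2 c by (simp add: norm_mult norm_divide)
    moreover have "1 / norm \<rho> \<le> real n / norm \<rho>" using n(1) by (intro divide_right_mono) auto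
    ultimately show False using c by (simp add: inverse_eq_divide)
  qed
qed

section \<open>From dyadic measure bounds to convergence\<close>

text \<open>The halved last term only matters on a countable set.\<close>

lemma sum_star_mangoldt:
  "x \<notin> \<nat> \<Longrightarrow> sum_star mangoldt x = chebyshev_psi x"
  by (simp add: sum_star_def chebyshev_psi_def)

text \<open>The negation of \<open>is_Omega\<close> says that the quotient tends to 0; that it is eventually below 1 is all that is
kept.\<close>

lemma not_is_Omega_bound:
  assumes "\<not> is_Omega f g" and g: "\<And>T. T > 0 \<Longrightarrow> g T > 0"
  shows "\<exists>T0\<ge>1. \<forall>T\<ge>T0. \<bar>f T\<bar> \<le> g T"
proof -
  have "Limsup at_top (\<lambda>T. ereal (\<bar>f T\<bar> / g T)) \<le> 0" using assms(1) unfolding is_Omega_def by (simp add: not_less)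
  also have "(0::ereal) < 1" by simp
  finally have "\<forall>\<^sub>F T in at_top. ereal (\<bar>f T\<bar> / g T) < 1" by (intro Limsup_lessD)
  then obtain T1 where T1: "\<And>T. T \<ge> T1 \<Longrightarrow> ereal (\<bar>f T\<bar> / g T) < 1"
    unfolding eventually_at_top_linorder by blast
  show ?thesis
  proof (intro exI[of _ "max 1 T1"] conjI allI impI)
    fix T assume T: "max 1 T1 \<le> T"
    then have "\<bar>f T\<bar> / g T < 1" using T1[of T] by simp
    then show "\<bar>f T\<bar> \<le> g T" using g[of T] T by (simp add: divide_less_eq)
  qed simp
qed

text \<open>After the substitution \<open>x = exp u\<close>, the block over \<open>[T, 2 T]\<close> contributes at most
\<open>T powr (\<eta> - 1) * T powr (1 - \<epsilon>)\<close>; summed over \<open>T = T0 * 2 ^ k\<close> this is a geometric series.\<close>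

lemma sparse_dyadic_integrable:
  fixes S :: "real set"
  assumes [measurable]: "S \<in> sets borel" and T0: "T0 \<ge> 1"
    and S: "\<And>T. T \<ge> T0 \<Longrightarrow> emeasure lborel (S \<inter> {T..2 * T}) \<le> ennreal (T powr (1 - \<epsilon>))"
    and \<eta>: "0 < \<eta>" "\<eta> < \<epsilon>" "\<eta> \<le> 1"
  shows "integrable lborel (\<lambda>u. indicator {u. u \<ge> 0 \<and> exp u \<in> S} u * exp (\<eta> * u))"
proof -
  define B where "B = {u. u \<ge> 0 \<and> exp u \<in> S}"
  have B[measurable]: "B \<in> sets borel" unfolding B_def by measurable
  define T where "T k = T0 * 2 ^ k" for k :: nat
  let ?i = "\<lambda>u. ennreal (exp (\<eta> * ln T0)) * indicator {0..ln T0} u"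
  let ?b = "\<lambda>k u. ennreal (indicator B u * exp (\<eta> * u)) * indicator {ln (T k)..ln (T (Suc k))} u"
  have T: "T k \<ge> T0" "T k > 0" "T (Suc k) = 2 * T k" for k
  proof -
    have "T0 * 1 \<le> T0 * 2 ^ k" using T0 by (intro mult_left_mono) auto
    then show "T k \<ge> T0" by (simp add: T_def)
    then show "T k > 0" using T0 by linarith
  qed (simp add: T_def)
  have block: "(\<integral>\<^sup>+u. ?b k u \<partial>lborel) \<le> ennreal (T k powr (\<eta> - \<epsilon>))" for k
  proof -
    define F where "F x = indicator S x * x powr (\<eta> - 1)" for x :: real
    have [measurable]: "F \<in> borel_measurable borel" unfolding F_def[abs_def] by measurable
    have le: "ln (T k) \<le> ln (T (Suc k))" using T[of k] by simp
    have lnn: "ln (T k) \<ge> 0" using T[of k] T0 by simp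
    have "(\<integral>\<^sup>+u. ?b k u \<partial>lborel)
       = (\<integral>\<^sup>+u. ennreal (F (exp u) * exp u * indicator {ln (T k)..ln (T (Suc k))} u) \<partial>lborel)"
    proof (rule nn_integral_cong)
      fix u :: real
      have "exp u powr (\<eta> - 1) * exp u = exp (\<eta> * u)"
        by (simp add: powr_def left_diff_distrib flip: exp_add)
      then show "?b k u = ennreal (F (exp u) * exp u * indicator {ln (T k)..ln (T (Suc k))} u)"
        using lnn by (auto simp: F_def B_def indicator_def)
    qed
    also have "\<dots> = (\<integral>\<^sup>+x. ennreal (F x * indicator {exp (ln (T k))..exp (ln (T (Suc k)))} x) \<partial>lborel)"
      by (rule nn_integral_substitution[symmetric])
         (use le in \<open>auto intro!: derivative_eq_intros continuous_intros simp: set_borel_measurable_def\<close>)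
    also have "\<dots> = (\<integral>\<^sup>+x. ennreal (F x * indicator {T k..2 * T k} x) \<partial>lborel)"
      using T[of k] T[of "Suc k"] by simp
    also have "\<dots> \<le> (\<integral>\<^sup>+x. ennreal (T k powr (\<eta> - 1)) * indicator (S \<inter> {T k..2 * T k}) x \<partial>lborel)"
    proof (rule nn_integral_mono)
      fix x :: real
      show "ennreal (F x * indicator {T k..2 * T k} x) \<le> ennreal (T k powr (\<eta> - 1)) * indicator (S \<inter> {T k..2 * T k}) x"
      proof (cases "x \<in> S \<inter> {T k..2 * T k}")
        case True
        then have "x powr (\<eta> - 1) \<le> T k powr (\<eta> - 1)" using T[of k] \<eta> by (intro powr_mono2') auto
        then show ?thesis using True by (simp add: F_def ennreal_leI)
      qed (auto simp: F_def indicator_def)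
    qed
    also have "\<dots> = ennreal (T k powr (\<eta> - 1)) * emeasure lborel (S \<inter> {T k..2 * T k})"
      by (rule nn_integral_cmult_indicator) simp
    also have "\<dots> \<le> ennreal (T k powr (\<eta> - 1)) * ennreal (T k powr (1 - \<epsilon>))"
      by (intro mult_left_mono S T) simp
    also have "\<dots> = ennreal (T k powr (\<eta> - \<epsilon>))"
      by (simp flip: ennreal_mult powr_add)
    finally show ?thesis .
  qed
  have Tp: "T k powr (\<eta> - \<epsilon>) = T0 powr (\<eta> - \<epsilon>) * (2 powr (\<eta> - \<epsilon>)) ^ k" for k
    unfolding T_def using T0 by (simp add: powr_mult powr_realpow[symmetric] powr_powr mult.commute)
  have q: "norm ((2::real) powr (\<eta> - \<epsilon>)) < 1" using \<eta> powr_less_mono[of "\<eta> - \<epsilon>" 0 "2::real"] by simp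
  have sumT: "summable (\<lambda>k. T k powr (\<eta> - \<epsilon>))"
    unfolding Tp by (intro summable_mult summable_geometric q)
  have "(\<integral>\<^sup>+u. ennreal (indicator B u * exp (\<eta> * u)) \<partial>lborel) \<le>
     (\<integral>\<^sup>+u. ?i u + (\<Sum>k. ?b k u) \<partial>lborel)"
  proof (rule nn_integral_mono)
    fix u :: real
    consider "u \<notin> B" | "u \<in> B" "u \<le> ln T0" | "u \<in> B" "u > ln T0" by linarith
    then show "ennreal (indicator B u * exp (\<eta> * u)) \<le> ?i u + (\<Sum>k. ?b k u)"
    proof cases
      case 1 then show ?thesis by simp
    next
      case 2
      then have "u \<ge> 0" by (simp add: B_def)
      moreover have "ennreal (exp (\<eta> * u)) \<le> ennreal (exp (\<eta> * ln T0))" using 2 \<eta> by (intro ennreal_leI) simp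
      ultimately show ?thesis using 2 by (simp add: add_increasing2)
    next
      case 3
      have "\<exists>k. exp u < T k"
      proof -
        obtain k where "exp u < 2 ^ k" using real_arch_pow[of 2 "exp u"] by auto
        also have "1 * 2 ^ k \<le> T k" unfolding T_def using T0 by (intro mult_right_mono) auto
        finally show ?thesis by auto
      qed
      define k where "k = (LEAST k. exp u < T k)"
      have k: "exp u < T k" unfolding k_def by (rule LeastI_ex[OF \<open>\<exists>k. exp u < T k\<close>])
      have k': "T j \<le> exp u" if "j < k" for j
        using not_less_Least[of j "\<lambda>k. exp u < T k"] that unfolding k_def not_less by blast
      have "T0 < exp u" using 3 T0 by (metis exp_ln exp_less_cancel_iff less_le_trans zero_less_one)
      then have "k \<noteq> 0" using k by (intro notI) (simp add: T_def)
      then obtain j where j: "k = Suc j" by (cases k) auto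
      have "ln (T j) \<le> ln (exp u)" using k'[of j] j T(2)[of j] by (subst ln_le_cancel_iff) auto
      then have "ln (T j) \<le> u" by simp
      moreover have "u \<le> ln (T (Suc j))" using k j T(2)[of "Suc j"] by (simp add: ln_ge_iff less_imp_le)
      ultimately have "ennreal (indicator B u * exp (\<eta> * u)) = (\<Sum>k\<in>{j}. ?b k u)"
        by simp
      also have "\<dots> \<le> (\<Sum>k. ?b k u)"
        by (rule sum_le_suminf) auto
      finally show ?thesis by (simp add: add_increasing)
    qed
  qed
  also have "\<dots> = (\<integral>\<^sup>+u. ?i u \<partial>lborel) + (\<Sum>k. \<integral>\<^sup>+u. ?b k u \<partial>lborel)"
  proof -
    have "(\<integral>\<^sup>+u. (\<Sum>k. ?b k u) \<partial>lborel)
      = (\<Sum>k. \<integral>\<^sup>+u. ?b k u \<partial>lborel)"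
      by (rule nn_integral_suminf) measurable
    moreover have "(\<integral>\<^sup>+u. ?i u + (\<Sum>k. ?b k u) \<partial>lborel)
      = (\<integral>\<^sup>+u. ?i u \<partial>lborel) + (\<integral>\<^sup>+u. (\<Sum>k. ?b k u) \<partial>lborel)"
      by (rule nn_integral_add) measurable
    ultimately show ?thesis by (simp only:)
  qed
  also have "\<dots> \<le> ennreal (exp (\<eta> * ln T0)) * ennreal (ln T0) + (\<Sum>k. ennreal (T k powr (\<eta> - \<epsilon>)))"
  proof (rule add_mono)
    show "(\<integral>\<^sup>+u. ?i u \<partial>lborel) \<le> ennreal (exp (\<eta> * ln T0)) * ennreal (ln T0)"
      using T0 by (subst nn_integral_cmult_indicator) auto
  qed (intro suminf_le block summableI)
  also have "\<dots> < \<infinity>"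
  proof -
    have "(\<Sum>k. ennreal (T k powr (\<eta> - \<epsilon>))) = ennreal (\<Sum>k. T k powr (\<eta> - \<epsilon>))"
      by (rule suminf_ennreal_eq[OF _ summable_sums[OF sumT]]) simp
    then show ?thesis by (simp only:) (simp add: ennreal_mult_less_top)
  qed
  finally have fin: "(\<integral>\<^sup>+u. ennreal (indicator B u * exp (\<eta> * u)) \<partial>lborel) < \<infinity>" .
  have "integrable lborel (\<lambda>u. indicator B u * exp (\<eta> * u))"
    by (rule integrableI_nonneg) (use fin in auto)
  then show ?thesis unfolding B_def .
qed

theorem proposition1:
  fixes s0 :: complex and lambda2 \<epsilon>0 :: real and A1 A2 :: "real set"
  assumes zero: "nontrivial_zeta_zero (2 * s0)" "Im (2 * s0) > 0"
    and least: "\<And>\<rho>. nontrivial_zeta_zero \<rho> \<Longrightarrow> Im \<rho> > 0 \<Longrightarrow> Im (2 * s0) \<le> Im \<rho>"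
    and val: "Re (2 * s0) = 1 / 2" "14.134 \<le> Im (2 * s0)" "Im (2 * s0) < 14.135"
    and lambda2: "lambda2 = inverse (cmod (2 * s0))"
    and \<epsilon>0: "0 < \<epsilon>0" "\<epsilon>0 < lambda2"
    and A1: "A1 = {x. x > 0 \<and> pnt_error x > (lambda2 - \<epsilon>0) * x powr (1 / 2)}"
    and A2: "A2 = {x. x > 0 \<and> pnt_error x < (- lambda2 + \<epsilon>0) * x powr (1 / 2)}"
  shows "\<forall>A \<in> {A1, A2}. \<forall>\<epsilon>>0.
           is_Omega (\<lambda>T. measure lebesgue (A \<inter> {T..2 * T})) (\<lambda>T. T powr (1 - \<epsilon>))"
proof (intro ballI allI impI)
  fix A and \<epsilon> :: real
  assume "A \<in> {A1, A2}" and \<epsilon>: "\<epsilon> > 0"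
  define c where "c = lambda2 - \<epsilon>0"
  have c: "0 < c" "c < inverse (cmod (2 * s0))" using \<epsilon>0 lambda2 by (auto simp: c_def)
  have zr: "zeta_reg (2 * s0) = 0"
    using zero(1) unfolding nontrivial_zeta_zero_def zeta_reg_def by simp
  \<comment> \<open>With this sign both sets take the same form.\<close>
  define sg :: real where "sg = (if A = A1 then 1 else -1)"
  have sg: "sg = 1 \<or> sg = -1" by (simp add: sg_def)
  have A: "A = {x. x > 0 \<and> sg * pnt_error x > c * x powr (1 / 2)}"
  proof (cases "A = A1")
    case True
    then show ?thesis by (simp add: sg_def A1 c_def)
  next
    case False
    then have "A = A2" using \<open>A \<in> {A1, A2}\<close> by simp
    moreover have "pnt_error x < (- lambda2 + \<epsilon>0) * x powr (1 / 2) \<longleftrightarrow> - 1 * pnt_error x > c * x powr (1 / 2)" for x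
      unfolding c_def left_diff_distrib distrib_right by auto
    ultimately show ?thesis using False by (simp only: sg_def A2 if_False)
  qed
  show "is_Omega (\<lambda>T. measure lebesgue (A \<inter> {T..2 * T})) (\<lambda>T. T powr (1 - \<epsilon>))"
  proof (rule ccontr)
    assume "\<not> is_Omega (\<lambda>T. measure lebesgue (A \<inter> {T..2 * T})) (\<lambda>T. T powr (1 - \<epsilon>))"
    from not_is_Omega_bound[OF this] obtain T0 where T0: "T0 \<ge> 1"
      "\<And>T. T \<ge> T0 \<Longrightarrow> \<bar>measure lebesgue (A \<inter> {T..2 * T})\<bar> \<le> T powr (1 - \<epsilon>)"
      by auto
    define S where "S = {x. x > 0 \<and> sg * (chebyshev_psi x - x) > c * x powr (1 / 2)}"
    have [measurable]: "S \<in> sets borel" unfolding S_def by measurable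
    have neg: "negligible (\<nat> :: real set)"
    proof -
      have "countable (\<nat> :: real set)" unfolding Nats_def by (rule countable_image) simp
      then have "\<nat> \<in> null_sets (lborel :: real measure)" by (rule countable_imp_null_set_lborel)
      then show ?thesis unfolding negligible_iff_null_sets by (rule null_sets_completionI)
    qed
    have S: "emeasure lborel (S \<inter> {T..2 * T}) \<le> ennreal (T powr (1 - \<epsilon>))" if T: "T \<ge> T0" for T
    proof -
      have sb: "S \<inter> {T..2 * T} \<in> sets lborel" by measurable
      have "bounded (S \<inter> {T..2 * T})" by (rule bounded_subset[OF bounded_closed_interval]) blast
      then have lm: "S \<inter> {T..2 * T} \<in> lmeasurable"
        by (rule bounded_set_imp_lmeasurable) (rule sets_completionI_sets[OF sb])
      have "S \<inter> {T..2 * T} - A \<inter> {T..2 * T} \<union> (A \<inter> {T..2 * T} - S \<inter> {T..2 * T}) \<subseteq> \<nat>"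
      proof
        fix x assume x: "x \<in> S \<inter> {T..2 * T} - A \<inter> {T..2 * T} \<union> (A \<inter> {T..2 * T} - S \<inter> {T..2 * T})"
        have "x \<in> A \<longleftrightarrow> x \<in> S" if "x \<notin> \<nat>"
          unfolding A S_def pnt_error_def mem_Collect_eq sum_star_mangoldt[OF that] ..
        then show "x \<in> \<nat>" using x by blast
      qed
      then have eqm: "measure lebesgue (A \<inter> {T..2 * T}) = measure lebesgue (S \<inter> {T..2 * T})"
        by (rule measure_negligible_symdiff[OF lm negligible_subset[OF neg]])
      have "measure lebesgue (S \<inter> {T..2 * T}) \<le> T powr (1 - \<epsilon>)"
        using T0(2)[OF T] unfolding eqm by (rule order_trans[OF abs_ge_self])
      then have "emeasure lebesgue (S \<inter> {T..2 * T}) \<le> ennreal (T powr (1 - \<epsilon>))"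
        unfolding emeasure_eq_measure2[OF lm] by (rule ennreal_leI)
      moreover have "emeasure lebesgue (S \<inter> {T..2 * T}) = emeasure lborel (S \<inter> {T..2 * T})"
        using sb by simp
      ultimately show ?thesis by (simp only:)
    qed
    define \<eta> where "\<eta> = min (\<epsilon> / 2) 1"
    have \<eta>: "0 < \<eta>" "\<eta> < \<epsilon>" "\<eta> \<le> 1" using \<epsilon> by (auto simp: \<eta>_def min_def)
    have "{u. u \<ge> 0 \<and> exp u \<in> S} = {u. u \<ge> 0 \<and> sg * log_pnt_error u > c * exp (1/2 * u)}"
      by (auto simp: S_def log_pnt_error_def powr_def)
    with sparse_dyadic_integrable[OF _ T0(1) S \<eta>]
    have "integrable lborel (\<lambda>u. indicator {u. u \<ge> 0 \<and> sg * log_pnt_error u > c * exp (1/2 * u)} u * exp (\<eta> * u))"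
      by simp
    then show False by (rule pnt_error_not_sparse[OF zr val(1) c \<eta>(1) sg])
  qed
qed

end
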